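(* Let $p>0$ and $K\ge 1$, and let $f:\mathbb{C}\to\mathbb{C}$ be a homeomorphism with $p$-exponentially integrable distortion which is $K$-quasiconformal in the unit disk $\mathbb{D}$. Then for every $\varepsilon>0$ there exists a constant $c>0$ such that $$|f(z)-f(w)|\ge c\,|z-w|^{2K(1+\varepsilon)}\qquad\text{for all } z,w\in\overline{\mathbb{D}}.$$
   Context: Finite distortion: a sense-preserving homeomorphism $f:\Omega_1\to\Omega_2$ between planar domains has finite distortion if $f\in W^{1,1}_{\mathrm{loc}}(\Omega_1)$, the Jacobian $J_f\in L^1_{\mathrm{loc}}(\Omega_1)$, and $|Df(z)|^2\le K(z)J_f(z)$ a.e. for some measurable function $K(\cdot)\ge 1$ that is finite a.e., where $|Df(z)|=\max\{|Df(z)e|:|e|=1\}$. The smallest such function is denoted $K_f(z)$ and called the distortion of $f$. The map has $p$-exponentially integrable distortion ($p>0$) if it has finite distortion and $e^{pK_f}\in L^1_{\mathrm{loc}}(\Omega_1)$. $f$ is $K$-quasiconformal in $\mathbb{D}$ if its restriction to $\mathbb{D}$ is a sense-preserving homeomorphism onto its image, belongs to $W^{1,2}_{\mathrm{loc}}(\mathbb{D})$ and satisfies $|Df(z)|^2\le KJ_f(z)$ for a.e. $z\in\mathbb{D}$. *)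

theory Defs
  imports "HOL-Complex_Analysis.Complex_Analysis"
begin

text \<open>
  The winding number condition expresses that the homeomorphism has local degree \<open>+1\<close> (rather than
  \<open>-1\<close>) at every point; \<open>circlepath\<close> runs counterclockwise.
\<close>

definition sense_preserving_homeomorphism ::
    "complex set \<Rightarrow> complex set \<Rightarrow> (complex \<Rightarrow> complex) \<Rightarrow> bool" where
  "sense_preserving_homeomorphism \<Omega>1 \<Omega>2 f \<longleftrightarrow>
     open \<Omega>1 \<and> connected \<Omega>1 \<and> \<Omega>1 \<noteq> {} \<and>
     open \<Omega>2 \<and> connected \<Omega>2 \<and> \<Omega>2 \<noteq> {} \<and>
     (\<exists>g. homeomorphism \<Omega>1 \<Omega>2 f g) \<and>
     (\<forall>z r. 0 < r \<and> cball z r \<subseteq> \<Omega>1 \<longrightarrow> winding_number (f \<circ> circlepath z r) (f z) = 1)"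

definition Lq_loc :: "real \<Rightarrow> complex set \<Rightarrow> (complex \<Rightarrow> 'b::euclidean_space) \<Rightarrow> bool" where
  "Lq_loc q \<Omega> u \<longleftrightarrow>
     u \<in> borel_measurable (lebesgue_on \<Omega>) \<and>
     (\<forall>C. compact C \<and> C \<subseteq> \<Omega> \<longrightarrow> set_integrable lebesgue C (\<lambda>z. norm (u z) powr q))"

primrec Ck :: "nat \<Rightarrow> (complex \<Rightarrow> real) \<Rightarrow> bool" where
  "Ck 0 \<phi> \<longleftrightarrow> continuous_on UNIV \<phi>"
| "Ck (Suc k) \<phi> \<longleftrightarrow>
     \<phi> differentiable_on UNIV \<and> (\<forall>e. Ck k (\<lambda>z. frechet_derivative \<phi> (at z) e))"

definition test_functions :: "complex set \<Rightarrow> (complex \<Rightarrow> real) set" where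
  "test_functions \<Omega> =
     {\<phi>. (\<forall>k. Ck k \<phi>) \<and> compact (closure {z. \<phi> z \<noteq> 0}) \<and> closure {z. \<phi> z \<noteq> 0} \<subseteq> \<Omega>}"

text \<open>
  \<open>W1q_loc q \<Omega> f Df\<close> states that \<open>f\<close> lies in \<open>W\<^bsup>1,q\<^esup>\<^bsub>loc\<^esub>(\<Omega>)\<close> and that \<open>Df\<close> is (a representative of)
  its weak derivative, which is unique up to null sets. As \<open>Df z\<close> is a bounded linear map of the
  real plane, \<open>norm (Df z)\<close> is its operator norm.
\<close>

definition W1q_loc ::
    "real \<Rightarrow> complex set \<Rightarrow> (complex \<Rightarrow> complex) \<Rightarrow> (complex \<Rightarrow> complex \<Rightarrow>\<^sub>L complex) \<Rightarrow> bool" where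
  "W1q_loc q \<Omega> f Df \<longleftrightarrow>
     Lq_loc q \<Omega> f \<and>
     (\<forall>e. Lq_loc q \<Omega> (\<lambda>z. blinfun_apply (Df z) e)) \<and>
     (\<forall>e. \<forall>\<phi>\<in>test_functions \<Omega>.
        (LINT z:\<Omega>|lebesgue. frechet_derivative \<phi> (at z) e *\<^sub>R f z) =
        - (LINT z:\<Omega>|lebesgue. \<phi> z *\<^sub>R blinfun_apply (Df z) e))"

text \<open>The determinant of a real-linear map of the plane in the basis \<open>1, \<i>\<close>.\<close>

definition jacobian :: "(complex \<Rightarrow>\<^sub>L complex) \<Rightarrow> real" where
  "jacobian A =
     Re (blinfun_apply A 1) * Im (blinfun_apply A \<i>) - Re (blinfun_apply A \<i>) * Im (blinfun_apply A 1)"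

text \<open>
  The functions \<open>K\<close> admissible in the definition of finite distortion. Since they only matter up to
  null sets, functions that are finite almost everywhere are taken to be real-valued.
\<close>

definition distortion_bound :: "complex set \<Rightarrow> (complex \<Rightarrow> complex) \<Rightarrow> (complex \<Rightarrow> real) \<Rightarrow> bool" where
  "distortion_bound \<Omega> f K \<longleftrightarrow>
     K \<in> borel_measurable (lebesgue_on \<Omega>) \<and> (\<forall>z\<in>\<Omega>. 1 \<le> K z) \<and>
     (\<exists>Df. W1q_loc 1 \<Omega> f Df \<and> Lq_loc 1 \<Omega> (\<lambda>z. jacobian (Df z)) \<and>
        (AE z in lebesgue_on \<Omega>. (norm (Df z))\<^sup>2 \<le> K z * jacobian (Df z)))"

definition finite_distortion ::
    "complex set \<Rightarrow> complex set \<Rightarrow> (complex \<Rightarrow> complex) \<Rightarrow> bool" where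
  "finite_distortion \<Omega>1 \<Omega>2 f \<longleftrightarrow>
     sense_preserving_homeomorphism \<Omega>1 \<Omega>2 f \<and> (\<exists>K. distortion_bound \<Omega>1 f K)"

text \<open>\<open>is_distortion \<Omega> f K\<close> states that \<open>K\<close> is a representative of the distortion \<open>K\<^sub>f\<close>.\<close>

definition is_distortion :: "complex set \<Rightarrow> (complex \<Rightarrow> complex) \<Rightarrow> (complex \<Rightarrow> real) \<Rightarrow> bool" where
  "is_distortion \<Omega> f K \<longleftrightarrow>
     distortion_bound \<Omega> f K \<and>
     (\<forall>K'. distortion_bound \<Omega> f K' \<longrightarrow> (AE z in lebesgue_on \<Omega>. K z \<le> K' z))"

definition exp_integrable_distortion ::
    "real \<Rightarrow> complex set \<Rightarrow> complex set \<Rightarrow> (complex \<Rightarrow> complex) \<Rightarrow> bool" where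
  "exp_integrable_distortion p \<Omega>1 \<Omega>2 f \<longleftrightarrow>
     finite_distortion \<Omega>1 \<Omega>2 f \<and>
     (\<exists>K. is_distortion \<Omega>1 f K \<and> Lq_loc 1 \<Omega>1 (\<lambda>z. exp (p * K z)))"

definition quasiconformal_in :: "real \<Rightarrow> complex set \<Rightarrow> (complex \<Rightarrow> complex) \<Rightarrow> bool" where
  "quasiconformal_in K \<Omega> f \<longleftrightarrow>
     sense_preserving_homeomorphism \<Omega> (f ` \<Omega>) f \<and>
     (\<exists>Df. W1q_loc 2 \<Omega> f Df \<and>
        (AE z in lebesgue_on \<Omega>. (norm (Df z))\<^sup>2 \<le> K * jacobian (Df z)))"

end

theory Submission
  imports Defs
begin

text \<open>
  Let \<open>d = norm (z - w)\<close>, \<open>\<delta> = norm (f z - f w)\<close> and \<open>L = ln (R / \<delta>)\<close>, where \<open>R\<close> bounds from below the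
  displacement of \<open>f\<close> on a circle of fixed radius about \<open>z\<close>. The function
  \<open>u = ln (max (norm (f - f z)) \<delta>)\<close> grows by \<open>L\<close> from its minimum to that circle, while the area
  inequality bounds the integral of \<open>(norm (D u))\<^sup>2 / K\<^sub>f\<close> by \<open>2 * pi * L + O(1)\<close>. The minimum is attained on every circle about \<open>z\<close>
  of radius at most \<open>d\<close>, because the preimage of the segment from \<open>f z\<close> to \<open>f w\<close> meets it. Exponential
  integrability of \<open>K\<^sub>f\<close> provides a radius between \<open>d powr (1 + \<kappa>)\<close> and \<open>d\<close> such that \<open>u\<close> oscillates by at most
  \<open>\<kappa> * L\<close> on the whole circle, including its part outside the disk. From this circle one moves
  radially inside a sector of the disk with opening nearly \<open>pi\<close>, where \<open>K\<^sub>f \<le> K\<close>; the Cauchy-Schwarz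
  inequality gives \<open>pi * L\<^sup>2 \<le> K * (2 * pi * L) * ln (1 / d)\<close> up to factors close to 1, which is the
  exponent \<open>2 * K\<close>.
\<close>

section \<open>The area formula in the plane\<close>

text \<open>The exponent is \<open>2 * K\<close> rather than \<open>K\<close> because a point of the
  unit circle sees the disk only in a sector whose opening O is below pi, whereas the energy of the
  image is bounded only by that of a full ring. With l = ln (1/d) the length-area estimate is
  essentially O^2 L^2 \<le> K (l O) (2 pi L), that is, L \<le> (2 pi / O) K l. Off the disk the
  distortion has no pointwise bound. Exponential integrability with any p > 0 still bounds its
  integral over the logarithmic ring between d^(1+\<kappa>) and d by C l^2. Oscillation above
  \<kappa> L on every circle of that ring would give \<kappa>^4 l^2 L^2 \<le> C l^2 L with a new
  constant C, hence a bound on L independent of d; when L is bounded the claim is trivial.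
  Truncation at \<delta> keeps the logarithm Lipschitz and the energy finite. As \<open>f\<close> is
  only in W^(1,1) on the plane, derivatives are found along almost every coordinate line and then
  within countably many pieces. The Jacobian is controlled from above by area in the image, which is
  the direction that the energy bound uses.\<close>

lemma nn_integral_eq_if_integrable_iff:
  fixes u :: "'a \<Rightarrow> real" and v :: "'b \<Rightarrow> real"
  assumes [measurable]: "u \<in> borel_measurable M" "v \<in> borel_measurable N"
    and nonneg: "\<And>x. 0 \<le> u x" "\<And>x. 0 \<le> v x"
    and iff: "\<And>b. integrable M u \<and> integral\<^sup>L M u = b \<longleftrightarrow> integrable N v \<and> integral\<^sup>L N v = b"
  shows "(\<integral>\<^sup>+x. ennreal (u x) \<partial>M) = (\<integral>\<^sup>+x. ennreal (v x) \<partial>N)"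
proof (cases "integrable M u")
  case True
  then have "integrable N v" "integral\<^sup>L M u = integral\<^sup>L N v"
    using iff by blast+
  with True show ?thesis
    by (simp add: nn_integral_eq_integral nonneg)
next
  case False
  then have "\<not> integrable N v"
    using iff by blast
  with False show ?thesis
    by (simp add: integrable_iff_bounded nonneg less_top[symmetric])
qed

text \<open>The classical theorem is an equivalence between two statements "absolutely integrable
  with integral b". For nonnegative integrands this becomes one equation between extended integrals,
  with both sides infinite when integrability fails.\<close>

lemma nn_integral_change_of_variables_vec:
  fixes f :: "real^'m::{finite,wellorder} \<Rightarrow> real" and g :: "real^'m::_ \<Rightarrow> real^'m::_"
  assumes S: "S \<in> sets lebesgue"
    and der: "\<And>x. x \<in> S \<Longrightarrow> (g has_derivative g' x) (at x within S)"
    and inj: "inj_on g S"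
    and f [measurable]: "f \<in> borel_measurable borel" and nonneg: "\<And>y. 0 \<le> f y"
  shows "g ` S \<in> sets lebesgue"
    and "(\<integral>\<^sup>+x. ennreal (\<bar>det (matrix (g' x))\<bar> * f (g x)) \<partial>lebesgue_on S)
       = (\<integral>\<^sup>+y. ennreal (f y) \<partial>lebesgue_on (g ` S))"
proof -
  have diff: "g differentiable_on S"
    using der by (auto simp: differentiable_on_def differentiable_def)
  then show gS: "g ` S \<in> sets lebesgue"
    by (intro differentiable_image_in_sets_lebesgue [OF S]) auto
  have det: "(\<lambda>x. det (matrix (g' x))) \<in> borel_measurable (lebesgue_on S)"
    by (rule borel_measurable_det_Jacobian [OF S der])
  have g: "g \<in> borel_measurable (lebesgue_on S)"
    using diff S by (intro continuous_imp_measurable_on_sets_lebesgue differentiable_imp_continuous_on)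
  note [measurable] = det g
  have abs_iff: "integrable (lebesgue_on A) u \<longleftrightarrow> u absolutely_integrable_on A"
    if "A \<in> sets lebesgue" for A :: "(real^'m::_) set" and u :: "real^'m::_ \<Rightarrow> real"
    using that by (simp add: set_integrable_def integrable_restrict_space)
  have int_iff: "integrable (lebesgue_on A) u \<and> integral\<^sup>L (lebesgue_on A) u = b \<longleftrightarrow>
      u absolutely_integrable_on A \<and> integral A u = b"
    if "A \<in> sets lebesgue" for A :: "(real^'m::_) set" and u :: "real^'m::_ \<Rightarrow> real" and b
    using abs_iff[OF that, of u] lebesgue_integral_eq_integral[OF _ that, of u] by auto
  show "(\<integral>\<^sup>+x. ennreal (\<bar>det (matrix (g' x))\<bar> * f (g x)) \<partial>lebesgue_on S)
       = (\<integral>\<^sup>+y. ennreal (f y) \<partial>lebesgue_on (g ` S))"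
  proof (rule nn_integral_eq_if_integrable_iff)
    show "f \<in> borel_measurable (lebesgue_on (g ` S))"
      by (intro measurable_restrict_space1 measurable_completion) simp
    fix b :: real
    \<comment> \<open>The change-of-variables theorem takes vector-valued integrands, so
      \<open>f\<close> enters as a function into \<open>real^1\<close>.\<close>
    have "(\<lambda>x. \<bar>det (matrix (g' x))\<bar> * f (g x)) absolutely_integrable_on S \<and>
          integral S (\<lambda>x. \<bar>det (matrix (g' x))\<bar> * f (g x)) = b \<longleftrightarrow>
          f absolutely_integrable_on (g ` S) \<and> integral (g ` S) f = b"
      using has_absolute_integral_change_of_variables [OF S der inj, of "\<lambda>x. vec (f x) :: real^1" "vec b"]
      unfolding absolutely_integrable_on_1_iff integral_on_1_eq
      by (simp add: vec_eq_iff)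
    then show "integrable (lebesgue_on S) (\<lambda>x. \<bar>det (matrix (g' x))\<bar> * f (g x)) \<and>
          integral\<^sup>L (lebesgue_on S) (\<lambda>x. \<bar>det (matrix (g' x))\<bar> * f (g x)) = b \<longleftrightarrow>
          integrable (lebesgue_on (g ` S)) f \<and> integral\<^sup>L (lebesgue_on (g ` S)) f = b"
      by (simp only: int_iff[OF S] int_iff[OF gS])
  qed (auto simp: nonneg)
qed

section \<open>Identification of pairs and complex numbers with \<open>real^2\<close>\<close>

definition vec_of_complex :: "complex \<Rightarrow> real^2" where
  "vec_of_complex z = vector [Re z, Im z]"

definition vec_of_pair :: "real \<times> real \<Rightarrow> real^2" where
  "vec_of_pair x = vector [fst x, snd x]"

lemma vec_of_complex_nth [simp]:
  "vec_nth (vec_of_complex z) 1 = Re z" "vec_nth (vec_of_complex z) 2 = Im z"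
  and vec_of_pair_nth [simp]:
  "vec_nth (vec_of_pair x) 1 = fst x" "vec_nth (vec_of_pair x) 2 = snd x"
  by (simp_all add: vec_of_complex_def vec_of_pair_def)

lemma bounded_linear_vec_of_complex: "bounded_linear vec_of_complex"
  by (intro linear_conv_bounded_linear[THEN iffD1] linearI)
     (auto simp: vec_eq_iff forall_2)

lemma bounded_linear_pair_of_vec: "bounded_linear (\<lambda>v::real^2. (vec_nth v 1, vec_nth v 2))"
  by (intro linear_conv_bounded_linear[THEN iffD1] linearI) auto

text \<open>Determinants and the change of variables live on \<open>real^2\<close>, while the
  parameters below are pairs and the values complex numbers. Comparing boxes shows that passing
  between these spaces preserves Lebesgue measure.\<close>

lemma lborel_distr_pair_of_vec:
  "distr lborel borel (\<lambda>v::real^2. (vec_nth v 1, vec_nth v 2)) = lborel"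
proof (rule sym, rule lborel_eqI)
  fix l u :: "real \<times> real"
  assume le: "\<And>b. b \<in> Basis \<Longrightarrow> l \<bullet> b \<le> u \<bullet> b"
  have "(\<lambda>v::real^2. (vec_nth v 1, vec_nth v 2)) -` box l u = box (vec_of_pair l) (vec_of_pair u)"
  proof (rule set_eqI)
    fix v :: "real^2"
    have "v \<in> box (vec_of_pair l) (vec_of_pair u) \<longleftrightarrow>
      fst l < vec_nth v 1 \<and> vec_nth v 1 < fst u \<and> snd l < vec_nth v 2 \<and> vec_nth v 2 < snd u"
      unfolding mem_box_cart forall_2 vec_of_pair_nth by blast
    moreover have "(vec_nth v 1, vec_nth v 2) \<in> box (fst l, snd l) (fst u, snd u) \<longleftrightarrow>
      fst l < vec_nth v 1 \<and> vec_nth v 1 < fst u \<and> snd l < vec_nth v 2 \<and> vec_nth v 2 < snd u"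
      by (auto simp: mem_box Basis_prod_def inner_prod_def)
    ultimately show "v \<in> (\<lambda>v::real^2. (vec_nth v 1, vec_nth v 2)) -` box l u \<longleftrightarrow>
        v \<in> box (vec_of_pair l) (vec_of_pair u)"
      by (simp only: vimage_eq prod.collapse)
  qed
  moreover have "emeasure lborel (box (vec_of_pair l) (vec_of_pair u)) = (\<Prod>b\<in>Basis. (u - l) \<bullet> b)"
  proof -
    have B: "(Basis :: (real^2) set) = {axis 1 1, axis 2 1}"
      by (auto simp: Basis_vec_def UNIV_2)
    have ne: "axis 1 1 \<noteq> (axis 2 1 :: real^2)"
      by (simp add: axis_eq_axis)
    have BP: "(Basis :: (real \<times> real) set) = {(1,0), (0,1)}"
      by (auto simp: Basis_prod_def)
    have "fst l \<le> fst u" "snd l \<le> snd u"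
      using le[of "(1,0)"] le[of "(0,1)"] by (auto simp: Basis_prod_def inner_prod_def)
    then show ?thesis
      by (subst emeasure_lborel_box_eq)
        (auto simp: B ne inner_axis inner_diff_left BP inner_prod_def)
  qed
  ultimately show "emeasure (distr lborel borel (\<lambda>v::real^2. (vec_nth v 1, vec_nth v 2))) (box l u)
      = (\<Prod>b\<in>Basis. (u - l) \<bullet> b)"
    by (subst emeasure_distr) (auto intro!: borel_measurable_continuous_onI continuous_intros)
qed simp

lemma lborel_distr_complex_of_vec:
  "distr lborel borel (\<lambda>v::real^2. Complex (vec_nth v 1) (vec_nth v 2)) = lborel"
proof (rule sym, rule lborel_eqI)
  fix l u :: complex
  assume le: "\<And>b. b \<in> Basis \<Longrightarrow> l \<bullet> b \<le> u \<bullet> b"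
  have "(\<lambda>v::real^2. Complex (vec_nth v 1) (vec_nth v 2)) -` box l u = box (vec_of_complex l) (vec_of_complex u)"
  proof (rule set_eqI)
    fix v :: "real^2"
    have "v \<in> box (vec_of_complex l) (vec_of_complex u) \<longleftrightarrow>
      Re l < vec_nth v 1 \<and> vec_nth v 1 < Re u \<and> Im l < vec_nth v 2 \<and> vec_nth v 2 < Im u"
      unfolding mem_box_cart forall_2 vec_of_complex_nth by blast
    then show "v \<in> (\<lambda>v::real^2. Complex (vec_nth v 1) (vec_nth v 2)) -` box l u \<longleftrightarrow>
        v \<in> box (vec_of_complex l) (vec_of_complex u)"
      by (simp add: in_box_complex_iff)
  qed
  moreover have "emeasure lborel (box (vec_of_complex l) (vec_of_complex u)) = (\<Prod>b\<in>Basis. (u - l) \<bullet> b)"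
  proof -
    have B: "(Basis :: (real^2) set) = {axis 1 1, axis 2 1}"
      by (auto simp: Basis_vec_def UNIV_2)
    have ne: "axis 1 1 \<noteq> (axis 2 1 :: real^2)"
      by (simp add: axis_eq_axis)
    have "Re l \<le> Re u" "Im l \<le> Im u"
      using le[of 1] le[of \<i>] by (auto simp: Basis_complex_def inner_complex_def)
    then show ?thesis
      by (subst emeasure_lborel_box_eq)
        (auto simp: B ne inner_axis inner_diff_left Basis_complex_def inner_complex_def)
  qed
  ultimately show "emeasure (distr lborel borel (\<lambda>v::real^2. Complex (vec_nth v 1) (vec_nth v 2))) (box l u)
      = (\<Prod>b\<in>Basis. (u - l) \<bullet> b)"
    by (subst emeasure_distr) (auto intro!: borel_measurable_continuous_onI continuous_intros continuous_on_Complex)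
qed simp

text \<open>The image of a Borel set under a differentiable map is only known to be Lebesgue
  measurable, so the invariance is also needed for the completed measure.\<close>

lemma lebesgue_distr_of_lborel_distr:
  fixes T :: "'a::euclidean_space \<Rightarrow> 'b::euclidean_space"
  assumes T: "T \<in> borel_measurable borel" and eq: "distr lborel borel T = lborel"
  shows "T \<in> lebesgue \<rightarrow>\<^sub>M lebesgue" "distr lebesgue lebesgue T = lebesgue"
proof -
  have T': "T \<in> lebesgue \<rightarrow>\<^sub>M lborel"
    using T by (simp add: measurable_completion)
  have d: "distr lebesgue lborel T = lborel"
  proof -
    have "distr lebesgue lborel T = distr lborel lborel T"
      by (rule distr_completion) (use T in simp)
    also have "\<dots> = distr lborel borel T"
      by (rule distr_cong) auto
    finally show ?thesis using eq by simp
  qed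
  show "distr lebesgue lebesgue T = lebesgue"
    using completion.completion_distr_eq[OF T'] d by simp
  show "T \<in> lebesgue \<rightarrow>\<^sub>M lebesgue"
    using completion.measurable_completion2[OF T'] d by simp
qed

text \<open>The determinant of the real-linear map with columns \<open>P\<close> and
  \<open>Q\<close>; it is \<open>jacobian\<close> when these are the images of 1 and
  \<open>\<i>\<close>.\<close>

definition jac2 :: "complex \<Rightarrow> complex \<Rightarrow> real" where
  "jac2 P Q = Re P * Im Q - Re Q * Im P"

text \<open>Differentiability is required only within \<open>S\<close>, and \<open>S\<close> is an
  arbitrary Borel set. This makes the formula applicable to pieces of a domain on which the map has
  no derivative in the usual sense.\<close>

lemma area_formula:
  fixes g :: "real \<times> real \<Rightarrow> complex" and h :: "complex \<Rightarrow> real" and P Q :: "real \<times> real \<Rightarrow> complex"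
  assumes S [measurable]: "S \<in> sets borel"
    and der: "\<And>x. x \<in> S \<Longrightarrow> (g has_derivative (\<lambda>u. fst u *\<^sub>R P x + snd u *\<^sub>R Q x)) (at x within S)"
    and inj: "inj_on g S"
    and [measurable]: "h \<in> borel_measurable borel" "P \<in> borel_measurable borel" "Q \<in> borel_measurable borel"
    and nonneg: "\<And>y. 0 \<le> h y"
  shows "g ` S \<in> sets lebesgue"
    and "(\<integral>\<^sup>+x. ennreal (\<bar>jac2 (P x) (Q x)\<bar> * h (g x)) * indicator S x \<partial>lborel)
       = (\<integral>\<^sup>+y. ennreal (h y) * indicator (g ` S) y \<partial>lebesgue)"
proof -
  let ?T = "\<lambda>v::real^2. (vec_nth v 1, vec_nth v 2)"
  let ?X = "\<lambda>v::real^2. Complex (vec_nth v 1) (vec_nth v 2)"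
  have cont: "continuous_on S g"
    unfolding continuous_on_eq_continuous_within using der has_derivative_continuous by blast
  show gS: "g ` S \<in> sets lebesgue"
    using S der by (intro differentiable_image_in_sets_lebesgue)
      (auto simp: differentiable_on_def differentiable_def)
  have [measurable]: "?T \<in> borel_measurable borel" "?X \<in> borel_measurable borel"
    by (auto intro!: borel_measurable_continuous_onI continuous_intros continuous_on_Complex)
  define S' where "S' = ?T -` S"
  have S'b [measurable]: "S' \<in> sets borel"
    unfolding S'_def using measurable_sets[OF _ S, of ?T borel] by simp
  define G where "G = (\<lambda>v. vec_of_complex (g (?T v)))"
  define G' where "G' = (\<lambda>v u::real^2. vec_of_complex (vec_nth u 1 *\<^sub>R P (?T v) + vec_nth u 2 *\<^sub>R Q (?T v)))"
  have G': "(G has_derivative G' v) (at v within S')" if "v \<in> S'" for v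
  proof -
    have 1: "(?T has_derivative ?T) (at v within S')"
      by (rule bounded_linear_imp_has_derivative[OF bounded_linear_pair_of_vec])
    have "?T ` S' \<subseteq> S" by (auto simp: S'_def)
    then have 2: "(g has_derivative (\<lambda>u. fst u *\<^sub>R P (?T v) + snd u *\<^sub>R Q (?T v))) (at (?T v) within ?T ` S')"
      using der[of "?T v"] that by (auto simp: S'_def intro: has_derivative_subset)
    have 3: "((g \<circ> ?T) has_derivative (\<lambda>u. fst u *\<^sub>R P (?T v) + snd u *\<^sub>R Q (?T v)) \<circ> ?T) (at v within S')"
      by (rule diff_chain_within[OF 1 2])
    show ?thesis
      unfolding G_def G'_def
      using bounded_linear.has_derivative[OF bounded_linear_vec_of_complex 3] by (simp add: o_def)
  qed
  have det: "det (matrix (G' v)) = jac2 (P (?T v)) (Q (?T v))" for v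
    by (simp add: det_2 matrix_def G'_def jac2_def axis_def)
  have injG: "inj_on G S'"
  proof (rule inj_onI)
    fix v w assume "v \<in> S'" "w \<in> S'" "G v = G w"
    then have "g (?T v) = g (?T w)"
      unfolding G_def by (metis complex_eqI vec_of_complex_nth)
    then have "?T v = ?T w"
      using inj \<open>v \<in> S'\<close> \<open>w \<in> S'\<close> by (auto simp: S'_def inj_on_def)
    then show "v = w" by (simp add: vec_eq_iff forall_2)
  qed
  have S'l: "S' \<in> sets lebesgue" using S'b by simp
  have hX: "(\<lambda>v. h (?X v)) \<in> borel_measurable borel" by measurable
  have gm: "(\<lambda>x. indicator S x *\<^sub>R g x) \<in> borel_measurable borel"
    by (rule borel_measurable_continuous_on_indicator[OF S cont])
  have cov: "G ` S' \<in> sets lebesgue"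
    "(\<integral>\<^sup>+v. ennreal (\<bar>det (matrix (G' v))\<bar> * h (?X (G v))) \<partial>lebesgue_on S')
       = (\<integral>\<^sup>+v. ennreal (h (?X v)) \<partial>lebesgue_on (G ` S'))"
    using nn_integral_change_of_variables_vec[OF S'l G' injG hX] nonneg by auto
  have XG: "?X (G v) = g (?T v)" for v
    by (simp add: G_def)
  \<comment> \<open>Away from \<open>S\<close> nothing is known about \<open>g\<close>, so
    measurability is proved for \<open>indicator S x *\<^sub>R g x\<close>, which gives the same
    integrand.\<close>
  have lhs_meas: "(\<lambda>x. ennreal (\<bar>jac2 (P x) (Q x)\<bar> * h (g x)) * indicator S x) \<in> borel_measurable borel"
  proof -
    have "(\<lambda>x. ennreal (\<bar>jac2 (P x) (Q x)\<bar> * h (indicator S x *\<^sub>R g x)) * indicator S x) \<in> borel_measurable borel"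
      unfolding jac2_def using gm by measurable
    also have "(\<lambda>x. ennreal (\<bar>jac2 (P x) (Q x)\<bar> * h (indicator S x *\<^sub>R g x)) * indicator S x)
      = (\<lambda>x. ennreal (\<bar>jac2 (P x) (Q x)\<bar> * h (g x)) * indicator S x)"
      by (auto simp: indicator_def fun_eq_iff)
    finally show ?thesis .
  qed
  have "(\<integral>\<^sup>+x. ennreal (\<bar>jac2 (P x) (Q x)\<bar> * h (g x)) * indicator S x \<partial>lborel)
      = (\<integral>\<^sup>+v. ennreal (\<bar>jac2 (P (?T v)) (Q (?T v))\<bar> * h (g (?T v))) * indicator S (?T v) \<partial>lborel)"
    by (subst lborel_distr_pair_of_vec[symmetric], subst nn_integral_distr) (use lhs_meas in auto)
  also have "\<dots> = (\<integral>\<^sup>+v. ennreal (\<bar>det (matrix (G' v))\<bar> * h (?X (G v))) * indicator S' v \<partial>lebesgue)"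
    unfolding XG det by (simp add: nn_integral_completion S'_def indicator_def)
  also have "\<dots> = (\<integral>\<^sup>+v. ennreal (h (?X v)) * indicator (G ` S') v \<partial>lebesgue)"
    using cov S'l by (simp add: nn_integral_restrict_space)
  also have "\<dots> = (\<integral>\<^sup>+v. ennreal (h (?X v)) * indicator (g ` S) (?X v) \<partial>lebesgue)"
  proof -
    have "v \<in> G ` S' \<longleftrightarrow> ?X v \<in> g ` S" for v
    proof
      assume "?X v \<in> g ` S"
      then obtain x where "x \<in> S" "?X v = g x" by auto
      then have "v = G (vec_of_pair x)" "vec_of_pair x \<in> S'"
        by (auto simp: G_def S'_def vec_eq_iff forall_2 complex_eq_iff)
      then show "v \<in> G ` S'" by blast
    qed (auto simp: G_def S'_def)
    then show ?thesis by (simp add: indicator_def)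
  qed
  also have "\<dots> = (\<integral>\<^sup>+y. ennreal (h y) * indicator (g ` S) y \<partial>lebesgue)"
  proof -
    have X: "?X \<in> lebesgue \<rightarrow>\<^sub>M lebesgue" "distr lebesgue lebesgue ?X = lebesgue"
      using lebesgue_distr_of_lborel_distr[OF _ lborel_distr_complex_of_vec] by auto
    have "h \<in> borel_measurable lebesgue" by (simp add: measurable_completion)
    then have "(\<lambda>y. ennreal (h y) * indicator (g ` S) y) \<in> borel_measurable lebesgue"
      using gS by measurable
    then have "(\<integral>\<^sup>+y. ennreal (h y) * indicator (g ` S) y \<partial>distr lebesgue lebesgue ?X)
        = (\<integral>\<^sup>+v. ennreal (h (?X v)) * indicator (g ` S) (?X v) \<partial>lebesgue)"
      by (intro nn_integral_distr X(1)) simp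
    then show ?thesis
      by (simp only: X(2))
  qed
  finally show "(\<integral>\<^sup>+x. ennreal (\<bar>jac2 (P x) (Q x)\<bar> * h (g x)) * indicator S x \<partial>lborel)
       = (\<integral>\<^sup>+y. ennreal (h y) * indicator (g ` S) y \<partial>lebesgue)" .
qed

section \<open>Test functions and mollification\<close>

text \<open>Differentiating P(1/t) exp(-1/t) gives (1/t)^2 (P(1/t) - P'(1/t)) exp(-1/t), so with x =
  1/t the next polynomial is x^2 (P - P').\<close>

fun exp_recip_poly :: "nat \<Rightarrow> real poly" where
  "exp_recip_poly 0 = 1"
| "exp_recip_poly (Suc k) = [:0, 0, 1:] * (exp_recip_poly k - pderiv (exp_recip_poly k))"

text \<open>The \<open>k\<close>-th derivative of the function that is \<open>exp (- 1 / t)\<close> for \<open>t > 0\<close> and \<open>0\<close> for \<open>t \<le> 0\<close>.\<close>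

definition flat_exp :: "nat \<Rightarrow> real \<Rightarrow> real" where
  "flat_exp k t = (if 0 < t then poly (exp_recip_poly k) (1 / t) * exp (- (1 / t)) else 0)"

lemma tendsto_poly_times_exp_minus:
  fixes p :: "real poly"
  shows "((\<lambda>x. poly p x * exp (- x)) \<longlongrightarrow> 0) at_top"
proof -
  have "((\<lambda>x. \<Sum>i\<le>degree p. coeff p i * (x ^ i / exp x)) \<longlongrightarrow> (\<Sum>i\<le>degree p. coeff p i * 0)) at_top"
    by (intro tendsto_sum tendsto_mult tendsto_const tendsto_power_div_exp_0)
  then show ?thesis
    by (simp add: poly_altdef sum_distrib_right exp_minus field_simps sum_divide_distrib)
qed

lemma flat_exp_has_derivative: "(flat_exp k has_real_derivative flat_exp (Suc k) t) (at t)"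
proof -
  consider "t > 0" | "t < 0" | "t = 0" by linarith
  then show ?thesis
  proof cases
    case 1
    let ?p = "exp_recip_poly k"
    have "((\<lambda>t. poly ?p (1 / t) * exp (- (1 / t))) has_real_derivative
        poly ?p (1 / t) * (exp (- (1 / t)) * (1 / t\<^sup>2)) + (poly (pderiv ?p) (1 / t) * (- (1 / t\<^sup>2))) * exp (- (1 / t))) (at t)"
      using 1 by (auto intro!: derivative_eq_intros DERIV_chain2[OF poly_DERIV] simp: power2_eq_square)
    moreover have "poly ?p (1 / t) * (exp (- (1 / t)) * (1 / t\<^sup>2)) + (poly (pderiv ?p) (1 / t) * (- (1 / t\<^sup>2))) * exp (- (1 / t))
       = flat_exp (Suc k) t"
      using 1 by (simp add: flat_exp_def power2_eq_square algebra_simps)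
    ultimately have "((\<lambda>t. poly ?p (1 / t) * exp (- (1 / t))) has_real_derivative flat_exp (Suc k) t) (at t)"
      by simp
    then show ?thesis
      by (rule has_field_derivative_transform_within_open[where S="{0<..}"]) (use 1 in \<open>auto simp: flat_exp_def\<close>)
  next
    case 2
    have "((\<lambda>t. 0) has_real_derivative flat_exp (Suc k) t) (at t)"
      using 2 by (simp add: flat_exp_def)
    then show ?thesis
      by (rule has_field_derivative_transform_within_open[where S="{..<0}"]) (use 2 in \<open>auto simp: flat_exp_def\<close>)
  next
    case 3
    have "((\<lambda>h. flat_exp k h / h) \<longlongrightarrow> 0) (at_right 0)"
    proof -
      \<comment> \<open>With x = 1/h the division by h becomes multiplication by x, which is what
        \<open>pCons 0\<close> does.\<close>
      have "((\<lambda>x. poly (pCons 0 (exp_recip_poly k)) x * exp (- x)) \<longlongrightarrow> 0) at_top"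
        by (rule tendsto_poly_times_exp_minus)
      then have "((\<lambda>h. poly (pCons 0 (exp_recip_poly k)) (inverse h) * exp (- inverse h)) \<longlongrightarrow> 0) (at_right 0)"
        by (rule filterlim_compose) (rule filterlim_inverse_at_top_right)
      moreover have "eventually (\<lambda>h. poly (pCons 0 (exp_recip_poly k)) (inverse h) * exp (- inverse h)
          = flat_exp k h / h) (at_right (0::real))"
        by (auto simp: flat_exp_def field_simps eventually_at_right_field intro!: exI[of _ 1])
      ultimately show ?thesis
        by (rule Lim_transform_eventually)
    qed
    moreover have "((\<lambda>h. flat_exp k h / h) \<longlongrightarrow> 0) (at_left 0)"
    proof -
      have "eventually (\<lambda>h. 0 = flat_exp k h / h) (at_left (0::real))"
        by (simp add: eventually_at_filter flat_exp_def)
      then show ?thesis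
        by (rule Lim_transform_eventually[OF tendsto_const])
    qed
    ultimately have "((\<lambda>h. flat_exp k h / h) \<longlongrightarrow> 0) (at 0)"
      by (intro filterlim_split_at)
    then show ?thesis
      using 3 by (simp add: DERIV_def flat_exp_def)
  qed
qed

section \<open>Smoothness classes and a compactly supported bump\<close>

lemma Ck_Suc_imp: "Ck (Suc k) \<phi> \<Longrightarrow> Ck k \<phi>"
proof (induction k arbitrary: \<phi>)
  case 0
  then show ?case by (simp add: differentiable_imp_continuous_on)
next
  case (Suc k)
  then have "\<phi> differentiable_on UNIV" "Ck k (\<lambda>z. frechet_derivative \<phi> (at z) e)" for e
    using Suc.prems Suc.IH[of "\<lambda>z. frechet_derivative \<phi> (at z) e"] by auto
  then show ?case by simp
qed

lemma Ck_add: "Ck k \<phi> \<Longrightarrow> Ck k \<psi> \<Longrightarrow> Ck k (\<lambda>z. \<phi> z + \<psi> z)"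
proof (induction k arbitrary: \<phi> \<psi>)
  case 0
  then show ?case by (auto intro: continuous_intros)
next
  case (Suc k)
  then have d: "\<phi> differentiable at z" "\<psi> differentiable at z" for z
    by (auto simp: differentiable_on_def)
  have "(\<lambda>z. frechet_derivative (\<lambda>z. \<phi> z + \<psi> z) (at z) e)
      = (\<lambda>z. frechet_derivative \<phi> (at z) e + frechet_derivative \<psi> (at z) e)" for e
  proof
    fix z
    have "((\<lambda>z. \<phi> z + \<psi> z) has_derivative
        (\<lambda>e. frechet_derivative \<phi> (at z) e + frechet_derivative \<psi> (at z) e)) (at z)"
      by (intro has_derivative_add d[unfolded frechet_derivative_works])
    then show "frechet_derivative (\<lambda>z. \<phi> z + \<psi> z) (at z) e
        = frechet_derivative \<phi> (at z) e + frechet_derivative \<psi> (at z) e"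
      by (simp add: frechet_derivative_at[symmetric])
  qed
  with Suc d show ?case
    by (auto simp: differentiable_on_def)
qed

lemma Ck_mult: "Ck k \<phi> \<Longrightarrow> Ck k \<psi> \<Longrightarrow> Ck k (\<lambda>z. \<phi> z * \<psi> z)"
proof (induction k arbitrary: \<phi> \<psi>)
  case 0
  then show ?case by (auto intro: continuous_intros)
next
  case (Suc k)
  then have d: "\<phi> differentiable at z" "\<psi> differentiable at z" for z
    by (auto simp: differentiable_on_def)
  have eq: "(\<lambda>z. frechet_derivative (\<lambda>z. \<phi> z * \<psi> z) (at z) e)
      = (\<lambda>z. \<phi> z * frechet_derivative \<psi> (at z) e + frechet_derivative \<phi> (at z) e * \<psi> z)" for e
  proof
    fix z
    have "((\<lambda>z. \<phi> z * \<psi> z) has_derivative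
        (\<lambda>e. \<phi> z * frechet_derivative \<psi> (at z) e + frechet_derivative \<phi> (at z) e * \<psi> z)) (at z)"
      by (intro has_derivative_mult d[unfolded frechet_derivative_works])
    then show "frechet_derivative (\<lambda>z. \<phi> z * \<psi> z) (at z) e
        = \<phi> z * frechet_derivative \<psi> (at z) e + frechet_derivative \<phi> (at z) e * \<psi> z"
      by (simp add: frechet_derivative_at[symmetric])
  qed
  have "Ck k (\<lambda>z. \<phi> z * frechet_derivative \<psi> (at z) e + frechet_derivative \<phi> (at z) e * \<psi> z)" for e
    using Suc.prems(1)[THEN Ck_Suc_imp] Suc.prems(2)[THEN Ck_Suc_imp] Suc.prems
    by (auto intro!: Ck_add Suc.IH)
  then show ?case
    using d by (simp add: eq differentiable_on_def)
qed

lemma Ck_const: "Ck k (\<lambda>z. c)"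
proof (induction k arbitrary: c)
  case (Suc k)
  have "frechet_derivative (\<lambda>z. c) (at z) e = 0" for z e :: complex
    by simp
  with Suc show ?case by simp
qed simp

text \<open>A partial derivative of such a function is a constant times the function of the same
  kind with \<open>Suc j\<close> in place of \<open>j\<close>. The affine argument stays the same,
  so the induction on \<open>k\<close> closes with \<open>j\<close> arbitrary.\<close>

lemma Ck_flat_exp: "Ck k (\<lambda>z. flat_exp j (a + b * Re z + c * Im z))"
proof (induction k arbitrary: j)
  case 0
  have "continuous_on UNIV (flat_exp j)"
    using flat_exp_has_derivative by (intro DERIV_continuous_on) (blast intro: has_field_derivative_at_within)
  then show ?case
    by (auto intro!: continuous_on_compose2[of UNIV "flat_exp j"] continuous_intros)
next
  case (Suc k)
  have der: "((\<lambda>z. flat_exp j (a + b * Re z + c * Im z)) has_derivative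
      (\<lambda>e. (b * Re e + c * Im e) * flat_exp (Suc j) (a + b * Re z + c * Im z))) (at z)" for z
  proof -
    have "((\<lambda>z. a + b * Re z + c * Im z) has_derivative (\<lambda>e. b * Re e + c * Im e)) (at z)"
      by (auto intro!: derivative_eq_intros)
    from DERIV_compose_FDERIV[OF flat_exp_has_derivative this] show ?thesis
      by simp
  qed
  have "(\<lambda>z. frechet_derivative (\<lambda>z. flat_exp j (a + b * Re z + c * Im z)) (at z) e)
    = (\<lambda>z. (b * Re e + c * Im e) * flat_exp (Suc j) (a + b * Re z + c * Im z))" for e
    by (simp add: frechet_derivative_at[OF der, symmetric])
  moreover have "(\<lambda>z. flat_exp j (a + b * Re z + c * Im z)) differentiable_on UNIV"
    using der by (auto simp: differentiable_on_def differentiable_def)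
  ultimately show ?case
    using Suc by (auto intro!: Ck_mult Ck_const)
qed

text \<open>A product of one-dimensional cutoffs, positive exactly on the open square with vertices
  \<plusminus>1 \<plusminus> i. Unlike a radial profile it is a product of \<open>flat_exp\<close>
  applied to affine functions, so smoothness follows from \<open>Ck_mult\<close> and
  \<open>Ck_flat_exp\<close>.\<close>

definition bump :: "complex \<Rightarrow> real" where
  "bump z = flat_exp 0 (1 + Re z) * flat_exp 0 (1 - Re z) * (flat_exp 0 (1 + Im z) * flat_exp 0 (1 - Im z))"

lemma continuous_on_flat_exp: "continuous_on UNIV (flat_exp k)"
  using flat_exp_has_derivative by (intro DERIV_continuous_on) (blast intro: has_field_derivative_at_within)

lemmas continuous_on_flat_exp' [continuous_intros] =
  continuous_on_compose2[OF continuous_on_flat_exp _ subset_UNIV]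

lemma flat_exp_0_nonneg: "0 \<le> flat_exp 0 t"
  by (simp add: flat_exp_def)

lemma bump_nonneg: "0 \<le> bump z"
  by (simp add: bump_def flat_exp_0_nonneg)

lemma bump_eq_0_iff: "bump z = 0 \<longleftrightarrow> 1 \<le> \<bar>Re z\<bar> \<or> 1 \<le> \<bar>Im z\<bar>"
  by (auto simp: bump_def flat_exp_def)

lemma bump_support: "bump z \<noteq> 0 \<Longrightarrow> norm z \<le> 2"
  using cmod_le[of z] by (simp add: bump_eq_0_iff)

lemma continuous_on_bump: "continuous_on UNIV bump"
  unfolding bump_def by (intro continuous_intros)

lemma integrable_bump: "integrable lborel bump"
proof -
  have "integrable lborel (\<lambda>z. indicator (cball 0 2) z *\<^sub>R bump z)"
    by (intro borel_integrable_compact continuous_on_subset[OF continuous_on_bump]) auto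
  also have "(\<lambda>z. indicator (cball 0 2) z *\<^sub>R bump z) = bump"
    using bump_support by (force simp: fun_eq_iff indicator_def)
  finally show ?thesis .
qed

lemma integral_bump_pos: "0 < (LINT z|lborel. bump z)"
proof -
  have "(LINT z|lborel. bump z) \<noteq> 0"
  proof
    assume "(LINT z|lborel. bump z) = 0"
    then have "AE z in lborel. bump z = 0"
      using integral_nonneg_eq_0_iff_AE[OF integrable_bump] bump_nonneg by simp
    then have "AE z in lborel. z \<notin> box (Complex (-1) (-1)) (Complex 1 1)"
      by (rule AE_mp) (auto simp: bump_eq_0_iff in_box_complex_iff)
    then have "box (Complex (-1) (-1)) (Complex 1 1) \<in> null_sets lborel"
      by (subst AE_iff_null_sets) auto
    then have "emeasure lborel (box (Complex (-1) (-1)) (Complex 1 1)) = 0"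
      by blast
    then show False
      by (subst (asm) emeasure_lborel_box) (auto simp: Basis_complex_def inner_complex_def)
  qed
  moreover have "0 \<le> (LINT z|lborel. bump z)"
    by (simp add: bump_nonneg integral_nonneg)
  ultimately show ?thesis by simp
qed

section \<open>Mollifiers and their partial derivatives\<close>

definition mollifier :: "real \<Rightarrow> complex \<Rightarrow> real" where
  "mollifier r z = bump (z /\<^sub>R r) / (r\<^sup>2 * (LINT z|lborel. bump z))"

text \<open>\<open>True\<close> selects the derivative in the real direction, \<open>False\<close>
  the one in the imaginary direction.\<close>

definition bump_der :: "bool \<Rightarrow> complex \<Rightarrow> real" where
  "bump_der b z = (if b then
     (flat_exp 1 (1 + Re z) * flat_exp 0 (1 - Re z) - flat_exp 0 (1 + Re z) * flat_exp 1 (1 - Re z))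
       * (flat_exp 0 (1 + Im z) * flat_exp 0 (1 - Im z))
   else flat_exp 0 (1 + Re z) * flat_exp 0 (1 - Re z)
       * (flat_exp 1 (1 + Im z) * flat_exp 0 (1 - Im z) - flat_exp 0 (1 + Im z) * flat_exp 1 (1 - Im z)))"

lemma flat_exp_has_derivative_compose [derivative_intros]:
  assumes "(u has_derivative u') (at x within S)" "\<And>e. D e = u' e * flat_exp (Suc k) (u x)"
  shows "((\<lambda>x. flat_exp k (u x)) has_derivative D) (at x within S)"
proof -
  have "D = (\<lambda>e. u' e * flat_exp (Suc k) (u x))"
    using assms(2) by auto
  then show ?thesis
    using DERIV_compose_FDERIV[OF flat_exp_has_derivative assms(1)] by simp
qed

lemma bump_has_derivative:
  "(bump has_derivative (\<lambda>e. Re e * bump_der True z + Im e * bump_der False z)) (at z)"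
  unfolding bump_def bump_der_def
  by (rule derivative_eq_intros flat_exp_has_derivative_compose refl)+ (simp add: fun_eq_iff algebra_simps)

text \<open>The cube consists of the square that normalises area and one more factor
  \<open>r\<close> from the chain rule.\<close>

definition mollifier_der :: "bool \<Rightarrow> real \<Rightarrow> complex \<Rightarrow> real" where
  "mollifier_der b r z = bump_der b (z /\<^sub>R r) / (r ^ 3 * (LINT z|lborel. bump z))"

definition mollify :: "real \<Rightarrow> (complex \<Rightarrow> complex) \<Rightarrow> complex \<Rightarrow> complex" where
  "mollify r u x = (LINT y|lborel. mollifier r (x - y) *\<^sub>R u y)"

lemma bump_der_support: "bump_der b z \<noteq> 0 \<Longrightarrow> norm z \<le> 2"
proof -
  assume "bump_der b z \<noteq> 0"
  then have "\<bar>Re z\<bar> < 1" "\<bar>Im z\<bar> < 1"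
    by (auto simp: bump_der_def flat_exp_def split: if_splits)
  then show ?thesis
    using cmod_le[of z] by linarith
qed

text \<open>The factor 2 is there because the bump lives on a square, whose corners are further than
  1 from the origin. It recurs in every later condition on supports.\<close>

lemma mollifier_support: "0 < r \<Longrightarrow> mollifier r z \<noteq> 0 \<Longrightarrow> norm z \<le> 2 * r"
  using bump_support[of "z /\<^sub>R r"] by (auto simp: mollifier_def field_simps)

lemma mollifier_der_support: "0 < r \<Longrightarrow> mollifier_der b r z \<noteq> 0 \<Longrightarrow> norm z \<le> 2 * r"
  using bump_der_support[of b "z /\<^sub>R r"] by (auto simp: mollifier_der_def field_simps)

lemma mollifier_nonneg: "0 \<le> mollifier r z"
  using integral_bump_pos by (simp add: mollifier_def bump_nonneg)

lemma continuous_on_bump_der: "continuous_on UNIV (bump_der b)"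
  unfolding bump_der_def by (cases b) (auto intro!: continuous_intros)

lemma continuous_on_mollifier [continuous_intros]:
  "continuous_on S h \<Longrightarrow> continuous_on S (\<lambda>x. mollifier r (h x))"
  unfolding mollifier_def divide_inverse
  by (intro continuous_intros continuous_on_compose2[OF continuous_on_bump]) auto

lemma continuous_on_mollifier_der [continuous_intros]:
  "continuous_on S h \<Longrightarrow> continuous_on S (\<lambda>x. mollifier_der b r (h x))"
  unfolding mollifier_der_def divide_inverse
  by (intro continuous_intros continuous_on_compose2[OF continuous_on_bump_der]) auto

lemma borel_measurable_mollifier [measurable]: "mollifier r \<in> borel_measurable borel"
  and borel_measurable_mollifier_der [measurable]: "mollifier_der b r \<in> borel_measurable borel"
  by (auto intro!: borel_measurable_continuous_onI continuous_intros)

lemma mollifier_has_derivative: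
  assumes "0 < r"
  shows "(mollifier r has_derivative
    (\<lambda>e. Re e * mollifier_der True r z + Im e * mollifier_der False r z)) (at z)"
proof -
  let ?N = "LINT z|lborel. bump z"
  have "((\<lambda>z. z /\<^sub>R r) has_derivative (\<lambda>e. e /\<^sub>R r)) (at z)"
    by (auto intro!: derivative_eq_intros)
  from diff_chain_at[OF this bump_has_derivative]
  have "((\<lambda>z. bump (z /\<^sub>R r)) has_derivative
      (\<lambda>e. Re (e /\<^sub>R r) * bump_der True (z /\<^sub>R r) + Im (e /\<^sub>R r) * bump_der False (z /\<^sub>R r))) (at z)"
    by (simp add: o_def)
  then have "((\<lambda>z. bump (z /\<^sub>R r) / (r\<^sup>2 * ?N)) has_derivative
      (\<lambda>e. (Re (e /\<^sub>R r) * bump_der True (z /\<^sub>R r) + Im (e /\<^sub>R r) * bump_der False (z /\<^sub>R r)) / (r\<^sup>2 * ?N))) (at z)"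
    by (rule bounded_linear.has_derivative[OF bounded_linear_divide])
  moreover have "(\<lambda>e. (Re (e /\<^sub>R r) * bump_der True (z /\<^sub>R r) + Im (e /\<^sub>R r) * bump_der False (z /\<^sub>R r)) / (r\<^sup>2 * ?N))
     = (\<lambda>e. Re e * mollifier_der True r z + Im e * mollifier_der False r z)"
    using assms by (simp add: fun_eq_iff mollifier_der_def divide_inverse algebra_simps power2_eq_square power3_eq_cube)
  ultimately show ?thesis
    by (simp add: mollifier_def[abs_def])
qed

lemma mollifier_reflected_has_derivative:
  assumes "0 < r"
  shows "((\<lambda>y. mollifier r (x - y)) has_derivative
    (\<lambda>e. - (Re e * mollifier_der True r (x - y) + Im e * mollifier_der False r (x - y)))) (at y)"
proof -
  have "((\<lambda>y. x - y) has_derivative (\<lambda>e. - e)) (at y)"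
    by (auto intro!: derivative_eq_intros)
  from diff_chain_at[OF this mollifier_has_derivative[OF assms]]
  show ?thesis by (simp add: o_def)
qed

lemma mollifier_test_function:
  assumes "0 < r" "cball x (2 * r) \<subseteq> \<Omega>"
  shows "(\<lambda>y. mollifier r (x - y)) \<in> test_functions \<Omega>"
proof -
  have "Ck k (\<lambda>y. mollifier r (x - y))" for k
  proof -
    let ?N = "LINT z|lborel. bump z"
    have eq: "mollifier r (x - y) = inverse (r\<^sup>2 * ?N) *
      (flat_exp 0 ((1 + Re x / r) + (- 1 / r) * Re y + 0 * Im y)
      * flat_exp 0 ((1 - Re x / r) + (1 / r) * Re y + 0 * Im y)
      * (flat_exp 0 ((1 + Im x / r) + 0 * Re y + (- 1 / r) * Im y)
      * flat_exp 0 ((1 - Im x / r) + 0 * Re y + (1 / r) * Im y)))" for y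
      by (simp add: mollifier_def bump_def divide_inverse algebra_simps)
    show ?thesis
      unfolding eq by (intro Ck_mult Ck_flat_exp Ck_const)
  qed
  moreover have sub: "closure {y. mollifier r (x - y) \<noteq> 0} \<subseteq> cball x (2 * r)"
    by (rule closure_minimal) (use mollifier_support[OF assms(1)] in \<open>auto simp: dist_norm\<close>)
  moreover have "compact (closure {y. mollifier r (x - y) \<noteq> 0})"
    using sub by (meson bounded_cball bounded_subset closed_closure compact_eq_bounded_closed)
  ultimately show ?thesis
    using assms(2) by (auto simp: test_functions_def)
qed

section \<open>Mollification: mass, weak derivatives and convergence\<close>

lemma nn_integral_lborel_reflect:
  fixes F :: "complex \<Rightarrow> ennreal"
  assumes [measurable]: "F \<in> borel_measurable borel"
  shows "(\<integral>\<^sup>+y. F (x - y) \<partial>lborel) = (\<integral>\<^sup>+y. F y \<partial>lborel)"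
proof -
  have eq: "lborel = distr lborel borel (\<lambda>y. x + (- 1) *\<^sub>R y)"
    using lborel_affine[of "- 1" x] by (simp add: density_1)
  show ?thesis
    by (subst (2) eq, subst nn_integral_distr) auto
qed

lemma nn_integral_mollifier:
  assumes "0 < r"
  shows "(\<integral>\<^sup>+y. ennreal (mollifier r y) \<partial>lborel) = 1"
proof -
  let ?N = "LINT z|lborel. bump z"
  have [measurable]: "bump \<in> borel_measurable borel"
    by (rule borel_measurable_continuous_onI[OF continuous_on_bump])
  have eq: "lborel = density (distr lborel borel (\<lambda>y::complex. 0 + r *\<^sub>R y)) (\<lambda>_. ennreal (r\<^sup>2))"
    using lborel_affine[of r "0 :: complex"] assms by simp
  have "(\<integral>\<^sup>+y. ennreal (mollifier r y) \<partial>lborel) = (\<integral>\<^sup>+y. ennreal (r\<^sup>2) * ennreal (mollifier r (r *\<^sub>R y)) \<partial>lborel)"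
    by (subst eq, subst nn_integral_density) (auto simp: nn_integral_distr)
  also have "\<dots> = (\<integral>\<^sup>+y. ennreal (1 / ?N) * ennreal (bump y) \<partial>lborel)"
    using assms integral_bump_pos
    by (intro nn_integral_cong) (simp add: mollifier_def ennreal_mult[symmetric] bump_nonneg)
  also have "\<dots> = ennreal (1 / ?N) * ennreal ?N"
    by (subst nn_integral_cmult) (auto simp: nn_integral_eq_integral[OF integrable_bump] bump_nonneg)
  also have "\<dots> = 1"
    using integral_bump_pos by (simp add: ennreal_mult[symmetric])
  finally show ?thesis .
qed

lemma mollifier_bounded: "\<exists>B. \<forall>z. mollifier r z \<le> B"
proof (cases "r > 0")
  case True
  have "compact (mollifier r ` cball 0 (2 * r))"
    by (intro compact_continuous_image continuous_intros) auto
  then obtain B where B: "\<And>z. z \<in> cball 0 (2 * r) \<Longrightarrow> mollifier r z \<le> B"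
    by (meson bounded_imp_bdd_above compact_imp_bounded bdd_above.E imageI)
  have "mollifier r z \<le> max B 0" for z
    using B[of z] mollifier_support[OF True, of z] by force
  then show ?thesis by blast
next
  case False
  have "compact (bump ` cball 0 2)"
    by (intro compact_continuous_image continuous_on_subset[OF continuous_on_bump]) auto
  then obtain B where B: "\<And>z. z \<in> cball 0 2 \<Longrightarrow> bump z \<le> B"
    by (meson bounded_imp_bdd_above compact_imp_bounded bdd_above.E imageI)
  have "bump z \<le> max B 0" for z
    using B[of z] bump_support[of z] by force
  then have "mollifier r z \<le> max B 0 / (r\<^sup>2 * (LINT z|lborel. bump z))" for z
    using integral_bump_pos unfolding mollifier_def by (intro divide_right_mono) auto
  then show ?thesis by blast
qed

lemma integrable_mollifier_times:
  assumes "integrable lborel u"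
  shows "integrable lborel (\<lambda>y. mollifier r (x - y) *\<^sub>R (u y :: complex))"
proof -
  obtain B where B: "\<And>z. mollifier r z \<le> B" using mollifier_bounded by blast
  have [measurable]: "u \<in> borel_measurable borel" using assms by auto
  show ?thesis
  proof (rule Bochner_Integration.integrable_bound)
    show "integrable lborel (\<lambda>y. B *\<^sub>R u y)" using assms by simp
    show "AE y in lborel. norm (mollifier r (x - y) *\<^sub>R u y) \<le> norm (B *\<^sub>R u y)"
      using B[of "x - _"] mollifier_nonneg[of r] by (auto intro!: AE_I2 mult_right_mono order_trans[OF _ abs_ge_self])
  qed measurable
qed

text \<open>The weak derivative is tested against the mollifier as a function of the subtracted
  variable. The sign from differentiating in that variable cancels the sign in the definition of the
  weak derivative, so differentiating the mollification of \<open>f\<close> amounts to mollifying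
  the derivative. The function \<open>u\<close> is a Borel substitute that agrees with the weak
  derivative almost everywhere on the support.\<close>

lemma mollify_weak_derivative:
  assumes r: "0 < r" "cball x (2 * r) \<subseteq> \<Omega>"
    and f: "continuous_on UNIV f" and [measurable]: "u \<in> borel_measurable borel"
    and weak: "\<And>\<phi>. \<phi> \<in> test_functions \<Omega> \<Longrightarrow>
        (LINT z:\<Omega>|lebesgue. frechet_derivative \<phi> (at z) e *\<^sub>R f z) = - (LINT z:\<Omega>|lebesgue. \<phi> z *\<^sub>R v z)"
    and v: "AE y in lborel. y \<in> cball x (2 * r) \<longrightarrow> v y = u y"
    and vm: "v \<in> borel_measurable (lebesgue_on \<Omega>)" and \<Omega>: "open \<Omega>"
  shows "(LINT y|lborel. (Re e * mollifier_der True r (x - y) + Im e * mollifier_der False r (x - y)) *\<^sub>R f y)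
    = mollify r u x"
proof -
  let ?\<phi> = "\<lambda>y. mollifier r (x - y)"
  let ?D = "\<lambda>y. Re e * mollifier_der True r (x - y) + Im e * mollifier_der False r (x - y)"
  have [measurable]: "f \<in> borel_measurable borel"
    by (rule borel_measurable_continuous_onI[OF f])
  have fd: "frechet_derivative ?\<phi> (at y) e = - ?D y" for y
    by (simp add: frechet_derivative_at[OF mollifier_reflected_has_derivative[OF r(1)], symmetric])
  have supp: "y \<in> cball x (2 * r)" if "?D y \<noteq> 0" for y
  proof -
    have "mollifier_der True r (x - y) \<noteq> 0 \<or> mollifier_der False r (x - y) \<noteq> 0"
      using that by auto
    then show ?thesis
      using mollifier_der_support[OF r(1), of _ "x - y"] by (auto simp: dist_norm)
  qed
  have supp': "y \<in> cball x (2 * r)" if "?\<phi> y \<noteq> 0" for y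
    using that mollifier_support[OF r(1), of "x - y"] by (auto simp: dist_norm)
  have "(LINT z:\<Omega>|lebesgue. frechet_derivative ?\<phi> (at z) e *\<^sub>R f z) = (LINT y|lebesgue. - (?D y *\<^sub>R f y))"
    unfolding set_lebesgue_integral_def fd
  proof (intro Bochner_Integration.integral_cong refl)
    fix y show "indicator \<Omega> y *\<^sub>R - ?D y *\<^sub>R f y = - (?D y *\<^sub>R f y)"
    proof (cases "?D y = 0")
      case True
      then show ?thesis by (simp only: minus_zero scaleR_zero_left scaleR_zero_right)
    next
      case False
      then have "y \<in> \<Omega>" using supp[of y] r(2) by blast
      then show ?thesis by (simp only: indicator_simps scaleR_one scaleR_minus_left)
    qed
  qed
  also have "\<dots> = - (LINT y|lborel. ?D y *\<^sub>R f y)"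
    by (subst integral_completion) auto
  finally have 1: "(LINT y|lborel. ?D y *\<^sub>R f y) = (LINT z:\<Omega>|lebesgue. ?\<phi> z *\<^sub>R v z)"
    using weak[OF mollifier_test_function[OF r]] by simp
  have "(LINT z:\<Omega>|lebesgue. ?\<phi> z *\<^sub>R v z) = (LINT y|lebesgue. ?\<phi> y *\<^sub>R u y)"
    unfolding set_lebesgue_integral_def
  proof (rule integral_cong_AE)
    have "(\<lambda>z. indicator \<Omega> z *\<^sub>R v z) \<in> borel_measurable lebesgue"
      using vm \<Omega> by (simp add: borel_measurable_restrict_space_iff)
    moreover have "?\<phi> \<in> borel_measurable lebesgue"
      by (rule measurable_completion) measurable
    ultimately have "(\<lambda>z. ?\<phi> z *\<^sub>R (indicator \<Omega> z *\<^sub>R v z)) \<in> borel_measurable lebesgue"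
      by measurable
    then show "(\<lambda>z. indicator \<Omega> z *\<^sub>R ?\<phi> z *\<^sub>R v z) \<in> borel_measurable lebesgue"
      by (simp add: mult.commute)
    show "(\<lambda>z. ?\<phi> z *\<^sub>R u z) \<in> borel_measurable lebesgue"
      by (rule measurable_completion) measurable
    show "AE z in lebesgue. indicator \<Omega> z *\<^sub>R ?\<phi> z *\<^sub>R v z = ?\<phi> z *\<^sub>R u z"
      using AE_completion[OF v]
    proof eventually_elim
      case (elim y)
      then show ?case
        using supp'[of y] r(2) by (cases "?\<phi> y = 0") (auto simp: indicator_def)
    qed
  qed
  also have "\<dots> = mollify r u x"
    unfolding mollify_def by (subst integral_completion) auto
  finally show ?thesis using 1 by simp
qed

text \<open>The function is truncated both in its argument and in its values. Continuous functions
  converging almost everywhere to the truncation are then forced under an integrable bound, so that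
  dominated convergence applies.\<close>

lemma continuous_dense_L1:
  fixes u :: "complex \<Rightarrow> complex"
  assumes u: "integrable lborel u" and "0 < \<epsilon>"
  obtains G R where "continuous_on UNIV G" "\<And>x. R < norm x \<Longrightarrow> G x = 0"
    "(\<integral>\<^sup>+x. norm (u x - G x) \<partial>lborel) < ennreal \<epsilon>"
proof -
  have [measurable]: "u \<in> borel_measurable borel" using u by auto
  define t where "t M x = (if norm x \<le> real M \<and> norm (u x) \<le> real M then u x else 0)" for M x
  have [measurable]: "t M \<in> borel_measurable borel" for M
    unfolding t_def by measurable
  have t_lim: "(\<lambda>M. norm (u x - t M x)) \<longlonglongrightarrow> 0" for x
  proof (rule tendsto_eventually)
    obtain M0 :: nat where "max (norm x) (norm (u x)) \<le> real M0"
      using real_arch_simple by blast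
    then show "eventually (\<lambda>M. norm (u x - t M x) = 0) sequentially"
      by (auto simp: t_def eventually_sequentially intro!: exI[of _ M0])
  qed
  have "(\<lambda>M. LINT x|lborel. norm (u x - t M x)) \<longlonglongrightarrow> (LINT x|(lborel :: complex measure). 0)"
    by (rule integral_dominated_convergence[where w="\<lambda>x. norm (u x)"])
       (use u t_lim in \<open>auto simp: t_def intro!: AE_I2\<close>)
  then have "(\<lambda>M. LINT x|lborel. norm (u x - t M x)) \<longlonglongrightarrow> 0" by simp
  then obtain M where M: "(LINT x|lborel. norm (u x - t M x)) < \<epsilon> / 2"
    using \<open>0 < \<epsilon>\<close> order_tendstoD(2)[of _ 0 sequentially "\<epsilon> / 2"] by (force simp: eventually_sequentially)
  have "t M \<in> borel_measurable lebesgue"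
    by (simp add: measurable_completion)
  then have "t M measurable_on UNIV"
    by (intro lebesgue_measurable_imp_measurable_on) auto
  then obtain N g where N: "negligible N" and g: "\<And>n. continuous_on UNIV (g n)"
    and lim: "\<And>x. x \<notin> N \<Longrightarrow> (\<lambda>n. g n x) \<longlonglongrightarrow> t M x"
    unfolding measurable_on_def by auto
  define B where "B = cball (0::complex) (real M)"
  have B: "convex B" "closed B" "B \<noteq> {}" by (auto simp: B_def)
  \<comment> \<open>The factor \<open>cut\<close> is 1 where \<open>norm x \<le> M\<close> and
    vanishes beyond \<open>M + 1\<close>. Projecting onto \<open>B\<close> bounds the values by
    \<open>M\<close>. Neither changes the limit, because the truncation is supported where
    \<open>cut\<close> is 1 and takes values in \<open>B\<close>.\<close>
  define cut where "cut x = max 0 (min 1 (real M + 1 - norm x))" for x :: complex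
  define G where "G n x = cut x *\<^sub>R closest_point B (g n x)" for n x
  have contG: "continuous_on UNIV (G n)" for n
    unfolding G_def cut_def
    by (intro continuous_intros continuous_on_compose2[OF continuous_on_closest_point[OF B] g]) auto
  then have [measurable]: "G n \<in> borel_measurable borel" for n
    by (rule borel_measurable_continuous_onI)
  have supp: "G n x = 0" if "real M + 1 < norm x" for n x
    using that by (simp add: G_def cut_def)
  have limG: "(\<lambda>n. G n x) \<longlonglongrightarrow> t M x" if "x \<notin> N" for x
  proof -
    have tB: "t M x \<in> B" by (simp add: t_def B_def)
    have "(\<lambda>n. closest_point B (g n x)) \<longlonglongrightarrow> closest_point B (t M x)"
      by (rule continuous_on_tendsto_compose[OF continuous_on_closest_point[OF B, where t=UNIV] lim[OF that]]) auto
    then have "(\<lambda>n. G n x) \<longlonglongrightarrow> cut x *\<^sub>R t M x"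
      using closest_point_self[OF tB] unfolding G_def by (intro tendsto_intros) simp
    moreover have "cut x *\<^sub>R t M x = t M x"
      by (auto simp: cut_def t_def)
    ultimately show ?thesis by simp
  qed
  have normG: "norm (G n x) \<le> real M * indicator (cball 0 (real M + 1)) x" for n x
  proof (cases "x \<in> cball 0 (real M + 1)")
    case True
    have "norm (closest_point B (g n x)) \<le> real M"
      using closest_point_in_set[OF B(2,3), of "g n x"] by (simp add: B_def)
    moreover have "0 \<le> cut x" "cut x \<le> 1" by (auto simp: cut_def)
    ultimately have "\<bar>cut x\<bar> * norm (closest_point B (g n x)) \<le> 1 * real M"
      by (intro mult_mono) auto
    with True show ?thesis by (simp add: G_def)
  qed (auto simp: supp)
  have normt: "norm (t M x) \<le> real M * indicator (cball 0 (real M + 1)) x" for x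
    by (auto simp: t_def indicator_def)
  have intB: "integrable lborel (\<lambda>x::complex. 2 * (real M * indicator (cball 0 (real M + 1)) x))"
    by (auto intro!: integrable_mult_right integrable_real_indicator emeasure_lborel_cball_finite)
  have aeN: "AE x in lborel. x \<notin> N"
  proof -
    have "AE x in lebesgue. x \<notin> N"
      using N by (intro AE_not_in) (simp add: negligible_iff_null_sets)
    then show ?thesis by (simp add: AE_completion_iff)
  qed
  have bd: "norm (t M x - G n x) \<le> 2 * (real M * indicator (cball 0 (real M + 1)) x)" for n x
    using norm_triangle_ineq4[of "t M x" "G n x"] normG[of n x] normt[of x] by linarith
  have "(\<lambda>n. LINT x|lborel. norm (t M x - G n x)) \<longlonglongrightarrow> (LINT x|(lborel :: complex measure). 0)"
  proof (rule integral_dominated_convergence[OF _ _ intB])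
    show "AE x in lborel. (\<lambda>n. norm (t M x - G n x)) \<longlonglongrightarrow> 0"
      using aeN
    proof eventually_elim
      case (elim x)
      have "(\<lambda>n. norm (t M x - G n x)) \<longlonglongrightarrow> norm (t M x - t M x)"
        by (intro tendsto_intros limG[OF elim])
      then show ?case by simp
    qed
  qed (use bd in auto)
  then have "(\<lambda>n. LINT x|lborel. norm (t M x - G n x)) \<longlonglongrightarrow> 0" by simp
  then obtain n where n: "(LINT x|lborel. norm (t M x - G n x)) < \<epsilon> / 2"
    using \<open>0 < \<epsilon>\<close> order_tendstoD(2)[of _ 0 sequentially "\<epsilon> / 2"] by (force simp: eventually_sequentially)
  have i1: "integrable lborel (\<lambda>x. norm (u x - t M x))"
    by (rule Bochner_Integration.integrable_bound[OF integrable_norm[OF u]]) (auto simp: t_def)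
  have i2: "integrable lborel (\<lambda>x. norm (t M x - G n x))"
    by (rule Bochner_Integration.integrable_bound[OF intB]) (use bd in \<open>auto intro: order_trans[OF _ abs_ge_self]\<close>)
  have "(\<integral>\<^sup>+x. norm (u x - G n x) \<partial>lborel) \<le> (\<integral>\<^sup>+x. ennreal (norm (u x - t M x) + norm (t M x - G n x)) \<partial>lborel)"
    by (intro nn_integral_mono ennreal_leI norm_diff_triangle_le) auto
  also have "\<dots> = ennreal ((LINT x|lborel. norm (u x - t M x)) + (LINT x|lborel. norm (t M x - G n x)))"
    using i1 i2 by (subst nn_integral_eq_integral) auto
  also have "\<dots> < ennreal \<epsilon>"
    using M n \<open>0 < \<epsilon>\<close> by (intro ennreal_lessI) auto
  finally show thesis
    using that[OF contG supp] by blast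
qed

lemma nn_integral_lborel_translate:
  fixes F :: "complex \<Rightarrow> ennreal"
  assumes [measurable]: "F \<in> borel_measurable borel"
  shows "(\<integral>\<^sup>+y. F (y - v) \<partial>lborel) = (\<integral>\<^sup>+y. F y \<partial>lborel)"
  by (subst (2) lborel_distr_plus[of "- v", symmetric], subst nn_integral_distr) (auto simp: add.commute)

text \<open>A continuous function of bounded support is uniformly continuous, so it moves little in
  the mean under small translations. Replacing \<open>u\<close> by such a function costs one third
  of \<epsilon> before and one third after the translation.\<close>

lemma continuous_translation_L1:
  fixes u :: "complex \<Rightarrow> complex"
  assumes u: "integrable lborel u" and "0 < \<epsilon>"
  obtains \<rho> where "0 < \<rho>"
    "\<And>v. norm v < \<rho> \<Longrightarrow> (\<integral>\<^sup>+x. norm (u (x - v) - u x) \<partial>lborel) \<le> ennreal \<epsilon>"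
proof -
  have [measurable]: "u \<in> borel_measurable borel" using u by auto
  obtain G R where G: "continuous_on UNIV G" and supp: "\<And>x. R < norm x \<Longrightarrow> G x = 0"
    and uG: "(\<integral>\<^sup>+x. norm (u x - G x) \<partial>lborel) < ennreal (\<epsilon> / 3)"
    using continuous_dense_L1[OF u, of "\<epsilon> / 3"] \<open>0 < \<epsilon>\<close> by auto
  have [measurable]: "G \<in> borel_measurable borel"
    by (rule borel_measurable_continuous_onI[OF G])
  define S where "S = cball (0::complex) (\<bar>R\<bar> + 1)"
  have [measurable]: "S \<in> sets borel" by (simp add: S_def)
  define m where "m = measure lborel S"
  have mS: "emeasure lborel S = ennreal m"
    unfolding m_def S_def using emeasure_lborel_cball_finite
    by (intro emeasure_eq_ennreal_measure) (auto simp: less_top)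
  \<comment> \<open>Chosen so that a uniform error \<eta> on \<open>S\<close> has integral at most
    \<epsilon>/3. As \<open>norm v < 1\<close>, the difference of \<open>G\<close> and its translate
    vanishes outside \<open>S\<close>.\<close>
  define \<eta> where "\<eta> = \<epsilon> / (3 * (m + 1))"
  have "0 \<le> m" by (simp add: m_def)
  then have \<eta>: "0 < \<eta>" "\<eta> * m \<le> \<epsilon> / 3"
    using \<open>0 < \<epsilon>\<close> by (auto simp: \<eta>_def field_simps)
  have "uniformly_continuous_on (cball 0 (\<bar>R\<bar> + 2)) G"
    by (intro compact_uniformly_continuous continuous_on_subset[OF G]) auto
  then obtain d where "0 < d" and d: "\<And>x y. x \<in> cball 0 (\<bar>R\<bar> + 2) \<Longrightarrow> y \<in> cball 0 (\<bar>R\<bar> + 2) \<Longrightarrow>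
      dist y x < d \<Longrightarrow> dist (G y) (G x) < \<eta>"
    unfolding uniformly_continuous_on_def using \<eta>(1) by metis
  have mid: "norm (G (x - v) - G x) \<le> \<eta> * indicator S x" if "norm v < min d 1" for x v
  proof (cases "x \<in> S")
    case True
    then have "norm (x - v) \<le> \<bar>R\<bar> + 2"
      using norm_triangle_ineq4[of x v] that by (auto simp: S_def)
    then show ?thesis
      using d[of x "x - v"] True that by (auto simp: S_def dist_norm norm_minus_commute)
  next
    case False
    then have "R < norm x" "R < norm (x - v)"
      using norm_triangle_ineq2[of x v] that by (auto simp: S_def)
    then show ?thesis by (simp add: supp \<open>0 < \<eta>\<close> less_imp_le)
  qed
  show thesis
  proof
    show "0 < min d 1" using \<open>0 < d\<close> by simp
    fix v :: complex assume v: "norm v < min d 1"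
    have "(\<integral>\<^sup>+x. norm (u (x - v) - u x) \<partial>lborel)
       \<le> (\<integral>\<^sup>+x. ennreal (norm (u (x - v) - G (x - v))) + (ennreal (norm (G (x - v) - G x)) + ennreal (norm (u x - G x))) \<partial>lborel)"
    proof (rule nn_integral_mono)
      fix x
      have "norm (u (x - v) - u x) \<le> norm (u (x - v) - G (x - v)) + (norm (G (x - v) - G x) + norm (u x - G x))"
        by norm
      then show "ennreal (norm (u (x - v) - u x)) \<le> ennreal (norm (u (x - v) - G (x - v)))
          + (ennreal (norm (G (x - v) - G x)) + ennreal (norm (u x - G x)))"
        by (simp add: ennreal_plus[symmetric] del: ennreal_plus)
    qed
    also have "\<dots> = (\<integral>\<^sup>+x. ennreal (norm (u (x - v) - G (x - v))) \<partial>lborel)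
        + ((\<integral>\<^sup>+x. ennreal (norm (G (x - v) - G x)) \<partial>lborel) + (\<integral>\<^sup>+x. ennreal (norm (u x - G x)) \<partial>lborel))"
      by (simp add: nn_integral_add)
    also have "\<dots> \<le> ennreal (\<epsilon> / 3) + (ennreal (\<epsilon> / 3) + ennreal (\<epsilon> / 3))"
    proof (intro add_mono)
      show "(\<integral>\<^sup>+x. ennreal (norm (u (x - v) - G (x - v))) \<partial>lborel) \<le> ennreal (\<epsilon> / 3)"
        using nn_integral_lborel_translate[of "\<lambda>x. ennreal (norm (u x - G x))" v] uG by simp
      have "(\<integral>\<^sup>+x. ennreal (norm (G (x - v) - G x)) \<partial>lborel) \<le> (\<integral>\<^sup>+x. ennreal \<eta> * indicator S x \<partial>lborel)"
        by (intro nn_integral_mono order_trans[OF ennreal_leI[OF mid[OF v]]]) (auto simp: indicator_def)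
      also have "\<dots> = ennreal (\<eta> * m)"
        using \<eta> \<open>0 \<le> m\<close> by (subst nn_integral_cmult_indicator) (auto simp: mS ennreal_mult)
      also have "\<dots> \<le> ennreal (\<epsilon> / 3)"
        using \<eta> by (intro ennreal_leI)
      finally show "(\<integral>\<^sup>+x. ennreal (norm (G (x - v) - G x)) \<partial>lborel) \<le> ennreal (\<epsilon> / 3)" .
    qed (use uG in auto)
    also have "\<dots> = ennreal \<epsilon>"
      using \<open>0 < \<epsilon>\<close> by (simp add: ennreal_plus[symmetric] del: ennreal_plus)
    finally show "(\<integral>\<^sup>+x. norm (u (x - v) - u x) \<partial>lborel) \<le> ennreal \<epsilon>" .
  qed
qed

lemma integrable_mollifier_reflected:
  assumes "0 < r"
  shows "integrable lborel (\<lambda>y. mollifier r (x - y))" "(LINT y|lborel. mollifier r (x - y)) = 1"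
proof -
  have 1: "(\<integral>\<^sup>+y. ennreal (mollifier r (x - y)) \<partial>lborel) = 1"
    using nn_integral_lborel_reflect[of "\<lambda>y. ennreal (mollifier r y)" x] nn_integral_mollifier[OF assms]
    by simp
  show 2: "integrable lborel (\<lambda>y. mollifier r (x - y))"
    by (rule integrableI_bounded) (auto simp: mollifier_nonneg 1)
  show "(LINT y|lborel. mollifier r (x - y)) = 1"
    using nn_integral_eq_integral[OF 2] 1 mollifier_nonneg
    by (simp add: integral_nonneg_AE ennreal_eq_1)
qed

lemma mollify_diff:
  assumes r: "0 < r" and int: "integrable lborel (\<lambda>y. mollifier r (x - y) *\<^sub>R u y)"
  shows "mollify r u x - u x = (LINT y|lborel. mollifier r (x - y) *\<^sub>R (u y - u x))"
    and "ennreal (norm (mollify r u x - u x)) \<le> (\<integral>\<^sup>+y. ennreal (mollifier r (x - y)) * ennreal (norm (u y - u x)) \<partial>lborel)"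
proof -
  have i2: "integrable lborel (\<lambda>y. mollifier r (x - y) *\<^sub>R u x)"
    using integrable_mollifier_reflected(1)[OF r] by simp
  show eq: "mollify r u x - u x = (LINT y|lborel. mollifier r (x - y) *\<^sub>R (u y - u x))"
    unfolding mollify_def scaleR_diff_right
    by (subst Bochner_Integration.integral_diff[OF int i2]) (simp add: integrable_mollifier_reflected[OF r])
  have "integrable lborel (\<lambda>y. mollifier r (x - y) *\<^sub>R (u y - u x))"
    unfolding scaleR_diff_right using int i2 by (rule Bochner_Integration.integrable_diff)
  from integral_norm_bound_ennreal[OF this]
  show "ennreal (norm (mollify r u x - u x)) \<le> (\<integral>\<^sup>+y. ennreal (mollifier r (x - y)) * ennreal (norm (u y - u x)) \<partial>lborel)"
    unfolding eq by (simp add: ennreal_mult mollifier_nonneg)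
qed

text \<open>By Fubini the distance is at most the average, weighted by the mollifier, of the
  distances between \<open>u\<close> and its translates by vectors of norm at most
  \<open>2 * r\<close>. Since \<open>r < \<rho> / 3\<close>, all of these translations are
  admissible.\<close>

lemma mollify_tendsto_L1:
  fixes u :: "complex \<Rightarrow> complex"
  assumes u: "integrable lborel u" and "0 < \<epsilon>"
  obtains \<rho> where "0 < \<rho>"
    "\<And>r. 0 < r \<Longrightarrow> r < \<rho> \<Longrightarrow> (\<integral>\<^sup>+x. norm (mollify r u x - u x) \<partial>lborel) \<le> ennreal \<epsilon>"
proof -
  have [measurable]: "u \<in> borel_measurable borel" using u by auto
  obtain \<rho> where "0 < \<rho>" and \<rho>: "\<And>v. norm v < \<rho> \<Longrightarrow> (\<integral>\<^sup>+x. norm (u (x - v) - u x) \<partial>lborel) \<le> ennreal \<epsilon>"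
    using continuous_translation_L1[OF assms] by blast
  have "(\<integral>\<^sup>+x. norm (mollify r u x - u x) \<partial>lborel) \<le> ennreal \<epsilon>" if r: "0 < r" "r < \<rho> / 3" for r
  proof -
    have "(\<integral>\<^sup>+x. norm (mollify r u x - u x) \<partial>lborel)
      \<le> (\<integral>\<^sup>+x. (\<integral>\<^sup>+y. ennreal (mollifier r (x - y)) * ennreal (norm (u y - u x)) \<partial>lborel) \<partial>lborel)"
      by (intro nn_integral_mono mollify_diff(2)[OF r(1)] integrable_mollifier_times u)
    also have "\<dots> = (\<integral>\<^sup>+x. (\<integral>\<^sup>+v. ennreal (mollifier r v) * ennreal (norm (u (x - v) - u x)) \<partial>lborel) \<partial>lborel)"
    proof (rule nn_integral_cong)
      fix x
      show "(\<integral>\<^sup>+y. ennreal (mollifier r (x - y)) * ennreal (norm (u y - u x)) \<partial>lborel)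
        = (\<integral>\<^sup>+v. ennreal (mollifier r v) * ennreal (norm (u (x - v) - u x)) \<partial>lborel)"
        using nn_integral_lborel_reflect[of "\<lambda>v. ennreal (mollifier r v) * ennreal (norm (u (x - v) - u x))" x]
        by simp
    qed
    also have "\<dots> = (\<integral>\<^sup>+v. (\<integral>\<^sup>+x. ennreal (mollifier r v) * ennreal (norm (u (x - v) - u x)) \<partial>lborel) \<partial>lborel)"
      by (rule lborel_pair.Fubini') measurable
    also have "\<dots> = (\<integral>\<^sup>+v. ennreal (mollifier r v) * (\<integral>\<^sup>+x. ennreal (norm (u (x - v) - u x)) \<partial>lborel) \<partial>lborel)"
      by (intro nn_integral_cong nn_integral_cmult) measurable
    also have "\<dots> \<le> (\<integral>\<^sup>+v. ennreal (mollifier r v) * ennreal \<epsilon> \<partial>lborel)"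
    proof (rule nn_integral_mono)
      fix v
      show "ennreal (mollifier r v) * (\<integral>\<^sup>+x. ennreal (norm (u (x - v) - u x)) \<partial>lborel) \<le> ennreal (mollifier r v) * ennreal \<epsilon>"
      proof (cases "mollifier r v = 0")
        case False
        then have "norm v < \<rho>"
          using mollifier_support[OF r(1), of v] r by linarith
        then show ?thesis
          using \<rho> by (intro mult_left_mono) auto
      qed simp
    qed
    also have "\<dots> = ennreal \<epsilon>"
      by (simp add: nn_integral_multc nn_integral_mollifier[OF r(1)])
    finally show ?thesis .
  qed
  then show thesis
    using that[of "\<rho> / 3"] \<open>0 < \<rho>\<close> by simp
qed

lemma mollify_tendsto_uniformly:
  assumes f: "continuous_on UNIV f" and C: "compact C" and "0 < \<epsilon>"
  obtains \<rho> where "0 < \<rho>"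
    "\<And>r x. 0 < r \<Longrightarrow> r < \<rho> \<Longrightarrow> x \<in> C \<Longrightarrow> norm (mollify r f x - f x) \<le> \<epsilon>"
proof -
  obtain R where R: "\<And>x. x \<in> C \<Longrightarrow> norm x \<le> R"
    using compact_imp_bounded[OF C] by (auto simp: bounded_iff)
  have [measurable]: "f \<in> borel_measurable borel"
    by (rule borel_measurable_continuous_onI[OF f])
  have "uniformly_continuous_on (cball 0 (R + 1)) f"
    by (intro compact_uniformly_continuous continuous_on_subset[OF f]) auto
  then obtain d where "0 < d" and d: "\<And>x y. x \<in> cball 0 (R + 1) \<Longrightarrow> y \<in> cball 0 (R + 1) \<Longrightarrow>
      dist y x < d \<Longrightarrow> dist (f y) (f x) < \<epsilon>"
    unfolding uniformly_continuous_on_def using \<open>0 < \<epsilon>\<close> by metis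
  have "norm (mollify r f x - f x) \<le> \<epsilon>" if r: "0 < r" "r < min d 1 / 3" and x: "x \<in> C" for r x
  proof -
    have near: "norm (f y - f x) \<le> \<epsilon>" if "mollifier r (x - y) \<noteq> 0" for y
    proof -
      have n: "norm (x - y) \<le> 2 * r"
        by (rule mollifier_support[OF r(1) that])
      then have "norm (y - x) < d" "norm y \<le> R + 1"
        using r R[OF x] norm_triangle_ineq4[of x "x - y"] by (auto simp: norm_minus_commute)
      then show ?thesis
        using d[of x y] R[OF x] by (auto simp: dist_norm)
    qed
    have "integrable lborel (\<lambda>y. indicator (cball x (2 * r)) y *\<^sub>R (mollifier r (x - y) *\<^sub>R f y))"
      by (intro borel_integrable_compact continuous_intros continuous_on_subset[OF f]) auto
    also have "(\<lambda>y. indicator (cball x (2 * r)) y *\<^sub>R (mollifier r (x - y) *\<^sub>R f y))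
        = (\<lambda>y. mollifier r (x - y) *\<^sub>R f y)"
      using mollifier_support[OF r(1), of "x - _"] by (force simp: fun_eq_iff indicator_def dist_norm)
    finally have "ennreal (norm (mollify r f x - f x))
        \<le> (\<integral>\<^sup>+y. ennreal (mollifier r (x - y)) * ennreal (norm (f y - f x)) \<partial>lborel)"
      by (rule mollify_diff(2)[OF r(1)])
    also have "\<dots> \<le> (\<integral>\<^sup>+y. ennreal (mollifier r (x - y)) * ennreal \<epsilon> \<partial>lborel)"
    proof (rule nn_integral_mono)
      fix y show "ennreal (mollifier r (x - y)) * ennreal (norm (f y - f x)) \<le> ennreal (mollifier r (x - y)) * ennreal \<epsilon>"
        using near[of y] by (cases "mollifier r (x - y) = 0") (auto intro!: mult_left_mono ennreal_leI)
    qed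
    also have "\<dots> = ennreal \<epsilon>"
      using nn_integral_lborel_reflect[of "\<lambda>y. ennreal (mollifier r y) * ennreal \<epsilon>" x]
      by (simp add: nn_integral_multc nn_integral_mollifier[OF r(1)])
    finally show ?thesis
      using \<open>0 < \<epsilon>\<close> by simp
  qed
  then show thesis
    using that[of "min d 1 / 3"] \<open>0 < d\<close> by simp
qed

section \<open>Absolute continuity on curves\<close>

text \<open>All derivatives fall on the mollifier, so continuity of \<open>f\<close>
  suffices.\<close>

lemma mollify_FTC:
  fixes \<Gamma> e :: "real \<Rightarrow> complex"
  assumes r: "0 < r" and f: "continuous_on UNIV f" and "a \<le> b"
    and \<Gamma>: "\<And>s. s \<in> {a..b} \<Longrightarrow> (\<Gamma> has_vector_derivative e s) (at s within {a..b})"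
    and e: "continuous_on {a..b} e"
  shows "((\<lambda>s. LINT y|lborel. (Re (e s) * mollifier_der True r (\<Gamma> s - y)
        + Im (e s) * mollifier_der False r (\<Gamma> s - y)) *\<^sub>R f y)
      has_integral (mollify r f (\<Gamma> b) - mollify r f (\<Gamma> a))) {a..b}"
proof -
  let ?D = "\<lambda>s y. Re (e s) * mollifier_der True r (\<Gamma> s - y) + Im (e s) * mollifier_der False r (\<Gamma> s - y)"
  have cont\<Gamma>: "continuous_on {a..b} \<Gamma>"
    using \<Gamma> by (rule continuous_on_vector_derivative)
  have "bounded (\<Gamma> ` {a..b})"
    by (intro compact_imp_bounded compact_continuous_image cont\<Gamma>) auto
  then obtain R where R: "\<And>s. s \<in> {a..b} \<Longrightarrow> norm (\<Gamma> s) \<le> R"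
    unfolding bounded_iff by (metis imageI)
  \<comment> \<open>One box contains the supports of all mollifiers centred on the curve. The
    Leibniz rule can then be applied to an integral over a fixed compact set.\<close>
  obtain m where m: "cball (0::complex) (R + 2 * r) \<subseteq> cbox (- m) m"
    using bounded_subset_cbox_symmetric[OF bounded_cball] by blast
  have in_box: "y \<in> cbox (- m) m" if "s \<in> {a..b}" "norm (\<Gamma> s - y) \<le> 2 * r" for s y
    using m R[OF that(1)] that(2) norm_triangle_ineq4[of "\<Gamma> s" "\<Gamma> s - y"] by (auto simp: subset_iff)
  have lint_eq: "(LINT y|lborel. h y *\<^sub>R f y) = integral (cbox (- m) m) (\<lambda>y. h y *\<^sub>R f y)"
    if h: "continuous_on UNIV h" and supp: "\<And>y. h y \<noteq> 0 \<Longrightarrow> y \<in> cbox (- m) m" for h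
  proof -
    have "set_integrable lborel (cbox (- m) m) (\<lambda>y. h y *\<^sub>R f y)"
      unfolding set_integrable_def
      by (intro borel_integrable_compact continuous_intros continuous_on_subset[OF f] continuous_on_subset[OF h]) auto
    from set_borel_integral_eq_integral(2)[OF this]
    have "integral (cbox (- m) m) (\<lambda>y. h y *\<^sub>R f y) = (LINT y|lborel. indicator (cbox (- m) m) y *\<^sub>R (h y *\<^sub>R f y))"
      by (simp add: set_lebesgue_integral_def)
    also have "(\<lambda>y. indicator (cbox (- m) m) y *\<^sub>R (h y *\<^sub>R f y)) = (\<lambda>y. h y *\<^sub>R f y)"
      using supp by (auto simp: fun_eq_iff indicator_def)
    finally show ?thesis by simp
  qed
  have moll: "mollify r f (\<Gamma> s) = integral (cbox (- m) m) (\<lambda>y. mollifier r (\<Gamma> s - y) *\<^sub>R f y)" if "s \<in> {a..b}" for s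
    unfolding mollify_def
    by (intro lint_eq continuous_intros) (use in_box[OF that] mollifier_support[OF r] in blast)
  have der: "(LINT y|lborel. ?D s y *\<^sub>R f y) = integral (cbox (- m) m) (\<lambda>y. ?D s y *\<^sub>R f y)" if "s \<in> {a..b}" for s
  proof (intro lint_eq continuous_intros)
    fix y assume "?D s y \<noteq> 0"
    then have "mollifier_der True r (\<Gamma> s - y) \<noteq> 0 \<or> mollifier_der False r (\<Gamma> s - y) \<noteq> 0"
      by auto
    then show "y \<in> cbox (- m) m"
      using in_box[OF that] mollifier_der_support[OF r] by blast
  qed
  have "((\<lambda>s. integral (cbox (- m) m) (\<lambda>y. mollifier r (\<Gamma> s - y) *\<^sub>R f y)) has_vector_derivative
      integral (cbox (- m) m) (\<lambda>y. ?D s y *\<^sub>R f y)) (at s within {a..b})" if s: "s \<in> {a..b}" for s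
  proof (rule leibniz_rule_vector_derivative[where fx="\<lambda>s y. ?D s y *\<^sub>R f y"])
    fix s t assume s: "s \<in> {a..b}"
    have "((\<lambda>s. \<Gamma> s - t) has_vector_derivative e s) (at s within {a..b})"
      using \<Gamma>[OF s] by (auto intro!: derivative_eq_intros)
    have "((\<lambda>s. mollifier r (\<Gamma> s - t)) has_vector_derivative ?D s t) (at s within {a..b})"
    proof -
      have 1: "((\<lambda>s. \<Gamma> s - t) has_derivative (\<lambda>h. h *\<^sub>R e s)) (at s within {a..b})"
        using \<open>((\<lambda>s. \<Gamma> s - t) has_vector_derivative e s) (at s within {a..b})\<close>
        by (simp add: has_vector_derivative_def)
      have "((mollifier r \<circ> (\<lambda>s. \<Gamma> s - t)) has_derivative
        ((\<lambda>h. Re h * mollifier_der True r (\<Gamma> s - t) + Im h * mollifier_der False r (\<Gamma> s - t)) \<circ> (\<lambda>h. h *\<^sub>R e s)))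
        (at s within {a..b})"
        by (rule diff_chain_within[OF 1]) (rule has_derivative_at_withinI[OF mollifier_has_derivative[OF r]])
      then show ?thesis
        by (simp add: has_vector_derivative_def o_def algebra_simps)
    qed
    then show "((\<lambda>s. mollifier r (\<Gamma> s - t) *\<^sub>R f t) has_vector_derivative ?D s t *\<^sub>R f t) (at s within {a..b})"
      by (auto intro!: derivative_eq_intros simp: has_real_derivative_iff_has_vector_derivative)
  next
    fix s assume "s \<in> {a..b}"
    show "(\<lambda>y. mollifier r (\<Gamma> s - y) *\<^sub>R f y) integrable_on cbox (- m) m"
      by (intro integrable_continuous continuous_intros continuous_on_subset[OF f]) auto
  next
    have 1: "continuous_on ({a..b} \<times> cbox (- m) m) (\<lambda>x. e (fst x))"
      "continuous_on ({a..b} \<times> cbox (- m) m) (\<lambda>x. \<Gamma> (fst x))"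
      "continuous_on ({a..b} \<times> cbox (- m) m) (\<lambda>x. f (snd x))"
      by (auto intro!: continuous_on_compose2[OF e] continuous_on_compose2[OF cont\<Gamma>] continuous_on_compose2[OF f] continuous_intros)
    show "continuous_on ({a..b} \<times> cbox (- m) m) (\<lambda>(s, y). ?D s y *\<^sub>R f y)"
      unfolding split_beta by (intro continuous_intros 1)
  qed (use s in auto)
  then have "((\<lambda>s. integral (cbox (- m) m) (\<lambda>y. ?D s y *\<^sub>R f y)) has_integral
      (integral (cbox (- m) m) (\<lambda>y. mollifier r (\<Gamma> b - y) *\<^sub>R f y)
        - integral (cbox (- m) m) (\<lambda>y. mollifier r (\<Gamma> a - y) *\<^sub>R f y))) {a..b}"
    by (intro fundamental_theorem_of_calculus \<open>a \<le> b\<close>) auto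
  then show ?thesis
    using moll[of a] moll[of b] der \<open>a \<le> b\<close> by (subst has_integral_cong[OF der]) auto
qed

text \<open>Weak derivatives are only Lebesgue measurable, which does not survive composition with
  the curve families used below. A Borel version, cut off to a compact set, does, and is integrable
  on the whole plane.\<close>

lemma Lq_loc_borel_representative:
  assumes v: "Lq_loc 1 \<Omega> v" and "open \<Omega>" and C: "compact C" "C \<subseteq> \<Omega>"
  obtains u :: "complex \<Rightarrow> complex" where "integrable lborel u" "AE y in lborel. y \<in> C \<longrightarrow> v y = u y"
proof -
  define w where "w y = indicator C y *\<^sub>R v y" for y
  have "(\<lambda>z. indicator \<Omega> z *\<^sub>R v z) \<in> borel_measurable lebesgue"
    using v \<open>open \<Omega>\<close> by (simp add: Lq_loc_def borel_measurable_restrict_space_iff)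
  then have "(\<lambda>z. indicator C z *\<^sub>R (indicator \<Omega> z *\<^sub>R v z)) \<in> borel_measurable lebesgue"
    using lmeasurable_compact[OF C(1)]
    by (intro borel_measurable_scaleR[of "indicator C" lebesgue] borel_measurable_indicator) auto
  also have "(\<lambda>z. indicator C z *\<^sub>R (indicator \<Omega> z *\<^sub>R v z)) = w"
    using C(2) by (auto simp: w_def fun_eq_iff indicator_def)
  finally have wm: "w \<in> borel_measurable lebesgue" .
  have "integrable lebesgue (\<lambda>z. indicator C z *\<^sub>R (norm (v z) powr 1))"
    using v C by (auto simp: Lq_loc_def set_integrable_def)
  also have "(\<lambda>z. indicator C z *\<^sub>R (norm (v z) powr 1)) = (\<lambda>z. norm (w z))"
    by (auto simp: w_def fun_eq_iff indicator_def)
  finally have wi: "integrable lebesgue w"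
    using wm by (simp add: integrable_norm_iff)
  have "(\<lambda>z. Re (w z)) \<in> borel_measurable lebesgue" "(\<lambda>z. Im (w z)) \<in> borel_measurable lebesgue"
    using wm by measurable
  then obtain g1 g2 where [measurable]: "g1 \<in> borel_measurable lborel" "g2 \<in> borel_measurable lborel"
    and g: "AE z in lborel. Re (w z) = g1 z" "AE z in lborel. Im (w z) = g2 z"
    using completion_ex_borel_measurable_real by metis
  define u where "u z = Complex (g1 z) (g2 z)" for z
  have [measurable]: "u \<in> borel_measurable lborel"
    unfolding u_def Complex_eq by measurable
  have ae: "AE z in lborel. w z = u z"
    using g by eventually_elim (simp add: u_def complex_eq_iff)
  have "integrable lebesgue u"
    by (rule integrable_cong_AE_imp[OF wi]) (use AE_completion[OF ae] in \<open>auto simp: measurable_completion eq_commute\<close>)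
  then have "integrable lborel u"
    by (simp add: integrable_completion)
  moreover have "AE y in lborel. y \<in> C \<longrightarrow> v y = u y"
    using ae by eventually_elim (auto simp: w_def)
  ultimately show thesis by (rule that)
qed

lemma W1q_loc_weak_derivative:
  assumes "W1q_loc 1 \<Omega> f Df" "\<phi> \<in> test_functions \<Omega>"
  shows "(LINT z:\<Omega>|lebesgue. frechet_derivative \<phi> (at z) e *\<^sub>R f z)
      = - (LINT z:\<Omega>|lebesgue. \<phi> z *\<^sub>R blinfun_apply (Df z) e)"
  using assms by (simp add: W1q_loc_def)

lemma blinfun_apply_complex:
  fixes A :: "complex \<Rightarrow>\<^sub>L complex"
  shows "blinfun_apply A e = Re e *\<^sub>R blinfun_apply A 1 + Im e *\<^sub>R blinfun_apply A \<i>"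
proof -
  have "e = Re e *\<^sub>R 1 + Im e *\<^sub>R \<i>"
    by (simp add: complex_eq_iff)
  then show ?thesis
    by (metis blinfun.add_right blinfun.scaleR_right)
qed

lemma mollify_combination:
  assumes "integrable lborel P" "integrable lborel Q"
  shows "mollify r (\<lambda>y. a *\<^sub>R P y + b *\<^sub>R Q y) x = a *\<^sub>R mollify r P x + b *\<^sub>R mollify r Q x"
proof -
  have "(\<lambda>y. mollifier r (x - y) *\<^sub>R (a *\<^sub>R P y + b *\<^sub>R Q y))
     = (\<lambda>y. a *\<^sub>R (mollifier r (x - y) *\<^sub>R P y) + b *\<^sub>R (mollifier r (x - y) *\<^sub>R Q y))"
    by (simp add: scaleR_add_right mult.commute)
  then show ?thesis
    using integrable_mollifier_times[OF assms(1), of r x] integrable_mollifier_times[OF assms(2), of r x]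
    by (simp add: mollify_def del: scaleR_scaleR)
qed

lemma nn_integral_pair_lborel:
  fixes F :: "real \<times> real \<Rightarrow> ennreal"
  assumes "F \<in> borel_measurable borel"
  shows "(\<integral>\<^sup>+\<tau>. (\<integral>\<^sup>+t. F (t, \<tau>) \<partial>lborel) \<partial>lborel) = (\<integral>\<^sup>+x. F x \<partial>lborel)"
    and "(\<integral>\<^sup>+t. (\<integral>\<^sup>+\<tau>. F (t, \<tau>) \<partial>lborel) \<partial>lborel) = (\<integral>\<^sup>+x. F x \<partial>lborel)"
proof -
  have "F \<in> borel_measurable (lborel \<Otimes>\<^sub>M lborel)"
    using assms by (simp add: lborel_prod)
  from lborel_pair.nn_integral_snd[OF this] lborel.nn_integral_fst[OF this]
  show "(\<integral>\<^sup>+\<tau>. (\<integral>\<^sup>+t. F (t, \<tau>) \<partial>lborel) \<partial>lborel) = (\<integral>\<^sup>+x. F x \<partial>lborel)"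
    "(\<integral>\<^sup>+t. (\<integral>\<^sup>+\<tau>. F (t, \<tau>) \<partial>lborel) \<partial>lborel) = (\<integral>\<^sup>+x. F x \<partial>lborel)"
    by (simp_all add: lborel_prod)
qed

lemma liminf_eq_0_imp_frequently:
  fixes v :: "nat \<Rightarrow> ennreal"
  assumes "liminf v = 0" "0 < \<epsilon>"
  obtains n where "N \<le> n" "v n < \<epsilon>"
proof (rule ccontr)
  assume "\<not> thesis"
  then have "\<forall>n\<ge>N. \<epsilon> \<le> v n"
    using that by force
  then have "\<epsilon> \<le> liminf v"
    by (intro Liminf_bounded) (auto simp: eventually_sequentially)
  with assms show False by simp
qed

text \<open>Absolute continuity, encoded by the integral representation.\<close>

abbreviation has_L1_derivative ::
    "(real \<Rightarrow> complex) \<Rightarrow> (real \<Rightarrow> complex) \<Rightarrow> real \<Rightarrow> real \<Rightarrow> bool" where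
  "has_L1_derivative \<gamma> p a b \<equiv> set_integrable lborel {a..b} p \<and>
     (\<forall>s t. a \<le> s \<longrightarrow> s \<le> t \<longrightarrow> t \<le> b \<longrightarrow> \<gamma> t - \<gamma> s = (LINT u:{s..t}|lborel. p u))"

text \<open>
  Weakly differentiable continuous maps are absolutely continuous along almost every curve of a
  family that does not concentrate mass: mollification makes this an identity for smooth maps, and
  the mollified derivatives converge in \<open>L\<^sup>1\<close>.
\<close>

lemma weakly_differentiable_ACL:
  fixes \<Gamma> e :: "real \<times> real \<Rightarrow> complex"
  assumes W: "W1q_loc 1 \<Omega> f Df" and \<Omega>: "open \<Omega>" and f: "continuous_on UNIV f"
    and \<Gamma>: "\<And>t \<tau>. ((\<lambda>t. \<Gamma> (t, \<tau>)) has_vector_derivative e (t, \<tau>)) (at t)"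
    and cont\<Gamma>: "continuous_on UNIV \<Gamma>" and e: "continuous_on UNIV e"
    and S: "S = {a..b} \<times> {c..d}" and C: "C \<subseteq> \<Omega>" "0 < r0" "\<And>x. x \<in> S \<Longrightarrow> cball (\<Gamma> x) r0 \<subseteq> C"
    and cov: "\<And>h. h \<in> borel_measurable borel \<Longrightarrow> (\<And>y. 0 \<le> h y) \<Longrightarrow>
        (\<integral>\<^sup>+x. ennreal (h (\<Gamma> x)) * indicator S x \<partial>lborel) \<le> ennreal B * (\<integral>\<^sup>+y. ennreal (h y) \<partial>lborel)"
    and P: "integrable lborel P" "AE y in lborel. y \<in> C \<longrightarrow> blinfun_apply (Df y) 1 = P y"
    and Q: "integrable lborel Q" "AE y in lborel. y \<in> C \<longrightarrow> blinfun_apply (Df y) \<i> = Q y"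
    and p: "\<And>x. p x = Re (e x) *\<^sub>R P (\<Gamma> x) + Im (e x) *\<^sub>R Q (\<Gamma> x)"
  shows "AE \<tau> in lborel. \<tau> \<in> {c..d} \<longrightarrow> set_integrable lborel {a..b} (\<lambda>t. p (t, \<tau>)) \<and>
     (\<forall>s t. a \<le> s \<longrightarrow> s \<le> t \<longrightarrow> t \<le> b \<longrightarrow>
        f (\<Gamma> (t, \<tau>)) - f (\<Gamma> (s, \<tau>)) = (LINT t:{s..t}|lborel. p (t, \<tau>)))"
    and "set_integrable lborel S p"
proof -
  have [measurable]: "P \<in> borel_measurable borel" "Q \<in> borel_measurable borel"
    using P Q by auto
  have [measurable]: "\<Gamma> \<in> borel_measurable borel" "e \<in> borel_measurable borel" "f \<in> borel_measurable borel"
    by (auto intro: borel_measurable_continuous_onI cont\<Gamma> e f)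
  have pm [measurable]: "p \<in> borel_measurable borel"
    unfolding p[abs_def] by measurable
  have cS: "compact S" unfolding S by (intro compact_Times) auto
  then have [measurable]: "S \<in> sets borel" by (simp add: borel_compact)
  have cont\<Gamma>S: "continuous_on S \<Gamma>" "continuous_on S e"
    using cont\<Gamma> e by (auto intro: continuous_on_subset)
  have "bounded (e ` S)"
    by (intro compact_imp_bounded compact_continuous_image cont\<Gamma>S cS)
  then obtain E where E: "\<And>x. x \<in> S \<Longrightarrow> norm (e x) \<le> E" and "0 \<le> E"
    unfolding bounded_pos by (metis imageI less_imp_le)
  have c\<Gamma>S: "compact (\<Gamma> ` S)"
    by (intro compact_continuous_image cont\<Gamma>S cS)

  have comb: "norm (Re (e x) *\<^sub>R u + Im (e x) *\<^sub>R v) \<le> E * (norm u + norm v)" if "x \<in> S" for x u v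
  proof -
    have "norm (Re (e x) *\<^sub>R u + Im (e x) *\<^sub>R v) \<le> \<bar>Re (e x)\<bar> * norm u + \<bar>Im (e x)\<bar> * norm v"
      by (metis norm_scaleR norm_triangle_ineq)
    also have "\<dots> \<le> E * norm u + E * norm v"
      using E[OF that] abs_Re_le_cmod[of "e x"] abs_Im_le_cmod[of "e x"]
      by (intro add_mono mult_right_mono) auto
    finally show ?thesis by (simp add: algebra_simps)
  qed
  \<comment> \<open>Here \<open>cov\<close> is used: smallness in the mean over the plane is
    transferred to the parameter rectangle, with the speed of the curves bounded by
    \<open>E\<close>.\<close>
  have bound: "(\<integral>\<^sup>+x. ennreal (norm (Re (e x) *\<^sub>R u (\<Gamma> x) + Im (e x) *\<^sub>R v (\<Gamma> x))) * indicator S x \<partial>lborel)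
      \<le> ennreal B * (ennreal E * ((\<integral>\<^sup>+y. norm (u y) \<partial>lborel) + (\<integral>\<^sup>+y. norm (v y) \<partial>lborel)))"
    if [measurable]: "u \<in> borel_measurable borel" "v \<in> borel_measurable borel" for u v :: "complex \<Rightarrow> complex"
  proof -
    have "(\<integral>\<^sup>+x. ennreal (norm (Re (e x) *\<^sub>R u (\<Gamma> x) + Im (e x) *\<^sub>R v (\<Gamma> x))) * indicator S x \<partial>lborel)
       \<le> (\<integral>\<^sup>+x. ennreal (E * (norm (u (\<Gamma> x)) + norm (v (\<Gamma> x)))) * indicator S x \<partial>lborel)"
    proof (rule nn_integral_mono)
      fix x show "ennreal (norm (Re (e x) *\<^sub>R u (\<Gamma> x) + Im (e x) *\<^sub>R v (\<Gamma> x))) * indicator S x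
         \<le> ennreal (E * (norm (u (\<Gamma> x)) + norm (v (\<Gamma> x)))) * indicator S x"
        using ennreal_leI[OF comb[of x "u (\<Gamma> x)" "v (\<Gamma> x)"]] by (cases "x \<in> S") auto
    qed
    also have "\<dots> \<le> ennreal B * (\<integral>\<^sup>+y. ennreal (E * (norm (u y) + norm (v y))) \<partial>lborel)"
      using \<open>0 \<le> E\<close> by (intro cov[of "\<lambda>y. E * (norm (u y) + norm (v y))"]) auto
    also have "(\<integral>\<^sup>+y. ennreal (E * (norm (u y) + norm (v y))) \<partial>lborel)
        = (\<integral>\<^sup>+y. ennreal E * (ennreal (norm (u y)) + ennreal (norm (v y))) \<partial>lborel)"
      using \<open>0 \<le> E\<close> by (simp add: ennreal_mult)
    also have "(\<integral>\<^sup>+y. ennreal E * (ennreal (norm (u y)) + ennreal (norm (v y))) \<partial>lborel)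
       = ennreal E * ((\<integral>\<^sup>+y. norm (u y) \<partial>lborel) + (\<integral>\<^sup>+y. norm (v y) \<partial>lborel))"
      by (subst nn_integral_cmult) (auto simp: nn_integral_add)
    finally show ?thesis .
  qed

  have pS: "(\<integral>\<^sup>+x. ennreal (norm (p x)) * indicator S x \<partial>lborel) < \<infinity>"
  proof -
    have "(\<integral>\<^sup>+y. norm (P y) \<partial>lborel) < \<infinity>" "(\<integral>\<^sup>+y. norm (Q y) \<partial>lborel) < \<infinity>"
      using P(1) Q(1) by (auto simp: integrable_iff_bounded)
    then have "ennreal B * (ennreal E * ((\<integral>\<^sup>+y. norm (P y) \<partial>lborel) + (\<integral>\<^sup>+y. norm (Q y) \<partial>lborel))) < \<infinity>"
      by (simp add: ennreal_mult_less_top)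
    then show ?thesis
      using bound[of P Q] unfolding p by (rule le_less_trans[rotated]) auto
  qed
  then show "set_integrable lborel S p"
    unfolding set_integrable_def
    by (intro integrableI_bounded) (auto simp: ennreal_mult[symmetric] ennreal_indicator[symmetric] mult.commute simp del: ennreal_indicator)

  \<comment> \<open>The condition \<open>2 * r \<le> r0\<close> keeps the supports of the mollifiers
    inside \<open>C\<close>, where \<open>P\<close> and \<open>Q\<close> represent the weak
    derivative.\<close>
  define close where "close n r \<longleftrightarrow> 0 < r \<and> 2 * r \<le> r0
      \<and> (\<integral>\<^sup>+x. norm (mollify r P x - P x) \<partial>lborel) \<le> ennreal (1 / real (Suc n))
      \<and> (\<integral>\<^sup>+x. norm (mollify r Q x - Q x) \<partial>lborel) \<le> ennreal (1 / real (Suc n))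
      \<and> (\<forall>x\<in>\<Gamma> ` S. norm (mollify r f x - f x) \<le> 1 / real (Suc n))" for n r
  have ex_r: "\<exists>r. close n r" for n
  proof -
    have pos: "0 < 1 / real (Suc n)" by simp
    obtain \<rho>1 where 1: "0 < \<rho>1" "\<And>r. 0 < r \<Longrightarrow> r < \<rho>1 \<Longrightarrow> (\<integral>\<^sup>+x. norm (mollify r P x - P x) \<partial>lborel) \<le> ennreal (1 / real (Suc n))"
      using mollify_tendsto_L1[OF P(1) pos] by blast
    obtain \<rho>2 where 2: "0 < \<rho>2" "\<And>r. 0 < r \<Longrightarrow> r < \<rho>2 \<Longrightarrow> (\<integral>\<^sup>+x. norm (mollify r Q x - Q x) \<partial>lborel) \<le> ennreal (1 / real (Suc n))"
      using mollify_tendsto_L1[OF Q(1) pos] by blast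
    obtain \<rho>3 where 3: "0 < \<rho>3" "\<And>r x. 0 < r \<Longrightarrow> r < \<rho>3 \<Longrightarrow> x \<in> \<Gamma> ` S \<Longrightarrow> norm (mollify r f x - f x) \<le> 1 / real (Suc n)"
      using mollify_tendsto_uniformly[OF f c\<Gamma>S pos] by blast
    define r where "r = min (min \<rho>1 \<rho>2) (min \<rho>3 r0) / 2"
    have "0 < r" "r < \<rho>1" "r < \<rho>2" "r < \<rho>3" "2 * r \<le> r0"
      using 1(1) 2(1) 3(1) \<open>0 < r0\<close> by (auto simp: r_def)
    then show ?thesis
      unfolding close_def using 1(2) 2(2) 3(2) by blast
  qed
  then obtain r where close: "\<And>n. close n (r n)" by metis
  have r: "\<And>n. 0 < r n" "\<And>n. 2 * r n \<le> r0"
      "\<And>n. (\<integral>\<^sup>+x. norm (mollify (r n) P x - P x) \<partial>lborel) \<le> ennreal (1 / real (Suc n))"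
      "\<And>n. (\<integral>\<^sup>+x. norm (mollify (r n) Q x - Q x) \<partial>lborel) \<le> ennreal (1 / real (Suc n))"
      "\<And>n x. x \<in> S \<Longrightarrow> norm (mollify (r n) f (\<Gamma> x) - f (\<Gamma> x)) \<le> 1 / real (Suc n)"
    using close unfolding close_def by blast+

  have mm [measurable]: "mollify s u \<in> borel_measurable borel"
    if [measurable]: "u \<in> borel_measurable borel" for u s
    unfolding mollify_def[abs_def] by measurable
  define pn where "pn n x = Re (e x) *\<^sub>R mollify (r n) P (\<Gamma> x) + Im (e x) *\<^sub>R mollify (r n) Q (\<Gamma> x)" for n x
  have [measurable]: "pn n \<in> borel_measurable borel" for n
    unfolding pn_def by measurable

  have pn_int: "((\<lambda>t. pn n (t, \<tau>)) has_integral
      mollify (r n) f (\<Gamma> (t, \<tau>)) - mollify (r n) f (\<Gamma> (s, \<tau>))) {s..t}"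
    if st: "a \<le> s" "s \<le> t" "t \<le> b" and \<tau>: "\<tau> \<in> {c..d}" for n s t \<tau>
  proof -
    have eq: "(LINT y|lborel. (Re (e (s', \<tau>)) * mollifier_der True (r n) (\<Gamma> (s', \<tau>) - y)
        + Im (e (s', \<tau>)) * mollifier_der False (r n) (\<Gamma> (s', \<tau>) - y)) *\<^sub>R f y) = pn n (s', \<tau>)"
      if s': "s' \<in> {s..t}" for s'
    proof -
      let ?e = "e (s', \<tau>)"
      let ?u = "\<lambda>y. Re ?e *\<^sub>R P y + Im ?e *\<^sub>R Q y"
      have "(s', \<tau>) \<in> S" using s' st \<tau> by (auto simp: S)
      then have sub: "cball (\<Gamma> (s', \<tau>)) (2 * r n) \<subseteq> C"
        using C(3) r(2)[of n] subset_cball by (meson order_trans)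
      have "(LINT y|lborel. (Re ?e * mollifier_der True (r n) (\<Gamma> (s', \<tau>) - y)
        + Im ?e * mollifier_der False (r n) (\<Gamma> (s', \<tau>) - y)) *\<^sub>R f y) = mollify (r n) ?u (\<Gamma> (s', \<tau>))"
      proof (rule mollify_weak_derivative[OF r(1) _ f _ W1q_loc_weak_derivative[OF W] _ _ \<Omega>])
        show "cball (\<Gamma> (s', \<tau>)) (2 * r n) \<subseteq> \<Omega>" using sub C(1) by blast
        show "AE y in lborel. y \<in> cball (\<Gamma> (s', \<tau>)) (2 * r n) \<longrightarrow> blinfun_apply (Df y) ?e = ?u y"
          using P(2) Q(2)
        proof eventually_elim
          case (elim y)
          then show ?case using sub by (subst blinfun_apply_complex) auto
        qed
        show "(\<lambda>y. blinfun_apply (Df y) ?e) \<in> borel_measurable (lebesgue_on \<Omega>)"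
          using W by (simp add: W1q_loc_def Lq_loc_def)
      qed measurable
      also have "\<dots> = pn n (s', \<tau>)"
        unfolding pn_def by (rule mollify_combination[OF P(1) Q(1)])
      finally show ?thesis .
    qed
    have "((\<lambda>s'. LINT y|lborel. (Re (e (s', \<tau>)) * mollifier_der True (r n) (\<Gamma> (s', \<tau>) - y)
        + Im (e (s', \<tau>)) * mollifier_der False (r n) (\<Gamma> (s', \<tau>) - y)) *\<^sub>R f y) has_integral
      mollify (r n) f (\<Gamma> (t, \<tau>)) - mollify (r n) f (\<Gamma> (s, \<tau>))) {s..t}"
      by (rule mollify_FTC[OF r(1) f st(2)])
        (auto intro: has_vector_derivative_at_within \<Gamma> intro!: continuous_on_compose2[OF e] continuous_intros)
    then show ?thesis
      by (subst has_integral_cong[OF eq[symmetric]])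
  qed

  \<comment> \<open>The error in the mean along the curve with parameter \<tau>. Its integral over
    \<tau> tends to 0, so by Fatou its lower limit is 0 for almost every \<tau>. This yields
    arbitrarily good indices for each such \<tau>, though not the same ones for all.\<close>
  define v where "v n \<tau> = (\<integral>\<^sup>+t. ennreal (norm (pn n (t, \<tau>) - p (t, \<tau>))) * indicator S (t, \<tau>) \<partial>lborel)" for n \<tau>
  have vm [measurable]: "v n \<in> borel_measurable borel" for n
    unfolding v_def by measurable
  have v_le: "(\<integral>\<^sup>+\<tau>. v n \<tau> \<partial>lborel) \<le> ennreal B * (ennreal E * (ennreal (1 / real (Suc n)) + ennreal (1 / real (Suc n))))" for n
  proof -
    have "(\<integral>\<^sup>+\<tau>. v n \<tau> \<partial>lborel) = (\<integral>\<^sup>+x. ennreal (norm (pn n x - p x)) * indicator S x \<partial>lborel)"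
      unfolding v_def by (rule nn_integral_pair_lborel) measurable
    also have "\<dots> = (\<integral>\<^sup>+x. ennreal (norm (Re (e x) *\<^sub>R (mollify (r n) P (\<Gamma> x) - P (\<Gamma> x))
        + Im (e x) *\<^sub>R (mollify (r n) Q (\<Gamma> x) - Q (\<Gamma> x)))) * indicator S x \<partial>lborel)"
      by (simp add: pn_def p algebra_simps)
    also have "\<dots> \<le> ennreal B * (ennreal E * ((\<integral>\<^sup>+y. norm (mollify (r n) P y - P y) \<partial>lborel)
        + (\<integral>\<^sup>+y. norm (mollify (r n) Q y - Q y) \<partial>lborel)))"
      by (rule bound[of "\<lambda>y. mollify (r n) P y - P y" "\<lambda>y. mollify (r n) Q y - Q y"]) measurable
    also have "\<dots> \<le> ennreal B * (ennreal E * (ennreal (1 / real (Suc n)) + ennreal (1 / real (Suc n))))"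
      by (intro mult_left_mono add_mono r) auto
    finally show ?thesis .
  qed
  have "(\<integral>\<^sup>+\<tau>. liminf (\<lambda>n. v n \<tau>) \<partial>lborel) \<le> liminf (\<lambda>n. \<integral>\<^sup>+\<tau>. v n \<tau> \<partial>lborel)"
    by (rule nn_integral_liminf) simp
  \<comment> \<open>The real number \<open>B\<close> is arbitrary, and \<open>ennreal B\<close> is 0
    for negative \<open>B\<close>; hence \<open>max B 0\<close>.\<close>
  also have "\<dots> \<le> liminf (\<lambda>n. ennreal (max B 0 * (E * (2 / real (Suc n)))))"
  proof (intro Liminf_mono always_eventually allI)
    fix n
    have "ennreal B * (ennreal E * (ennreal (1 / real (Suc n)) + ennreal (1 / real (Suc n))))
        = ennreal (max B 0 * (E * (2 / real (Suc n))))"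
      using \<open>0 \<le> E\<close> by (cases "0 \<le> B") (simp_all add: ennreal_mult[symmetric] ennreal_plus[symmetric] ennreal_neg del: ennreal_plus of_nat_Suc)
    then show "(\<integral>\<^sup>+\<tau>. v n \<tau> \<partial>lborel) \<le> ennreal (max B 0 * (E * (2 / real (Suc n))))"
      using v_le[of n] by simp
  qed
  also have "\<dots> = 0"
  proof -
    have "(\<lambda>n. 2 / real (Suc n)) \<longlonglongrightarrow> 0"
      using tendsto_mult[OF tendsto_const[of 2] LIMSEQ_inverse_real_of_nat] by (simp add: divide_inverse)
    then have "(\<lambda>n. max B 0 * (E * (2 / real (Suc n)))) \<longlonglongrightarrow> max B 0 * (E * 0)"
      by (intro tendsto_mult tendsto_const)
    then have "(\<lambda>n. ennreal (max B 0 * (E * (2 / real (Suc n))))) \<longlonglongrightarrow> ennreal 0"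
      by (intro tendsto_ennrealI) simp
    then show ?thesis
      by (simp add: lim_imp_Liminf del: of_nat_Suc)
  qed
  finally have "(\<integral>\<^sup>+\<tau>. liminf (\<lambda>n. v n \<tau>) \<partial>lborel) = 0" by simp
  then have ae1: "AE \<tau> in lborel. liminf (\<lambda>n. v n \<tau>) = 0"
    by (subst (asm) nn_integral_0_iff_AE) auto
  have "(\<integral>\<^sup>+\<tau>. (\<integral>\<^sup>+t. ennreal (norm (p (t, \<tau>))) * indicator S (t, \<tau>) \<partial>lborel) \<partial>lborel) < \<infinity>"
    using pS by (subst nn_integral_pair_lborel) measurable
  then have ae2: "AE \<tau> in lborel. (\<integral>\<^sup>+t. ennreal (norm (p (t, \<tau>))) * indicator S (t, \<tau>) \<partial>lborel) \<noteq> \<infinity>"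
    by (intro nn_integral_PInf_AE) auto
  from ae1 ae2
  show "AE \<tau> in lborel. \<tau> \<in> {c..d} \<longrightarrow> set_integrable lborel {a..b} (\<lambda>t. p (t, \<tau>)) \<and>
     (\<forall>s t. a \<le> s \<longrightarrow> s \<le> t \<longrightarrow> t \<le> b \<longrightarrow>
        f (\<Gamma> (t, \<tau>)) - f (\<Gamma> (s, \<tau>)) = (LINT t:{s..t}|lborel. p (t, \<tau>)))"
  proof eventually_elim
    case (elim \<tau>)
    show ?case
    proof (intro impI conjI allI)
      assume \<tau>: "\<tau> \<in> {c..d}"
      have ind: "indicator S (t, \<tau>) = indicator {a..b} t" for t
        using \<tau> by (auto simp: S indicator_def)
      have pi: "set_integrable lborel {a..b} (\<lambda>t. p (t, \<tau>))"
        unfolding set_integrable_def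
        using elim(2) by (intro integrableI_bounded)
          (auto simp: ind top.not_eq_extremum ennreal_mult[symmetric] ennreal_indicator[symmetric] mult.commute simp del: ennreal_indicator)
      show "set_integrable lborel {a..b} (\<lambda>t. p (t, \<tau>))" by (rule pi)
      fix s t assume st: "a \<le> s" "s \<le> t" "t \<le> b"
      have pist: "set_integrable lborel {s..t} (\<lambda>t. p (t, \<tau>))"
        by (rule set_integrable_subset[OF pi]) (use st in auto)
      let ?L = "f (\<Gamma> (t, \<tau>)) - f (\<Gamma> (s, \<tau>))" and ?R = "LINT t:{s..t}|lborel. p (t, \<tau>)"
      have "norm (?L - ?R) \<le> \<delta>" if "0 < \<delta>" for \<delta>
      proof -
        \<comment> \<open>The two endpoint errors, each at most \<open>1 / Suc n\<close>, share one
          half of the tolerance, and the integral error \<open>v n \<tau>\<close> takes the other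
          half.\<close>
        obtain N where N: "2 / real (Suc N) \<le> \<delta> / 2"
          using reals_Archimedean[of "\<delta> / 4"] \<open>0 < \<delta>\<close> by (auto simp: field_simps intro: less_imp_le)
        obtain n where n: "N \<le> n" "v n \<tau> < ennreal (\<delta> / 2)"
          using liminf_eq_0_imp_frequently[OF elim(1), of "ennreal (\<delta> / 2)" N] \<open>0 < \<delta>\<close> by auto
        let ?M = "\<lambda>t. mollify (r n) f (\<Gamma> (t, \<tau>))"
        have d_le: "(\<integral>\<^sup>+t'. ennreal (norm (indicator {s..t} t' *\<^sub>R (pn n (t', \<tau>) - p (t', \<tau>)))) \<partial>lborel) \<le> v n \<tau>"
          unfolding v_def ind using st
          by (intro nn_integral_mono) (auto simp: indicator_def)
        have di: "set_integrable lborel {s..t} (\<lambda>t'. pn n (t', \<tau>) - p (t', \<tau>))"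
          unfolding set_integrable_def
        proof (rule integrableI_bounded)
          show "(\<integral>\<^sup>+t'. ennreal (norm (indicator {s..t} t' *\<^sub>R (pn n (t', \<tau>) - p (t', \<tau>)))) \<partial>lborel) < \<infinity>"
            unfolding infinity_ennreal_def by (rule le_less_trans[OF d_le less_trans[OF n(2) ennreal_less_top]])
        qed measurable
        have "set_integrable lborel {s..t} (\<lambda>t'. (pn n (t', \<tau>) - p (t', \<tau>)) + p (t', \<tau>))"
          by (intro set_integral_add di pist)
        then have pni: "set_integrable lborel {s..t} (\<lambda>t'. pn n (t', \<tau>))"
          by simp
        have "?M t - ?M s = (LINT t':{s..t}|lborel. pn n (t', \<tau>))"
          using set_borel_integral_eq_integral(2)[OF pni] integral_unique[OF pn_int[OF st \<tau>, of n]] by simp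
        then have eq: "?M t - ?M s - ?R = (LINT t':{s..t}|lborel. pn n (t', \<tau>) - p (t', \<tau>))"
          by (simp add: set_integral_diff[OF pni pist])
        have "ennreal (norm (?M t - ?M s - ?R)) \<le> v n \<tau>"
          unfolding eq unfolding set_lebesgue_integral_def
          using integral_norm_bound_ennreal[OF di[unfolded set_integrable_def]] d_le by (rule order_trans)
        from le_less_trans[OF this n(2)] have 1: "norm (?M t - ?M s - ?R) < \<delta> / 2"
          by (simp add: ennreal_less_iff)
        have 2: "norm (?M t - f (\<Gamma> (t, \<tau>))) \<le> 1 / real (Suc n)" "norm (?M s - f (\<Gamma> (s, \<tau>))) \<le> 1 / real (Suc n)"
          using r(5) st \<tau> by (auto simp: S)
        have "1 / real (Suc n) \<le> 1 / real (Suc N)"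
          using n(1) by (intro divide_left_mono) auto
        moreover have "2 * (1 / real (Suc N)) \<le> \<delta> / 2"
          using N by simp
        moreover have "norm (?L - ?R) \<le> norm (?M t - ?M s - ?R) + norm (?M t - f (\<Gamma> (t, \<tau>)))
            + norm (?M s - f (\<Gamma> (s, \<tau>)))"
        proof -
          have tri: "norm (u - v - w) \<le> norm (x - y - w) + norm (x - u) + norm (y - v)"
            for u v w x y :: complex
            using norm_triangle_ineq[of "(x - y - w) - (x - u)" "y - v"]
              norm_triangle_ineq4[of "x - y - w" "x - u"] by (simp add: algebra_simps)
          show ?thesis by (rule tri)
        qed
        ultimately show ?thesis
          using 1 2 by linarith
      qed
      then have "norm (?L - ?R) \<le> 0"
        using field_le_epsilon[of "norm (?L - ?R)" 0] by simp
      then show "?L = ?R" by simp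
    qed
  qed
qed

section \<open>Almost everywhere differentiability and the area inequality\<close>

text \<open>Egorov's theorem with \<open>A n k\<close> read as "accuracy k is reached from stage n
  on". The stage \<open>N j k\<close> is chosen to exclude measure less than 2^(-k)/(j+1). What is
  lost for a fixed j then has measure at most 2/(j+1), and what is lost for all j is null. On each
  remaining set the stage depends only on the accuracy.\<close>

lemma (in finite_measure) egorov_sets:
  fixes A :: "nat \<Rightarrow> nat \<Rightarrow> 'a set"
  assumes A [measurable]: "\<And>n k. A n k \<in> sets M"
    and mono: "\<And>m n k. m \<le> n \<Longrightarrow> A m k \<subseteq> A n k"
    and conv: "AE x in M. \<forall>k. \<exists>n. x \<in> A n k"
  obtains N :: "nat \<Rightarrow> nat \<Rightarrow> nat" where "AE x in M. \<exists>j. \<forall>k. x \<in> A (N j k) k"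
proof -
  have lim: "(\<lambda>n. measure M (space M - A n k)) \<longlonglongrightarrow> 0" for k
  proof -
    have "(\<lambda>n. measure M (space M - A n k)) \<longlonglongrightarrow> measure M (\<Inter>n. space M - A n k)"
      by (rule finite_Lim_measure_decseq) (use mono in \<open>auto simp: decseq_def\<close>)
    moreover have "measure M (\<Inter>n. space M - A n k) = 0"
    proof -
      have "AE x in M. x \<notin> (\<Inter>n. space M - A n k)"
        using conv by eventually_elim auto
      then have "(\<Inter>n. space M - A n k) \<in> null_sets M"
        by (subst AE_iff_null_sets) auto
      then show ?thesis by (simp add: measure_eq_0_null_sets)
    qed
    ultimately show ?thesis by simp
  qed
  have "\<exists>n. measure M (space M - A n k) < (1 / 2) ^ k / real (Suc j)" for j k
    using order_tendstoD(2)[OF lim[of k], of "(1 / 2) ^ k / real (Suc j)"]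
    by (auto simp: eventually_sequentially simp del: of_nat_Suc)
  note ex = this
  define N where "N j k = (SOME n. measure M (space M - A n k) < (1 / 2) ^ k / real (Suc j))" for j k
  have N: "measure M (space M - A (N j k) k) < (1 / 2) ^ k / real (Suc j)" for j k
    unfolding N_def by (rule someI_ex[OF ex])
  have small: "measure M (\<Union>k. space M - A (N j k) k) \<le> 2 / real (Suc j)" for j
  proof -
    have geo: "summable (\<lambda>k. (1 / 2) ^ k / real (Suc j))" "(\<Sum>k. (1 / 2) ^ k / real (Suc j)) = 2 / real (Suc j)"
      using sums_divide[OF geometric_sums[of "1 / 2 :: real"], of "real (Suc j)"]
      by (auto simp: sums_iff simp del: of_nat_Suc)
    have sm: "summable (\<lambda>k. measure M (space M - A (N j k) k))"
      by (rule summable_comparison_test'[OF geo(1), of 0]) (use N in \<open>auto intro: less_imp_le\<close>)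
    have "measure M (\<Union>k. space M - A (N j k) k) \<le> (\<Sum>k. measure M (space M - A (N j k) k))"
      by (rule finite_measure_subadditive_countably) (use sm in auto)
    also have "\<dots> \<le> (\<Sum>k. (1 / 2) ^ k / real (Suc j))"
      by (rule suminf_le[OF _ sm geo(1)]) (use N in \<open>auto intro: less_imp_le\<close>)
    finally show ?thesis using geo(2) by simp
  qed
  let ?B = "\<Inter>j. \<Union>k. space M - A (N j k) k"
  have "measure M ?B \<le> 0 + e" if "0 < e" for e
  proof -
    have "0 < e / 2" using that by simp
    then obtain j where "inverse (real (Suc j)) < e / 2"
      using reals_Archimedean by blast
    then have "2 * inverse (real (Suc j)) \<le> e" by linarith
    then have j: "2 / real (Suc j) \<le> e"
      by (simp only: divide_inverse)
    have "measure M ?B \<le> measure M (\<Union>k. space M - A (N j k) k)"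
      by (rule finite_measure_mono) auto
    with small[of j] j show ?thesis by simp
  qed
  then have "measure M ?B = 0"
    using field_le_epsilon[of "measure M ?B" 0] measure_nonneg[of M ?B] by (simp add: antisym)
  then have "?B \<in> null_sets M"
    by (auto simp: null_sets_def emeasure_eq_measure)
  then have "AE x in M. \<exists>j. \<forall>k. x \<in> A (N j k) k"
    by (rule AE_I') auto
  then show thesis by (rule that)
qed

lemma integral_right_limit_AE:
  fixes q :: "real \<Rightarrow> complex"
  assumes q: "integrable lborel q"
  shows "AE s in lborel. \<forall>\<epsilon>>0. \<exists>\<delta>>0. \<forall>h. 0 < h \<and> h < \<delta> \<longrightarrow> norm (integral {s..s+h} q - h *\<^sub>R q s) \<le> \<epsilon> * h"
proof -
  have "q integrable_on cbox a b" for a b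
    using integrable_on_lborel[OF q] integrable_on_subcbox by blast
  then obtain N where N: "negligible N"
    and lim: "\<And>x e. x \<notin> N \<Longrightarrow> 0 < e \<Longrightarrow> \<exists>d>0. \<forall>h. 0 < h \<and> h < d \<longrightarrow>
        norm (integral (cbox x (x + h *\<^sub>R One)) q /\<^sub>R h ^ DIM(real) - q x) < e"
    using integrable_ccontinuous_explicit[of q] by blast
  have "AE s in lebesgue. s \<notin> N"
    using N by (intro AE_not_in) (simp add: negligible_iff_null_sets)
  then have "AE s in lborel. s \<notin> N" by (simp add: AE_completion_iff)
  then show ?thesis
  proof eventually_elim
    case (elim s)
    show ?case
    proof (intro allI impI)
      fix \<epsilon> :: real assume "0 < \<epsilon>"
      then obtain d where "0 < d" and d: "\<And>h. 0 < h \<Longrightarrow> h < d \<Longrightarrow> norm (integral {s..s+h} q /\<^sub>R h - q s) < \<epsilon>"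
        using lim[OF elim \<open>0 < \<epsilon>\<close>] by auto
      have "norm (integral {s..s+h} q - h *\<^sub>R q s) \<le> \<epsilon> * h" if h: "0 < h" "h < d" for h
      proof -
        have "integral {s..s+h} q - h *\<^sub>R q s = h *\<^sub>R (integral {s..s+h} q /\<^sub>R h - q s)"
          using h by (simp add: scaleR_diff_right)
        then have "norm (integral {s..s+h} q - h *\<^sub>R q s) = h * norm (integral {s..s+h} q /\<^sub>R h - q s)"
          using h by simp
        also have "\<dots> \<le> h * \<epsilon>"
          using d[OF h] h by (intro mult_left_mono) auto
        finally show ?thesis by (simp add: mult.commute)
      qed
      then show "\<exists>\<delta>>0. \<forall>h. 0 < h \<and> h < \<delta> \<longrightarrow> norm (integral {s..s+h} q - h *\<^sub>R q s) \<le> \<epsilon> * h"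
        using \<open>0 < d\<close> by blast
    qed
  qed
qed

text \<open>The displacement is a curve \<open>v\<close> instead of a vector, so that one notion
  covers the real line and both coordinate directions of the plane. The difference quotient is
  multiplied out, which makes \<open>t = 0\<close> harmless.\<close>

abbreviation differentiable_along ::
    "('a::real_vector \<Rightarrow> complex) \<Rightarrow> (real \<Rightarrow> 'a) \<Rightarrow> complex \<Rightarrow> 'a \<Rightarrow> bool" where
  "differentiable_along g v D x \<equiv>
     \<forall>\<epsilon>>0. \<exists>\<delta>>0. \<forall>t. \<bar>t\<bar> < \<delta> \<longrightarrow> norm (g (x + v t) - g x - t *\<^sub>R D) \<le> \<epsilon> * \<bar>t\<bar>"

lemma indefinite_integral_derivative_AE:
  fixes p g :: "real \<Rightarrow> complex"
  assumes p: "set_integrable lborel {a..b} p"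
    and g: "\<And>s t. a \<le> s \<Longrightarrow> s \<le> t \<Longrightarrow> t \<le> b \<Longrightarrow> g t - g s = (LINT t:{s..t}|lborel. p t)"
  shows "AE s in lborel. s \<in> {a<..<b} \<longrightarrow>
    differentiable_along g (\<lambda>t. t) (p s) s"
proof -
  define q where "q s = indicator {a..b} s *\<^sub>R p s" for s
  have q: "integrable lborel q"
    using p by (simp add: q_def[abs_def] set_integrable_def)
  have q': "integrable lborel (\<lambda>s. q (- s))"
    using lborel_integrable_real_affine[OF q, of "- 1" 0] by simp
  have gq: "g t - g s = integral {s..t} q" if "a \<le> s" "s \<le> t" "t \<le> b" for s t
  proof -
    have "set_integrable lborel {s..t} p"
      by (rule set_integrable_subset[OF p]) (use that in auto)
    then have "(LINT t:{s..t}|lborel. p t) = integral {s..t} p"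
      by (rule set_borel_integral_eq_integral(2))
    also have "\<dots> = integral {s..t} q"
      by (rule integral_cong) (use that in \<open>auto simp: q_def\<close>)
    finally show ?thesis using g[OF that] by simp
  qed
  \<comment> \<open>The left derivative is the right derivative of the reflected integrand, and
    reflection preserves null sets.\<close>
  have left: "AE s in lborel. \<forall>\<epsilon>>0. \<exists>\<delta>>0. \<forall>h. 0 < h \<and> h < \<delta> \<longrightarrow> norm (integral {s-h..s} q - h *\<^sub>R q s) \<le> \<epsilon> * h"
  proof -
    have "AE s in distr lborel borel uminus. \<forall>\<epsilon>>0. \<exists>\<delta>>0. \<forall>h. 0 < h \<and> h < \<delta> \<longrightarrow>
        norm (integral {s..s+h} (\<lambda>s. q (- s)) - h *\<^sub>R q (- s)) \<le> \<epsilon> * h"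
      unfolding lborel_distr_uminus by (rule integral_right_limit_AE[OF q'])
    then have "AE s in lborel. \<forall>\<epsilon>>0. \<exists>\<delta>>0. \<forall>h. 0 < h \<and> h < \<delta> \<longrightarrow>
        norm (integral {-s..-s+h} (\<lambda>s. q (- s)) - h *\<^sub>R q (- (- s))) \<le> \<epsilon> * h"
      by (rule AE_distrD[rotated]) simp
    moreover have "integral {-s..-s+h} (\<lambda>s. q (- s)) = integral {s-h..s} q" for s h
      using Henstock_Kurzweil_Integration.integral_reflect_real[of s "s - h" q] by (simp add: add.commute)
    ultimately show ?thesis by simp
  qed
  from integral_right_limit_AE[OF q] left show ?thesis
  proof eventually_elim
    case (elim s)
    show ?case
    proof (intro impI allI)
      fix \<epsilon> :: real assume s: "s \<in> {a<..<b}" and "0 < \<epsilon>"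
      obtain d1 where "0 < d1" and d1: "\<And>h. 0 < h \<Longrightarrow> h < d1 \<Longrightarrow> norm (integral {s..s+h} q - h *\<^sub>R q s) \<le> \<epsilon> * h"
        using elim(1) \<open>0 < \<epsilon>\<close> by blast
      obtain d2 where "0 < d2" and d2: "\<And>h. 0 < h \<Longrightarrow> h < d2 \<Longrightarrow> norm (integral {s-h..s} q - h *\<^sub>R q s) \<le> \<epsilon> * h"
        using elim(2) \<open>0 < \<epsilon>\<close> by blast
      define d where "d = min (min d1 d2) (min (s - a) (b - s))"
      have "0 < d" using \<open>0 < d1\<close> \<open>0 < d2\<close> s by (auto simp: d_def)
      have qs: "q s = p s" using s by (simp add: q_def)
      have "norm (g (s + t) - g s - t *\<^sub>R p s) \<le> \<epsilon> * \<bar>t\<bar>" if t: "\<bar>t\<bar> < d" for t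
      proof -
        consider "t = 0" | "0 < t" | "t < 0" by linarith
        then show ?thesis
        proof cases
          case 2
          then have "t < d1" "s + t \<le> b" using t by (auto simp: d_def)
          then show ?thesis
            using d1[OF 2] gq[of s "s + t"] 2 s by (simp add: qs)
        next
          case 3
          then have t': "- t < d2" "a \<le> s + t" using t by (auto simp: d_def)
          have "norm (g (s + t) - g s - t *\<^sub>R p s) = norm (g s - g (s + t) - (- t) *\<^sub>R p s)"
            by (metis (no_types, opaque_lifting) add.commute diff_minus_eq_add minus_diff_eq norm_minus_cancel scaleR_minus_left uminus_add_conv_diff)
          then show ?thesis
            using d2[of "- t"] gq[of "s + t" s] 3 s t' by (simp add: qs)
        qed simp
      qed
      then show "\<exists>\<delta>>0. \<forall>t. \<bar>t\<bar> < \<delta> \<longrightarrow> norm (g (s + t) - g s - t *\<^sub>R p s) \<le> \<epsilon> * \<bar>t\<bar>"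
        using \<open>0 < d\<close> by blast
    qed
  qed
qed

text \<open>This replaces quantifiers over real increments by countable ones, so that sets defined
  by difference quotients are Borel.\<close>

lemma le_on_rationals_imp_le:
  fixes \<phi> \<psi> :: "real \<Rightarrow> real"
  assumes "continuous_on UNIV \<phi>" "continuous_on UNIV \<psi>"
    and le: "\<And>q::rat. \<bar>of_rat q\<bar> < d \<Longrightarrow> \<phi> (of_rat q) \<le> \<psi> (of_rat q)" and t: "\<bar>t\<bar> < d"
  shows "\<phi> t \<le> \<psi> t"
proof (rule ccontr)
  assume "\<not> \<phi> t \<le> \<psi> t"
  let ?U = "{t. \<psi> t < \<phi> t} \<inter> {-d<..<d}"
  have "open ?U"
    using assms(1,2) by (intro open_Int open_Collect_less) auto
  moreover have "t \<in> ?U"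
    using \<open>\<not> \<phi> t \<le> \<psi> t\<close> t by auto
  ultimately obtain e where "0 < e" and e: "ball t e \<subseteq> ?U"
    by (rule openE)
  obtain q :: rat where "t < of_rat q" "of_rat q < t + e"
    using of_rat_dense[of t "t + e"] \<open>0 < e\<close> by auto
  then have "of_rat q \<in> ball t e"
    by (auto simp: dist_real_def)
  then have "of_rat q \<in> ?U" using e by blast
  moreover from this have "\<bar>of_rat q\<bar> < d"
    by (auto simp: abs_less_iff simp del: abs_of_rat)
  ultimately show False
    using le[of q] by auto
qed

text \<open>
  Partial derivatives almost everywhere give a derivative within each of countably many sets that
  exhaust the domain: from \<open>x\<close> to \<open>y\<close> one moves along the first coordinate using uniformity at \<open>x\<close>
  and then along the second one using uniformity at \<open>y\<close>, so only continuity of the second partial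
  derivative on the set is needed.
\<close>

lemma partial_derivatives_AE_imp_derivative_within:
  fixes g p q :: "real \<times> real \<Rightarrow> complex"
  assumes g: "continuous_on UNIV g"
    and [measurable]: "p \<in> borel_measurable borel" "q \<in> borel_measurable borel"
    and U [measurable]: "U \<in> sets borel" and fin: "emeasure lborel U < \<infinity>"
    and D1: "AE x in lborel. x \<in> U \<longrightarrow> differentiable_along g (\<lambda>t. (t, 0)) (p x) x"
    and D2: "AE x in lborel. x \<in> U \<longrightarrow> differentiable_along g (\<lambda>t. (0, t)) (q x) x"
  obtains S :: "nat \<Rightarrow> (real \<times> real) set" where "\<And>j. S j \<in> sets borel" "\<And>j. S j \<subseteq> U"
    "AE x in lborel. x \<in> U \<longrightarrow> (\<exists>j. x \<in> S j)"
    "\<And>j x. x \<in> S j \<Longrightarrow> (g has_derivative (\<lambda>u. fst u *\<^sub>R p x + snd u *\<^sub>R q x)) (at x within S j)"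
proof -
  have [measurable]: "g \<in> borel_measurable borel"
    by (rule borel_measurable_continuous_onI[OF g])
  have "q \<in> borel_measurable lebesgue"
    by (simp add: measurable_completion)
  then have "q measurable_on UNIV"
    by (intro lebesgue_measurable_imp_measurable_on) auto
  \<comment> \<open>As in the proof of Lusin's theorem: continuous functions converge to
    \<open>q\<close> almost everywhere, and once the convergence is uniform on a piece,
    \<open>q\<close> is continuous there.\<close>
  then obtain Z qn where Z: "negligible Z" and qn: "\<And>n::nat. continuous_on UNIV (qn n)"
    and qlim: "\<And>x. x \<notin> Z \<Longrightarrow> (\<lambda>n. qn n x) \<longlonglongrightarrow> q x"
    unfolding measurable_on_def by auto
  have [measurable]: "qn n \<in> borel_measurable borel" for n
    by (rule borel_measurable_continuous_onI[OF qn])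
  have aeZ: "AE x in lborel. x \<notin> Z"
  proof -
    have "AE x in lebesgue. x \<notin> Z"
      using Z by (intro AE_not_in) (simp add: negligible_iff_null_sets)
    then show ?thesis by (simp add: AE_completion_iff)
  qed
  \<comment> \<open>Here \<open>n\<close> measures the scale and \<open>k\<close> the accuracy. All
    three conditions involve only countably many quantifiers, hence define Borel sets.\<close>
  define A where "A n k = {x \<in> U.
      (\<forall>t::rat. \<bar>of_rat t\<bar> < 1 / real (Suc n) \<longrightarrow>
        norm (g (x + (of_rat t, 0)) - g x - of_rat t *\<^sub>R p x) \<le> 1 / real (Suc k) * \<bar>of_rat t\<bar>) \<and>
      (\<forall>t::rat. \<bar>of_rat t\<bar> < 1 / real (Suc n) \<longrightarrow>
        norm (g (x + (0, of_rat t)) - g x - of_rat t *\<^sub>R q x) \<le> 1 / real (Suc k) * \<bar>of_rat t\<bar>) \<and>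
      (\<forall>m\<ge>n. norm (qn m x - q x) \<le> 1 / real (Suc k))}" for n k
  have A_borel [measurable]: "A n k \<in> sets borel" for n k
  proof -
    have "{x \<in> space borel. x \<in> U \<and>
      (\<forall>t::rat. \<bar>of_rat t\<bar> < 1 / real (Suc n) \<longrightarrow>
        norm (g (x + (of_rat t, 0)) - g x - of_rat t *\<^sub>R p x) \<le> 1 / real (Suc k) * \<bar>of_rat t\<bar>) \<and>
      (\<forall>t::rat. \<bar>of_rat t\<bar> < 1 / real (Suc n) \<longrightarrow>
        norm (g (x + (0, of_rat t)) - g x - of_rat t *\<^sub>R q x) \<le> 1 / real (Suc k) * \<bar>of_rat t\<bar>) \<and>
      (\<forall>m\<ge>n. norm (qn m x - q x) \<le> 1 / real (Suc k))} \<in> sets borel"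
      by measurable
    then show ?thesis by (simp add: A_def)
  qed
  have A1: "norm (g (x + (t, 0)) - g x - t *\<^sub>R p x) \<le> 1 / real (Suc k) * \<bar>t\<bar>"
    if "x \<in> A n k" "\<bar>t\<bar> < 1 / real (Suc n)" for x t n k
    using that(2)
    by (rule le_on_rationals_imp_le[where t=t and d="1 / real (Suc n)", rotated 3])
      (use that(1) in \<open>auto simp: A_def intro!: continuous_intros continuous_on_compose2[OF g]\<close>)
  have A2: "norm (g (x + (0, t)) - g x - t *\<^sub>R q x) \<le> 1 / real (Suc k) * \<bar>t\<bar>"
    if "x \<in> A n k" "\<bar>t\<bar> < 1 / real (Suc n)" for x t n k
    using that(2)
    by (rule le_on_rationals_imp_le[where t=t and d="1 / real (Suc n)", rotated 3])
      (use that(1) in \<open>auto simp: A_def intro!: continuous_intros continuous_on_compose2[OF g]\<close>)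
  interpret M: finite_measure "restrict_space lborel U"
    by (rule finite_measureI) (use fin in \<open>auto simp: emeasure_restrict_space space_restrict_space\<close>)
  have conv: "AE x in restrict_space lborel U. \<forall>k. \<exists>n. x \<in> A n k"
  proof (subst AE_restrict_space_iff)
    show "AE x in lborel. x \<in> U \<longrightarrow> (\<forall>k. \<exists>n. x \<in> A n k)"
      using D1 D2 aeZ
    proof eventually_elim
      case (elim x)
      show ?case
      proof (intro impI allI)
        fix k assume x: "x \<in> U"
        have pos: "0 < 1 / real (Suc k)" by simp
        obtain d1 where d1: "0 < d1" "\<And>t. \<bar>t\<bar> < d1 \<Longrightarrow> norm (g (x + (t, 0)) - g x - t *\<^sub>R p x) \<le> 1 / real (Suc k) * \<bar>t\<bar>"
          using elim(1) x pos by metis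
        obtain d2 where d2: "0 < d2" "\<And>t. \<bar>t\<bar> < d2 \<Longrightarrow> norm (g (x + (0, t)) - g x - t *\<^sub>R q x) \<le> 1 / real (Suc k) * \<bar>t\<bar>"
          using elim(2) x pos by metis
        obtain n0 where n0: "\<And>m. n0 \<le> m \<Longrightarrow> norm (qn m x - q x) < 1 / real (Suc k)"
          using LIMSEQ_D[OF qlim[OF elim(3)] pos] by blast
        obtain n1 where n1: "1 / real (Suc n1) < min d1 d2"
          using reals_Archimedean[of "min d1 d2"] d1(1) d2(1) by (auto simp: divide_inverse)
        define n where "n = max n0 n1"
        have "1 / real (Suc n) \<le> 1 / real (Suc n1)"
          by (intro divide_left_mono) (auto simp: n_def)
        then have "1 / real (Suc n) < d1" "1 / real (Suc n) < d2" "n0 \<le> n"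
          using n1 by (auto simp: n_def)
        then have "x \<in> A n k"
          unfolding A_def using x d1(2) d2(2) n0
          by (auto simp del: of_nat_Suc abs_of_rat intro: less_imp_le)
        then show "\<exists>n. x \<in> A n k" ..
      qed
    qed
  qed simp
  have mono: "A m k \<subseteq> A n k" if "m \<le> n" for m n k
  proof -
    have "1 / real (Suc n) \<le> 1 / real (Suc m)"
      using that by (intro divide_left_mono) auto
    then show ?thesis
      unfolding A_def using that by (auto simp del: of_nat_Suc intro: order_trans less_le_trans)
  qed
  have meas: "A n k \<in> sets (restrict_space lborel U)" for n k
    by (auto simp: sets_restrict_space_iff A_def[symmetric]) (auto simp: A_def)
  obtain N :: "nat \<Rightarrow> nat \<Rightarrow> nat" where N: "AE x in restrict_space lborel U. \<exists>j. \<forall>k. x \<in> A (N j k) k"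
    by (rule M.egorov_sets[OF meas mono conv])
  define S where "S j = (\<Inter>k. A (N j k) k)" for j :: nat
  show thesis
  proof
    show "S j \<in> sets borel" for j unfolding S_def by measurable
    show "S j \<subseteq> U" for j by (auto simp: S_def A_def)
    show "AE x in lborel. x \<in> U \<longrightarrow> (\<exists>j. x \<in> S j)"
      using N by (subst (asm) AE_restrict_space_iff) (auto simp: S_def)
    fix j x assume x: "x \<in> S j"
    show "(g has_derivative (\<lambda>u. fst u *\<^sub>R p x + snd u *\<^sub>R q x)) (at x within S j)"
      unfolding has_derivative_within_alt
    proof (intro conjI allI impI)
      show "bounded_linear (\<lambda>u. fst u *\<^sub>R p x + snd u *\<^sub>R q x)"
        by (intro bounded_linear_add bounded_linear_scaleR_const bounded_linear_fst bounded_linear_snd)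
      fix e :: real assume "0 < e"
      \<comment> \<open>Five errors are collected: one from the first partial derivative at
        \<open>x\<close>, one from the second at \<open>y\<close>, and three from comparing
        \<open>q y\<close> with \<open>q x\<close> through the continuous approximation.\<close>
      then have "0 < e / 5" by simp
      then obtain k where "inverse (real (Suc k)) < e / 5"
        using reals_Archimedean by blast
      then have "5 * inverse (real (Suc k)) \<le> e" by linarith
      then have k: "5 / real (Suc k) \<le> e"
        by (simp only: divide_inverse)
      define n where "n = N j k"
      define \<kappa> where "\<kappa> = 1 / real (Suc k)"
      have "0 < \<kappa>" "5 * \<kappa> \<le> e" using k by (auto simp: \<kappa>_def)
      obtain d where "0 < d" and d: "\<And>y. dist y x < d \<Longrightarrow> dist (qn n y) (qn n x) < \<kappa>"
        using qn[of n] \<open>0 < \<kappa>\<close> unfolding continuous_on_iff by (metis UNIV_I)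
      have "norm (g y - g x - (fst (y - x) *\<^sub>R p x + snd (y - x) *\<^sub>R q x)) \<le> e * norm (y - x)"
        if y: "y \<in> S j" and yx: "norm (y - x) < min d (1 / real (Suc n))" for y
      proof -
        define h1 h2 where "h1 = fst (y - x)" and "h2 = snd (y - x)"
        have h: "\<bar>h1\<bar> \<le> norm (y - x)" "\<bar>h2\<bar> \<le> norm (y - x)"
        proof -
          have eq: "y - x = (h1, h2)" by (simp add: h1_def h2_def prod_eq_iff)
          show "\<bar>h1\<bar> \<le> norm (y - x)" "\<bar>h2\<bar> \<le> norm (y - x)"
            using norm_fst_le[of h1 h2] norm_snd_le[of h2 h1] by (simp_all only: eq real_norm_def)
        qed
        have xA: "x \<in> A n k" and yA: "y \<in> A n k"
          using x y by (auto simp: S_def n_def)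
        have corner: "y + (0, - h2) = x + (h1, 0)"
          by (simp add: h1_def h2_def prod_eq_iff)
        have 1: "norm (g (x + (h1, 0)) - g x - h1 *\<^sub>R p x) \<le> \<kappa> * \<bar>h1\<bar>"
          unfolding \<kappa>_def by (rule A1[OF xA]) (use h yx in linarith)
        have "norm (g (y + (0, - h2)) - g y - (- h2) *\<^sub>R q y) \<le> \<kappa> * \<bar>- h2\<bar>"
          unfolding \<kappa>_def by (rule A2[OF yA]) (use h yx in linarith)
        then have 2: "norm (g (x + (h1, 0)) - g y + h2 *\<^sub>R q y) \<le> \<kappa> * \<bar>h2\<bar>"
          by (simp add: corner)
        have "norm (q y - q x) \<le> 3 * \<kappa>"
        proof -
          have "norm (qn n x - q x) \<le> \<kappa>" "norm (qn n y - q y) \<le> \<kappa>"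
            using xA yA by (auto simp: A_def \<kappa>_def)
          moreover have "norm (qn n y - qn n x) < \<kappa>"
            using d[of y] yx by (simp add: dist_norm)
          moreover have "norm (q y - q x) \<le> norm (qn n y - q y) + norm (qn n y - qn n x) + norm (qn n x - q x)"
            using norm_triangle_ineq[of "(qn n y - qn n x) - (qn n y - q y)" "qn n x - q x"]
              norm_triangle_ineq4[of "qn n y - qn n x" "qn n y - q y"] by (simp add: algebra_simps)
          ultimately show ?thesis by linarith
        qed
        then have 3: "norm (h2 *\<^sub>R (q y - q x)) \<le> \<bar>h2\<bar> * (3 * \<kappa>)"
          by (auto intro: mult_left_mono)
        have split: "g y - g x - (h1 *\<^sub>R p x + h2 *\<^sub>R q x)
            = (g (x + (h1, 0)) - g x - h1 *\<^sub>R p x) - (g (x + (h1, 0)) - g y + h2 *\<^sub>R q y) + h2 *\<^sub>R (q y - q x)"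
          by (simp add: algebra_simps)
        have "norm (g y - g x - (h1 *\<^sub>R p x + h2 *\<^sub>R q x)) \<le> \<kappa> * \<bar>h1\<bar> + \<kappa> * \<bar>h2\<bar> + \<bar>h2\<bar> * (3 * \<kappa>)"
          unfolding split by (intro norm_triangle_le norm_triangle_le_diff add_mono 1 2 3)
        also have "\<dots> \<le> \<kappa> * norm (y - x) + \<kappa> * norm (y - x) + norm (y - x) * (3 * \<kappa>)"
          using h \<open>0 < \<kappa>\<close> by (intro add_mono mult_left_mono mult_right_mono) auto
        also have "\<dots> = 5 * \<kappa> * norm (y - x)" by simp
        also have "\<dots> \<le> e * norm (y - x)"
          using \<open>5 * \<kappa> \<le> e\<close> by (rule mult_right_mono) simp
        finally show ?thesis by (simp add: h1_def h2_def)
      qed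
      moreover have "0 < min d (1 / real (Suc n))" using \<open>0 < d\<close> by simp
      ultimately show "\<exists>d>0. \<forall>y\<in>S j. norm (y - x) < d \<longrightarrow>
          norm (g y - g x - (fst (y - x) *\<^sub>R p x + snd (y - x) *\<^sub>R q x)) \<le> e * norm (y - x)"
        by blast
    qed
  qed
qed

text \<open>The pieces with a derivative cover \<open>U\<close> up to a null set. That set
  contributes nothing on the left, while its image, which may have positive measure, is discarded on
  the right; this is why only an inequality results.\<close>

lemma area_inequality:
  fixes g p q :: "real \<times> real \<Rightarrow> complex" and h :: "complex \<Rightarrow> real"
  assumes g: "continuous_on UNIV g"
    and [measurable]: "p \<in> borel_measurable borel" "q \<in> borel_measurable borel"
    and U: "U \<in> sets borel" "emeasure lborel U < \<infinity>"
    and D1: "AE x in lborel. x \<in> U \<longrightarrow> differentiable_along g (\<lambda>t. (t, 0)) (p x) x"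
    and D2: "AE x in lborel. x \<in> U \<longrightarrow> differentiable_along g (\<lambda>t. (0, t)) (q x) x"
    and inj: "inj_on g U"
    and h [measurable]: "h \<in> borel_measurable borel" and nonneg: "\<And>y. 0 \<le> h y"
  shows "(\<integral>\<^sup>+x. ennreal (\<bar>jac2 (p x) (q x)\<bar> * h (g x)) * indicator U x \<partial>lborel) \<le> (\<integral>\<^sup>+y. ennreal (h y) \<partial>lborel)"
proof -
  have [measurable]: "g \<in> borel_measurable borel"
    by (rule borel_measurable_continuous_onI[OF g])
  obtain S where S: "\<And>j. S j \<in> sets borel" "\<And>j::nat. S j \<subseteq> U"
    "AE x in lborel. x \<in> U \<longrightarrow> (\<exists>j. x \<in> S j)"
    "\<And>j x. x \<in> S j \<Longrightarrow> (g has_derivative (\<lambda>u. fst u *\<^sub>R p x + snd u *\<^sub>R q x)) (at x within S j)"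
    by (rule partial_derivatives_AE_imp_derivative_within[OF g assms(2,3) U D1 D2]) (rule that; assumption)
  \<comment> \<open>Disjoint pieces have disjoint images by injectivity, so the area formulas on the
    pieces can be summed.\<close>
  define T where "T = disjointed S"
  have TS: "T j \<subseteq> S j" for j by (simp add: T_def disjointed_subset)
  have T [measurable]: "T j \<in> sets borel" for j
    unfolding T_def by (rule sets.range_disjointed_sets'[of S borel, THEN subsetD]) (use S(1) in auto)
  have dT: "disjoint_family T" by (simp add: T_def disjoint_family_disjointed)
  have UT: "(\<Union>j. T j) = (\<Union>j. S j)" by (simp add: T_def UN_disjointed_eq)
  have [measurable]: "(\<lambda>x. ennreal (\<bar>jac2 (p x) (q x)\<bar> * h (g x))) \<in> borel_measurable borel"
    unfolding jac2_def by measurable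
  have formula: "g ` T j \<in> sets lebesgue"
    "(\<integral>\<^sup>+x. ennreal (\<bar>jac2 (p x) (q x)\<bar> * h (g x)) * indicator (T j) x \<partial>lborel)
      = (\<integral>\<^sup>+y. ennreal (h y) * indicator (g ` T j) y \<partial>lebesgue)" for j
  proof -
    have der: "(g has_derivative (\<lambda>u. fst u *\<^sub>R p x + snd u *\<^sub>R q x)) (at x within T j)" if "x \<in> T j" for x
      using S(4)[of x j] TS[of j] that by (meson has_derivative_subset subsetD)
    have "inj_on g (T j)"
      using inj TS[of j] S(2)[of j] by (meson inj_on_subset order_trans)
    then show "g ` T j \<in> sets lebesgue"
      "(\<integral>\<^sup>+x. ennreal (\<bar>jac2 (p x) (q x)\<bar> * h (g x)) * indicator (T j) x \<partial>lborel)
      = (\<integral>\<^sup>+y. ennreal (h y) * indicator (g ` T j) y \<partial>lebesgue)"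
      using area_formula[of "T j" g p q h] der nonneg by auto
  qed
  have dgT: "disjoint_family (\<lambda>j. g ` T j)"
    unfolding disjoint_family_on_def
  proof (intro ballI impI)
    fix i j :: nat assume "i \<noteq> j"
    then have "T i \<inter> T j = {}" using dT by (auto simp: disjoint_family_on_def)
    then show "g ` T i \<inter> g ` T j = {}"
      using inj TS S(2) inj_on_image_Int[of g U "T i" "T j"] by (metis image_empty order_trans)
  qed
  have hm: "h \<in> borel_measurable lebesgue" by (simp add: measurable_completion)
  have "(\<integral>\<^sup>+x. ennreal (\<bar>jac2 (p x) (q x)\<bar> * h (g x)) * indicator U x \<partial>lborel)
      = (\<integral>\<^sup>+x. (\<Sum>j. ennreal (\<bar>jac2 (p x) (q x)\<bar> * h (g x)) * indicator (T j) x) \<partial>lborel)"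
  proof (rule nn_integral_cong_AE)
    show "AE x in lborel. ennreal (\<bar>jac2 (p x) (q x)\<bar> * h (g x)) * indicator U x
        = (\<Sum>j. ennreal (\<bar>jac2 (p x) (q x)\<bar> * h (g x)) * indicator (T j) x)"
      using S(3)
    proof eventually_elim
      case (elim x)
      then have "x \<in> U \<longleftrightarrow> x \<in> (\<Union>j. T j)" using S(2) unfolding UT by blast
      then show ?case
        by (simp only: suminf_indicator[OF dT] ennreal_suminf_cmult) (simp add: indicator_def)
    qed
  qed
  also have "\<dots> = (\<Sum>j. \<integral>\<^sup>+x. ennreal (\<bar>jac2 (p x) (q x)\<bar> * h (g x)) * indicator (T j) x \<partial>lborel)"
    by (rule nn_integral_suminf) measurable
  also have "\<dots> = (\<Sum>j. \<integral>\<^sup>+y. ennreal (h y) * indicator (g ` T j) y \<partial>lebesgue)"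
    by (simp add: formula)
  also have "\<dots> = (\<integral>\<^sup>+y. (\<Sum>j. ennreal (h y) * indicator (g ` T j) y) \<partial>lebesgue)"
    using hm formula(1) by (intro nn_integral_suminf[symmetric]) auto
  also have "\<dots> \<le> (\<integral>\<^sup>+y. ennreal (h y) \<partial>lebesgue)"
    by (intro nn_integral_mono, simp only: suminf_indicator[OF dgT] ennreal_suminf_cmult)
      (simp add: indicator_def)
  also have "\<dots> = (\<integral>\<^sup>+y. ennreal (h y) \<partial>lborel)"
    by (rule nn_integral_completion)
  finally show ?thesis .
qed

section \<open>Logarithmic polar coordinates\<close>

text \<open>The first coordinate is the logarithm of the radius, the second the angle. This makes
  the map conformal and turns the density 1/r^2 into plain area.\<close>

definition log_polar :: "complex \<Rightarrow> real \<times> real \<Rightarrow> complex" where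
  "log_polar z x = z + exp (Complex (fst x) (snd x))"

lemma continuous_on_exp_Complex [continuous_intros]:
  "continuous_on S a \<Longrightarrow> continuous_on S b \<Longrightarrow> continuous_on S (\<lambda>x. exp (Complex (a x) (b x)))"
  unfolding Complex_eq by (intro continuous_intros)

lemma continuous_on_log_polar: "continuous_on S (log_polar z)"
  unfolding log_polar_def[abs_def] by (intro continuous_intros)

lemma norm_log_polar: "norm (log_polar z x - z) = exp (fst x)"
  by (simp add: log_polar_def norm_exp_eq_Re)

lemma log_polar_has_derivative:
  "(log_polar z has_derivative
     (\<lambda>u. fst u *\<^sub>R exp (Complex (fst x) (snd x)) + snd u *\<^sub>R (\<i> * exp (Complex (fst x) (snd x))))) (at x)"
proof -
  have 1: "((\<lambda>x. Complex (fst x) (snd x)) has_derivative (\<lambda>u. Complex (fst u) (snd u))) (at x)"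
    unfolding Complex_eq by (auto intro!: derivative_eq_intros)
  have "((\<lambda>x. exp (Complex (fst x) (snd x))) has_derivative
      (\<lambda>u. Complex (fst u) (snd u) * exp (Complex (fst x) (snd x)))) (at x)"
    using diff_chain_at[OF 1 DERIV_exp[unfolded has_field_derivative_def]] by (simp add: o_def mult.commute)
  moreover have "Complex a b * w = a *\<^sub>R w + b *\<^sub>R (\<i> * w)" for a b w
    by (simp add: complex_eq_iff)
  ultimately show ?thesis
    unfolding log_polar_def[abs_def] by (auto intro!: derivative_eq_intros)
qed

lemma log_polar_radial_derivative:
  "((\<lambda>t. log_polar z (t, \<theta>)) has_vector_derivative exp (Complex t \<theta>)) (at t)"
proof -
  have "((\<lambda>t. (t, \<theta>)) has_derivative (\<lambda>h. (h, 0))) (at t)"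
    by (auto intro!: derivative_eq_intros)
  from diff_chain_at[OF this log_polar_has_derivative] show ?thesis
    by (simp add: has_vector_derivative_def o_def)
qed

lemma log_polar_angular_derivative:
  "((\<lambda>\<theta>. log_polar z (t, \<theta>)) has_vector_derivative \<i> * exp (Complex t \<theta>)) (at \<theta>)"
proof -
  have "((\<lambda>\<theta>. (t, \<theta>)) has_derivative (\<lambda>h. (0, h))) (at \<theta>)"
    by (auto intro!: derivative_eq_intros)
  from diff_chain_at[OF this log_polar_has_derivative] show ?thesis
    by (simp add: has_vector_derivative_def o_def)
qed

lemma inj_on_log_polar: "inj_on (log_polar z) (UNIV \<times> {c..<c + 2 * pi})"
proof (rule inj_onI)
  fix x y assume xy: "x \<in> UNIV \<times> {c..<c + 2 * pi}" "y \<in> UNIV \<times> {c..<c + 2 * pi}"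
    and "log_polar z x = log_polar z y"
  then have "exp (Complex (fst x) (snd x)) = exp (Complex (fst y) (snd y))"
    by (simp add: log_polar_def)
  then obtain n :: int where n: "Complex (fst x) (snd x) = Complex (fst y) (snd y) + (of_int (2 * n) * pi) * \<i>"
    unfolding exp_eq by blast
  then have 1: "fst x = fst y" and 2: "snd x = snd y + 2 * of_int n * pi"
    by (auto simp: complex_eq_iff)
  have "\<bar>snd x - snd y\<bar> < 2 * pi" using xy by auto
  then have "\<bar>of_int n\<bar> * (2 * pi) < 1 * (2 * pi)"
    using 2 by (simp add: abs_mult)
  then have "\<bar>of_int n :: real\<bar> < 1"
    by (rule mult_right_less_imp_less) simp
  then have "n = 0" by linarith
  with 1 2 show "x = y" by (simp add: prod_eq_iff)
qed

lemma log_polar_surj: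
  assumes "y \<noteq> z"
  obtains \<theta> where "c \<le> \<theta>" "\<theta> < c + 2 * pi" "y = log_polar z (ln (norm (y - z)), \<theta>)"
proof -
  \<comment> \<open>\<open>Arg2pi\<close> takes values in [0, 2 pi), so a rotation by
    \<open>- c\<close> produces an angle in the interval that starts at \<open>c\<close>.\<close>
  define v where "v = (y - z) * exp (\<i> * of_real (- c))"
  have "norm v = norm (y - z)"
    by (simp add: v_def norm_mult)
  then have v: "v = of_real (norm (y - z)) * exp (\<i> * of_real (Arg2pi v))"
    "0 \<le> Arg2pi v" "Arg2pi v < 2 * pi"
    using Arg2pi[of v] by (auto simp: is_Arg_def)
  have "y - z = v * exp (\<i> * of_real c)"
    by (simp add: v_def mult.assoc exp_add[symmetric])
  also have "\<dots> = of_real (norm (y - z)) * exp (\<i> * of_real (c + Arg2pi v))"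
    by (subst v(1)) (simp add: mult.assoc exp_add[symmetric] distrib_left add.commute)
  also have "\<dots> = exp (Complex (ln (norm (y - z))) (c + Arg2pi v))"
    using assms by (simp add: Complex_eq exp_add exp_of_real)
  finally have "y = log_polar z (ln (norm (y - z)), c + Arg2pi v)"
    by (simp add: log_polar_def algebra_simps)
  then show thesis
    using that[of "c + Arg2pi v"] v(2,3) by simp
qed

lemma jac2_exp: "jac2 (exp (Complex s t)) (\<i> * exp (Complex s t)) = exp (2 * s)"
proof -
  have "jac2 (exp (Complex s t)) (\<i> * exp (Complex s t)) = (norm (exp (Complex s t)))\<^sup>2"
    unfolding jac2_def cmod_power2 by (simp add: power2_eq_square)
  then show ?thesis
    by (simp add: norm_exp_eq_Re exp_double)
qed

lemma borel_measurable_fst_snd [measurable]: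
  "fst \<in> borel_measurable (borel :: (real \<times> real) measure)"
  "snd \<in> borel_measurable (borel :: (real \<times> real) measure)"
  by (auto intro!: borel_measurable_continuous_onI continuous_intros)

lemma borel_measurable_exp_Complex [measurable]:
  "(\<lambda>x. exp (Complex (fst x) (snd x))) \<in> borel_measurable borel"
  by (intro borel_measurable_continuous_onI continuous_intros)

lemma borel_measurable_log_polar [measurable]: "log_polar z \<in> borel_measurable borel"
  by (intro borel_measurable_continuous_onI continuous_on_log_polar)

lemma log_polar_change_of_variables:
  fixes h :: "complex \<Rightarrow> real"
  assumes S: "S \<in> sets borel" "S \<subseteq> UNIV \<times> {c..<c + 2 * pi}"
    and h: "h \<in> borel_measurable borel" "\<And>y. 0 \<le> h y"
  shows "log_polar z ` S \<in> sets lebesgue"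
    and "(\<integral>\<^sup>+x. ennreal (exp (2 * fst x) * h (log_polar z x)) * indicator S x \<partial>lborel)
       = (\<integral>\<^sup>+y. ennreal (h y) * indicator (log_polar z ` S) y \<partial>lebesgue)"
proof -
  have i: "inj_on (log_polar z) S"
    using inj_on_log_polar S(2) by (rule inj_on_subset)
  have m: "(\<lambda>x. \<i> * exp (Complex (fst x) (snd x))) \<in> borel_measurable borel"
    by measurable
  note area = area_formula[OF S(1) has_derivative_at_withinI[OF log_polar_has_derivative] i h(1)
      borel_measurable_exp_Complex m h(2)]
  show "log_polar z ` S \<in> sets lebesgue"
    by (rule area(1))
  show "(\<integral>\<^sup>+x. ennreal (exp (2 * fst x) * h (log_polar z x)) * indicator S x \<partial>lborel)
       = (\<integral>\<^sup>+y. ennreal (h y) * indicator (log_polar z ` S) y \<partial>lebesgue)"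
    using area(2) by (simp add: jac2_exp)
qed

text \<open>The Jacobian \<open>exp (2 * fst x)\<close> is at least \<open>exp (2 * a)\<close> on
  \<open>S\<close>.\<close>

lemma nn_integral_log_polar_le:
  fixes h :: "complex \<Rightarrow> real"
  assumes S: "S \<in> sets borel" "S \<subseteq> {a..} \<times> {c..<c + 2 * pi}"
    and h [measurable]: "h \<in> borel_measurable borel" and nonneg: "\<And>y. 0 \<le> h y"
  shows "(\<integral>\<^sup>+x. ennreal (h (log_polar z x)) * indicator S x \<partial>lborel)
     \<le> ennreal (exp (- 2 * a)) * (\<integral>\<^sup>+y. ennreal (h y) \<partial>lborel)"
proof -
  note [measurable] = S(1)
  have sub: "S \<subseteq> UNIV \<times> {c..<c + 2 * pi}" using S(2) by auto
  have "(\<integral>\<^sup>+x. ennreal (h (log_polar z x)) * indicator S x \<partial>lborel)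
    \<le> (\<integral>\<^sup>+x. ennreal (exp (- 2 * a)) * (ennreal (exp (2 * fst x) * h (log_polar z x)) * indicator S x) \<partial>lborel)"
  proof (rule nn_integral_mono)
    fix x
    show "ennreal (h (log_polar z x)) * indicator S x
      \<le> ennreal (exp (- 2 * a)) * (ennreal (exp (2 * fst x) * h (log_polar z x)) * indicator S x)"
    proof (cases "x \<in> S")
      case True
      then have "1 \<le> exp (- 2 * a) * exp (2 * fst x)"
        using S(2) by (auto simp: exp_add[symmetric])
      then have "1 * h (log_polar z x) \<le> (exp (- 2 * a) * exp (2 * fst x)) * h (log_polar z x)"
        by (intro mult_right_mono nonneg)
      then show ?thesis
        using True nonneg by (simp add: ennreal_mult[symmetric] mult.assoc)
    qed simp
  qed
  also have "\<dots> = ennreal (exp (- 2 * a)) * (\<integral>\<^sup>+x. ennreal (exp (2 * fst x) * h (log_polar z x)) * indicator S x \<partial>lborel)"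
    by (rule nn_integral_cmult) measurable
  also have "\<dots> = ennreal (exp (- 2 * a)) * (\<integral>\<^sup>+y. ennreal (h y) * indicator (log_polar z ` S) y \<partial>lebesgue)"
    by (simp only: log_polar_change_of_variables[OF S(1) sub h nonneg])
  also have "\<dots> \<le> ennreal (exp (- 2 * a)) * (\<integral>\<^sup>+y. ennreal (h y) \<partial>lebesgue)"
    by (intro mult_left_mono nn_integral_mono) (auto simp: indicator_def)
  also have "\<dots> = ennreal (exp (- 2 * a)) * (\<integral>\<^sup>+y. ennreal (h y) \<partial>lborel)"
    by (simp add: nn_integral_completion)
  finally show ?thesis .
qed

text \<open>A closed rectangle of full angular width covers one ray twice. Two half-open rectangles,
  shifted by pi against each other, cover it and are each mapped injectively; this is the factor
  2.\<close>

lemma nn_integral_log_polar_le_closed: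
  fixes h :: "complex \<Rightarrow> real"
  assumes d: "d \<le> c + 2 * pi"
    and h [measurable]: "h \<in> borel_measurable borel" and nonneg: "\<And>y. 0 \<le> h y"
  shows "(\<integral>\<^sup>+x. ennreal (h (log_polar z x)) * indicator ({a..b} \<times> {c..d}) x \<partial>lborel)
     \<le> ennreal (2 * exp (- 2 * a)) * (\<integral>\<^sup>+y. ennreal (h y) \<partial>lborel)"
proof -
  let ?A = "{a..b} \<times> {c..<c + 2 * pi}" and ?B = "{a..b} \<times> {c + pi..<c + pi + 2 * pi}"
  have mA: "?A \<in> sets borel" and mB: "?B \<in> sets borel"
    by (auto intro!: borel_Times)
  note [measurable] = mA mB
  have "(\<integral>\<^sup>+x. ennreal (h (log_polar z x)) * indicator ({a..b} \<times> {c..d}) x \<partial>lborel)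
     \<le> (\<integral>\<^sup>+x. ennreal (h (log_polar z x)) * indicator ?A x + ennreal (h (log_polar z x)) * indicator ?B x \<partial>lborel)"
  proof (rule nn_integral_mono)
    fix x
    have "x \<in> {a..b} \<times> {c..d} \<Longrightarrow> x \<in> ?A \<or> x \<in> ?B"
    proof -
      assume x: "x \<in> {a..b} \<times> {c..d}"
      have "snd x \<le> c + 2 * pi" using x d by auto
      then have "snd x < c + pi + 2 * pi" using pi_gt_zero by linarith
      moreover have "c + pi \<le> snd x \<or> snd x < c + 2 * pi" using pi_gt_zero by linarith
      ultimately show ?thesis using x by auto
    qed
    then show "ennreal (h (log_polar z x)) * indicator ({a..b} \<times> {c..d}) x
        \<le> ennreal (h (log_polar z x)) * indicator ?A x + ennreal (h (log_polar z x)) * indicator ?B x"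
      by (auto simp: indicator_def)
  qed
  also have "\<dots> = (\<integral>\<^sup>+x. ennreal (h (log_polar z x)) * indicator ?A x \<partial>lborel)
      + (\<integral>\<^sup>+x. ennreal (h (log_polar z x)) * indicator ?B x \<partial>lborel)"
    by (rule nn_integral_add) measurable
  also have "\<dots> \<le> ennreal (exp (- 2 * a)) * (\<integral>\<^sup>+y. ennreal (h y) \<partial>lborel)
      + ennreal (exp (- 2 * a)) * (\<integral>\<^sup>+y. ennreal (h y) \<partial>lborel)"
    by (intro add_mono nn_integral_log_polar_le[OF mA] nn_integral_log_polar_le[OF mB] h nonneg) auto
  also have "\<dots> = ennreal (2 * exp (- 2 * a)) * (\<integral>\<^sup>+y. ennreal (h y) \<partial>lborel)"
    by (simp add: distrib_right[symmetric] ennreal_plus[symmetric] del: ennreal_plus)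
  finally show ?thesis .
qed

text \<open>The weight whose integral realises the modulus of the annulus \<open>\<delta> < norm (y - y0) < R\<close>.\<close>

definition ring_weight :: "complex \<Rightarrow> real \<Rightarrow> real \<Rightarrow> complex \<Rightarrow> real" where
  "ring_weight y0 \<delta> R y = indicator (cball y0 R) y / (max (norm (y - y0)) \<delta>)\<^sup>2"

lemma ring_weight_nonneg: "0 \<le> ring_weight y0 \<delta> R y"
  by (simp add: ring_weight_def)

lemma borel_measurable_ring_weight [measurable]: "ring_weight y0 \<delta> R \<in> borel_measurable borel"
  unfolding ring_weight_def[abs_def]
  by (intro borel_measurable_divide borel_measurable_indicator borel_measurable_power borel_measurable_max) auto

text \<open>The core of radius \<delta> has area pi \<delta>^2 and weight 1/\<delta>^2, which gives
  pi. On the ring the weight times the Jacobian of logarithmic polar coordinates is at most 1, which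
  leaves the area of a rectangle with sides ln (R/\<delta>) and 2 pi.\<close>

lemma nn_integral_ring_weight:
  assumes "0 < \<delta>" "\<delta> \<le> R"
  shows "(\<integral>\<^sup>+y. ennreal (ring_weight y0 \<delta> R y) \<partial>lborel) \<le> ennreal (pi + 2 * pi * ln (R / \<delta>))"
proof -
  define S where "S = {ln \<delta>..ln R} \<times> {0..<0 + 2 * pi}"
  have S [measurable]: "S \<in> sets borel" and sub: "S \<subseteq> UNIV \<times> {0..<0 + 2 * pi}"
    by (auto simp: S_def intro!: borel_Times)
  have "ln \<delta> \<le> ln R" using assms by simp
  have img: "log_polar y0 ` S \<in> sets lebesgue"
    by (rule log_polar_change_of_variables(1)[OF S sub borel_measurable_ring_weight ring_weight_nonneg])
  have w: "ring_weight y0 \<delta> R y \<le> indicator (cball y0 \<delta>) y / \<delta>\<^sup>2 + ring_weight y0 \<delta> R y * indicator (log_polar y0 ` S) y" for y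
  proof (cases "y \<in> cball y0 \<delta>")
    case True
    then have "ring_weight y0 \<delta> R y \<le> indicator (cball y0 \<delta>) y / \<delta>\<^sup>2"
      using assms by (simp add: ring_weight_def dist_norm norm_minus_commute max_def indicator_def)
    then show ?thesis
      using ring_weight_nonneg[of y0 \<delta> R y] by (simp add: add_increasing2)
  next
    case False
    show ?thesis
    proof (cases "y \<in> cball y0 R")
      case True
      have n: "\<delta> < norm (y - y0)" "norm (y - y0) \<le> R"
        using True False by (auto simp: dist_norm norm_minus_commute)
      then have "y \<noteq> y0" using assms by auto
      then obtain \<theta> where "0 \<le> \<theta>" "\<theta> < 0 + 2 * pi" "y = log_polar y0 (ln (norm (y - y0)), \<theta>)"
        by (rule log_polar_surj)
      moreover have "ln (norm (y - y0)) \<in> {ln \<delta>..ln R}"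
      proof -
        have "0 < norm (y - y0)" "0 < R" using n assms by linarith+
        then show ?thesis using n assms by simp
      qed
      ultimately have "y \<in> log_polar y0 ` S"
        unfolding S_def by (intro image_eqI[of _ _ "(ln (norm (y - y0)), \<theta>)"]) auto
      then show ?thesis by simp
    qed (auto simp: ring_weight_def)
  qed
  have meas: "(\<lambda>y. ennreal (ring_weight y0 \<delta> R y) * indicator (log_polar y0 ` S) y) \<in> borel_measurable lebesgue"
    using img by (intro borel_measurable_times_ennreal borel_measurable_indicator measurable_completion) auto
  have "(\<integral>\<^sup>+y. ennreal (ring_weight y0 \<delta> R y) \<partial>lborel) = (\<integral>\<^sup>+y. ennreal (ring_weight y0 \<delta> R y) \<partial>lebesgue)"
    by (simp add: nn_integral_completion)
  also have "\<dots> \<le> (\<integral>\<^sup>+y. ennreal (1 / \<delta>\<^sup>2) * indicator (cball y0 \<delta>) y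
        + ennreal (ring_weight y0 \<delta> R y) * indicator (log_polar y0 ` S) y \<partial>lebesgue)"
  proof (rule nn_integral_mono)
    fix y
    show "ennreal (ring_weight y0 \<delta> R y) \<le> ennreal (1 / \<delta>\<^sup>2) * indicator (cball y0 \<delta>) y
        + ennreal (ring_weight y0 \<delta> R y) * indicator (log_polar y0 ` S) y"
      using ennreal_leI[OF w[of y]] ring_weight_nonneg[of y0 \<delta> R y]
      by (auto simp: ennreal_plus ennreal_mult indicator_def split: if_splits)
  qed
  also have "\<dots> = (\<integral>\<^sup>+y. ennreal (1 / \<delta>\<^sup>2) * indicator (cball y0 \<delta>) y \<partial>lebesgue)
      + (\<integral>\<^sup>+y. ennreal (ring_weight y0 \<delta> R y) * indicator (log_polar y0 ` S) y \<partial>lebesgue)"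
    by (intro nn_integral_add meas borel_measurable_times_ennreal borel_measurable_indicator borel_measurable_const) auto
  also have "(\<integral>\<^sup>+y. ennreal (1 / \<delta>\<^sup>2) * indicator (cball y0 \<delta>) y \<partial>lebesgue) = ennreal pi"
    using assms emeasure_cball[of \<delta> y0]
    by (subst nn_integral_cmult_indicator) (auto simp: unit_ball_vol_2 ennreal_mult[symmetric])
  also have "(\<integral>\<^sup>+y. ennreal (ring_weight y0 \<delta> R y) * indicator (log_polar y0 ` S) y \<partial>lebesgue)
     = (\<integral>\<^sup>+x. ennreal (exp (2 * fst x) * ring_weight y0 \<delta> R (log_polar y0 x)) * indicator S x \<partial>lborel)"
    by (rule log_polar_change_of_variables(2)[OF S sub borel_measurable_ring_weight ring_weight_nonneg, symmetric])
  also have "\<dots> \<le> (\<integral>\<^sup>+x. indicator S x \<partial>lborel)"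
  proof (rule nn_integral_mono)
    fix x
    show "ennreal (exp (2 * fst x) * ring_weight y0 \<delta> R (log_polar y0 x)) * indicator S x \<le> indicator S x"
    proof (cases "x \<in> S")
      case True
      have "exp (2 * fst x) * ring_weight y0 \<delta> R (log_polar y0 x) \<le> 1"
      proof -
        have "(exp (fst x))\<^sup>2 \<le> (max (exp (fst x)) \<delta>)\<^sup>2"
          by (intro power_mono) auto
        moreover have "0 < (max (exp (fst x)) \<delta>)\<^sup>2"
          using assms by (simp add: max_def)
        ultimately show ?thesis
          by (simp add: ring_weight_def norm_log_polar exp_double indicator_def)
      qed
      then show ?thesis using True by (simp add: ennreal_le_1)
    qed simp
  qed
  also have "\<dots> = ennreal (2 * pi * ln (R / \<delta>))"
  proof -
    have "emeasure lborel S = emeasure lborel {ln \<delta>..ln R} * emeasure lborel {0..<0 + 2 * pi}"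
      unfolding S_def lborel_prod[symmetric] by (rule lborel.emeasure_pair_measure_Times) auto
    also have "\<dots> = ennreal (2 * pi * ln (R / \<delta>))"
      using \<open>ln \<delta> \<le> ln R\<close> assms by (simp add: ennreal_mult[symmetric] ln_div mult.commute)
    finally show ?thesis by simp
  qed
  finally show ?thesis
    using \<open>ln \<delta> \<le> ln R\<close> assms by (simp add: ennreal_plus ln_div)
qed

section \<open>Increments of a truncated logarithm along curves\<close>

lemma abs_ln_diff_le:
  fixes x y m :: real
  assumes "0 < m" "m \<le> x" "m \<le> y"
  shows "\<bar>ln x - ln y\<bar> \<le> \<bar>x - y\<bar> / m"
proof -
  have *: "ln x - ln y \<le> \<bar>x - y\<bar> / m" if "m \<le> x" "m \<le> y" for x y :: real
  proof -
    have "ln x - ln y \<le> (x - y) / y"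
      using that \<open>0 < m\<close> by (intro ln_diff_le) auto
    also have "\<dots> \<le> \<bar>x - y\<bar> / m"
      using that \<open>0 < m\<close> by (intro frac_le) auto
    finally show ?thesis .
  qed
  show ?thesis
    using *[of x y] *[of y x] assms by (auto simp: abs_le_iff abs_minus_commute)
qed

text \<open>In a short interval about any point the positive continuous function \<open>w\<close>
  varies only between \<open>1 - \<tau>\<close> and \<open>1 + \<tau>\<close> times its value there.
  The increment of the logarithm is then bounded by the desired integral up to the factor
  (1+\<tau>)/(1-\<tau>). Both sides behave well under concatenation of intervals, so Bolzano's
  bisection principle extends the bound to the whole interval, and \<tau> tends to 0.\<close>

lemma log_increment_le:
  fixes \<gamma> p :: "real \<Rightarrow> complex"
  assumes \<gamma>: "continuous_on UNIV \<gamma>" and p: "set_integrable lborel {a..b} p"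
    and inc: "\<And>s t. a \<le> s \<Longrightarrow> s \<le> t \<Longrightarrow> t \<le> b \<Longrightarrow> \<gamma> t - \<gamma> s = (LINT u:{s..t}|lborel. p u)"
    and "0 < \<delta>" and w: "\<And>u. w u = max (norm (\<gamma> u - y0)) \<delta>"
    and st: "a \<le> s" "s \<le> t" "t \<le> b"
  shows "ennreal \<bar>ln (w t) - ln (w s)\<bar> \<le> (\<integral>\<^sup>+u. ennreal (norm (p u) / w u) * indicator {s..t} u \<partial>lborel)"
proof -
  have contw: "continuous_on UNIV w"
    unfolding w[abs_def] by (intro continuous_intros \<gamma>)
  then have wm: "w \<in> borel_measurable borel"
    by (rule borel_measurable_continuous_onI)
  have w\<delta>: "\<delta> \<le> w u" and wpos: "0 < w u" for u
    using \<open>0 < \<delta>\<close> by (auto simp: w)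
  have np: "set_integrable lborel {a..b} (\<lambda>u. norm (p u))"
    by (rule set_integrable_norm[OF p])
  have pw: "set_integrable lborel {a..b} (\<lambda>u. norm (p u) / w u)"
    unfolding set_integrable_def
  proof (rule Bochner_Integration.integrable_bound)
    show "integrable lborel (\<lambda>u. (1 / \<delta>) * (indicator {a..b} u *\<^sub>R norm (p u)))"
      using np unfolding set_integrable_def by (rule integrable_mult_right)
    have "(\<lambda>u. (indicator {a..b} u *\<^sub>R norm (p u)) / w u) \<in> borel_measurable lborel"
      using np wm unfolding set_integrable_def by measurable
    then show "(\<lambda>u. indicator {a..b} u *\<^sub>R (norm (p u) / w u)) \<in> borel_measurable lborel"
      by simp
    have "norm (p u) / w u \<le> norm (p u) / \<delta>" for u
      using w\<delta>[of u] wpos[of u] \<open>0 < \<delta>\<close> by (intro divide_left_mono mult_pos_pos) auto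
    then show "AE u in lborel. norm (indicator {a..b} u *\<^sub>R (norm (p u) / w u))
        \<le> norm ((1 / \<delta>) * (indicator {a..b} u *\<^sub>R norm (p u)))"
      using \<open>0 < \<delta>\<close> wpos by (auto simp: indicator_def abs_mult less_imp_le)
  qed
  have hk: "p integrable_on {u..v}" "(\<lambda>x. norm (p x)) integrable_on {u..v}"
      "(\<lambda>x. norm (p x) / w x) integrable_on {u..v}"
    if "a \<le> u" "v \<le> b" for u v
    using set_borel_integral_eq_integral(1)[OF set_integrable_subset[OF p]]
      set_borel_integral_eq_integral(1)[OF set_integrable_subset[OF np]]
      set_borel_integral_eq_integral(1)[OF set_integrable_subset[OF pw]] that by auto
  have incw: "\<bar>w v - w u\<bar> \<le> integral {u..v} (\<lambda>x. norm (p x))" if "a \<le> u" "u \<le> v" "v \<le> b" for u v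
  proof -
    have "\<bar>w v - w u\<bar> \<le> \<bar>norm (\<gamma> v - y0) - norm (\<gamma> u - y0)\<bar>"
      by (auto simp: w max_def)
    also have "\<dots> \<le> norm (\<gamma> v - \<gamma> u)"
      using norm_triangle_ineq3[of "\<gamma> v - y0" "\<gamma> u - y0"] by simp
    also have "\<gamma> v - \<gamma> u = integral {u..v} p"
      using inc[OF that] set_borel_integral_eq_integral(2)[OF set_integrable_subset[OF p]] that by simp
    also have "norm \<dots> \<le> integral {u..v} (\<lambda>x. norm (p x))"
      by (rule integral_norm_bound_integral) (use hk that in auto)
    finally show ?thesis .
  qed
  define F where "F u v = integral {u..v} (\<lambda>x. norm (p x) / w x)" for u v
  have main: "\<bar>ln (w t) - ln (w s)\<bar> \<le> (1 + \<tau>) / (1 - \<tau>) * F s t" if \<tau>: "0 < \<tau>" "\<tau> < 1" for \<tau>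
  proof -
    have "a \<le> s \<longrightarrow> s \<le> t \<longrightarrow> t \<le> b \<longrightarrow> \<bar>ln (w t) - ln (w s)\<bar> \<le> (1 + \<tau>) / (1 - \<tau>) * F s t"
      using st(2)
    proof (induction rule: Bolzano)
      case (trans u v x)
      show ?case
      proof (intro impI)
        assume *: "a \<le> u" "u \<le> x" "x \<le> b"
        have "F u v + F v x = F u x"
          unfolding F_def using trans * hk by (intro Henstock_Kurzweil_Integration.integral_combine) auto
        moreover have "\<bar>ln (w v) - ln (w u)\<bar> \<le> (1 + \<tau>) / (1 - \<tau>) * F u v"
          "\<bar>ln (w x) - ln (w v)\<bar> \<le> (1 + \<tau>) / (1 - \<tau>) * F v x"
          using trans * by auto
        ultimately have "\<bar>ln (w x) - ln (w u)\<bar> \<le> (1 + \<tau>) / (1 - \<tau>) * F u v + (1 + \<tau>) / (1 - \<tau>) * F v x"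
          by linarith
        also have "\<dots> = (1 + \<tau>) / (1 - \<tau>) * F u x"
          using \<open>F u v + F v x = F u x\<close> by (metis distrib_left)
        finally show "\<bar>ln (w x) - ln (w u)\<bar> \<le> (1 + \<tau>) / (1 - \<tau>) * F u x" .
      qed
    next
      case (local x)
      have "0 < \<tau> * w x" using \<tau> wpos by simp
      then obtain d where "0 < d" and d: "\<And>y. \<bar>y - x\<bar> < d \<Longrightarrow> \<bar>w y - w x\<bar> < \<tau> * w x"
        using contw unfolding continuous_on_iff dist_real_def by (metis UNIV_I)
      have "\<bar>ln (w v) - ln (w u)\<bar> \<le> (1 + \<tau>) / (1 - \<tau>) * F u v"
        if uv: "u \<le> x" "x \<le> v" "v - u < d" "a \<le> u" "v \<le> b" for u v
      proof -
        have near: "(1 - \<tau>) * w x \<le> w y" "w y \<le> (1 + \<tau>) * w x" if "y \<in> {u..v}" for y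
        proof -
          have "\<bar>y - x\<bar> < d" using that uv by auto
          from d[OF this] show "(1 - \<tau>) * w x \<le> w y" "w y \<le> (1 + \<tau>) * w x"
            by (auto simp: algebra_simps abs_less_iff)
        qed
        have pos: "0 < (1 - \<tau>) * w x" "0 < (1 + \<tau>) * w x" using \<tau> wpos[of x] by auto
        have "\<bar>ln (w v) - ln (w u)\<bar> \<le> \<bar>w v - w u\<bar> / ((1 - \<tau>) * w x)"
          using near[of u] near[of v] uv pos by (intro abs_ln_diff_le) auto
        also have "\<dots> \<le> integral {u..v} (\<lambda>y. norm (p y)) / ((1 - \<tau>) * w x)"
          using incw[of u v] uv pos by (intro divide_right_mono) auto
        also have "\<dots> \<le> integral {u..v} (\<lambda>y. ((1 + \<tau>) * w x) * (norm (p y) / w y)) / ((1 - \<tau>) * w x)"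
        proof (intro divide_right_mono integral_le)
          fix y assume y: "y \<in> {u..v}"
          have "norm (p y) = w y * (norm (p y) / w y)" using wpos[of y] by simp
          also have "\<dots> \<le> ((1 + \<tau>) * w x) * (norm (p y) / w y)"
            using near(2)[OF y] wpos[of y] by (intro mult_right_mono) auto
          finally show "norm (p y) \<le> ((1 + \<tau>) * w x) * (norm (p y) / w y)" .
        next
          show "(\<lambda>y. ((1 + \<tau>) * w x) * (norm (p y) / w y)) integrable_on {u..v}"
            using integrable_cmul[OF hk(3)[of u v], of "(1 + \<tau>) * w x"] uv by simp
        qed (use hk uv pos in auto)
        also have "\<dots> = ((1 + \<tau>) * w x) * F u v / ((1 - \<tau>) * w x)"
          unfolding F_def by (simp only: integral_mult_right)
        also have "\<dots> = (1 + \<tau>) / (1 - \<tau>) * F u v"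
        proof -
          have "((1 + \<tau>) * w x) * F u v / ((1 - \<tau>) * w x) = ((1 + \<tau>) * F u v) * w x / ((1 - \<tau>) * w x)"
            by (simp only: mult.commute mult.left_commute)
          also have "\<dots> = ((1 + \<tau>) * F u v) / (1 - \<tau>)"
            using wpos[of x] by (intro mult_divide_mult_cancel_right) simp
          finally show ?thesis by simp
        qed
        finally show ?thesis .
      qed
      then show ?case
        using \<open>0 < d\<close> by blast
    qed
    then show ?thesis using st by blast
  qed
  have "\<bar>ln (w t) - ln (w s)\<bar> \<le> F s t"
  proof (rule tendsto_lowerbound)
    have "((\<lambda>\<tau>. (1 + \<tau>) / (1 - \<tau>) * F s t) \<longlongrightarrow> (1 + 0) / (1 - 0) * F s t) (at_right 0)"
      by (intro tendsto_intros) auto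
    then show "((\<lambda>\<tau>. (1 + \<tau>) / (1 - \<tau>) * F s t) \<longlongrightarrow> F s t) (at_right 0)"
      by simp
    show "\<forall>\<^sub>F \<tau> in at_right 0. \<bar>ln (w t) - ln (w s)\<bar> \<le> (1 + \<tau>) / (1 - \<tau>) * F s t"
      using main by (auto simp: eventually_at_right_field intro!: exI[of _ 1])
  qed simp
  moreover have "ennreal (F s t) = (\<integral>\<^sup>+u. ennreal (norm (p u) / w u) * indicator {s..t} u \<partial>lborel)"
  proof -
    have pst: "set_integrable lborel {s..t} (\<lambda>u. norm (p u) / w u)"
      by (rule set_integrable_subset[OF pw]) (use st in auto)
    have "F s t = (LINT u|lborel. indicator {s..t} u *\<^sub>R (norm (p u) / w u))"
      using set_borel_integral_eq_integral(2)[OF pst] by (simp add: F_def set_lebesgue_integral_def)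
    also have "ennreal \<dots> = (\<integral>\<^sup>+u. ennreal (indicator {s..t} u *\<^sub>R (norm (p u) / w u)) \<partial>lborel)"
      using pst wpos unfolding set_integrable_def
      by (intro nn_integral_eq_integral[symmetric]) (auto simp: less_imp_le)
    also have "\<dots> = (\<integral>\<^sup>+u. ennreal (norm (p u) / w u) * indicator {s..t} u \<partial>lborel)"
      by (intro nn_integral_cong) (auto simp: indicator_def)
    finally show ?thesis .
  qed
  ultimately show ?thesis by (metis ennreal_leI)
qed

text \<open>Fubini passes from "almost everywhere on almost every line" to "almost everywhere in the
  plane" only for measurable sets. Rational increments give the measurability.\<close>

lemma sets_directional_derivative:
  fixes g p :: "real \<times> real \<Rightarrow> complex"
  assumes g: "continuous_on UNIV g" and [measurable]: "p \<in> borel_measurable borel"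
  shows "{x. differentiable_along g (\<lambda>t. t *\<^sub>R v) (p x) x} \<in> sets borel"
    (is "?D \<in> _")
proof -
  have [measurable]: "g \<in> borel_measurable borel"
    by (rule borel_measurable_continuous_onI[OF g])
  have [measurable]: "(\<lambda>x. x + t *\<^sub>R v) \<in> borel_measurable borel" for t
    by (intro borel_measurable_continuous_onI continuous_intros)
  let ?D' = "{x \<in> space borel. \<forall>k::nat. \<exists>n::nat. \<forall>t::rat. \<bar>of_rat t\<bar> < 1 / real (Suc n) \<longrightarrow>
      norm (g (x + of_rat t *\<^sub>R v) - g x - of_rat t *\<^sub>R p x) \<le> 1 / real (Suc k) * \<bar>of_rat t\<bar>}"
  have "?D' \<in> sets borel" by measurable
  also have "?D' = ?D"
  proof (intro set_eqI iffI)
    fix x assume x: "x \<in> ?D"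
    have "\<exists>n::nat. \<forall>t::rat. \<bar>of_rat t\<bar> < 1 / real (Suc n) \<longrightarrow>
      norm (g (x + of_rat t *\<^sub>R v) - g x - of_rat t *\<^sub>R p x) \<le> 1 / real (Suc k) * \<bar>of_rat t\<bar>" for k :: nat
    proof -
      have "0 < 1 / real (Suc k)" by simp
      then obtain d where "0 < d" and d: "\<And>t. \<bar>t\<bar> < d \<Longrightarrow> norm (g (x + t *\<^sub>R v) - g x - t *\<^sub>R p x) \<le> 1 / real (Suc k) * \<bar>t\<bar>"
        using x by blast
      obtain n where "inverse (real (Suc n)) < d"
        using reals_Archimedean[OF \<open>0 < d\<close>] by blast
      then have "1 / real (Suc n) < d" by (simp only: inverse_eq_divide)
      then show ?thesis using d by (meson less_trans)
    qed
    then show "x \<in> ?D'" by simp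
  next
    fix x assume x: "x \<in> ?D'"
    have "\<exists>\<delta>>0. \<forall>t. \<bar>t\<bar> < \<delta> \<longrightarrow> norm (g (x + t *\<^sub>R v) - g x - t *\<^sub>R p x) \<le> \<epsilon> * \<bar>t\<bar>" if "0 < \<epsilon>" for \<epsilon>
    proof -
      obtain k where "inverse (real (Suc k)) < \<epsilon>"
        using reals_Archimedean[OF \<open>0 < \<epsilon>\<close>] by blast
      then have k: "1 / real (Suc k) \<le> \<epsilon>" by (simp only: inverse_eq_divide less_imp_le)
      obtain n where n: "\<And>t::rat. \<bar>of_rat t\<bar> < 1 / real (Suc n) \<Longrightarrow>
          norm (g (x + of_rat t *\<^sub>R v) - g x - of_rat t *\<^sub>R p x) \<le> 1 / real (Suc k) * \<bar>of_rat t\<bar>"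
        using x by blast
      have "norm (g (x + t *\<^sub>R v) - g x - t *\<^sub>R p x) \<le> \<epsilon> * \<bar>t\<bar>" if t: "\<bar>t\<bar> < 1 / real (Suc n)" for t
      proof -
        have "norm (g (x + t *\<^sub>R v) - g x - t *\<^sub>R p x) \<le> 1 / real (Suc k) * \<bar>t\<bar>"
          using t by (rule le_on_rationals_imp_le[where t=t and d="1 / real (Suc n)", rotated 3])
            (use n in \<open>auto intro!: continuous_intros continuous_on_compose2[OF g]\<close>)
        also have "\<dots> \<le> \<epsilon> * \<bar>t\<bar>" using k by (rule mult_right_mono) simp
        finally show ?thesis .
      qed
      moreover have "0 < 1 / real (Suc n)" by simp
      ultimately show ?thesis by blast
    qed
    then show "x \<in> ?D" by simp
  qed
  finally show ?thesis .
qed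

lemma nn_integral_lborel_swap:
  fixes F :: "real \<times> real \<Rightarrow> ennreal"
  assumes [measurable]: "F \<in> borel_measurable borel"
  shows "(\<integral>\<^sup>+x. F (snd x, fst x) \<partial>lborel) = (\<integral>\<^sup>+x. F x \<partial>lborel)"
proof -
  have "(\<lambda>x::real \<times> real. (snd x, fst x)) \<in> borel_measurable borel"
    by (intro borel_measurable_continuous_onI continuous_intros)
  then have "(\<lambda>x. F (snd x, fst x)) \<in> borel_measurable borel"
    by (rule measurable_compose) (rule assms)
  from nn_integral_pair_lborel(2)[OF this] nn_integral_pair_lborel(1)[OF assms]
  show ?thesis by simp
qed

lemma AE_lborel_pair_iff:
  fixes P :: "real \<times> real \<Rightarrow> bool"
  assumes "{x. P x} \<in> sets borel"
  shows "(AE x in lborel. P x) \<longleftrightarrow> (AE s in lborel. AE t in lborel. P (s, t))"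
    and "(AE x in lborel. P x) \<longleftrightarrow> (AE t in lborel. AE s in lborel. P (s, t))"
proof -
  have m: "{x \<in> space (lborel \<Otimes>\<^sub>M lborel). P (fst x, snd x)} \<in> sets (lborel \<Otimes>\<^sub>M lborel)"
    unfolding lborel_prod using assms by simp
  show 1: "(AE x in lborel. P x) \<longleftrightarrow> (AE s in lborel. AE t in lborel. P (s, t))"
    using lborel_pair.AE_pair_iff[OF m] unfolding lborel_prod by simp
  show "(AE x in lborel. P x) \<longleftrightarrow> (AE t in lborel. AE s in lborel. P (s, t))"
    unfolding 1 using lborel_pair.AE_commute[OF m] .
qed

lemma jac2_rotate:
  "jac2 (a *\<^sub>R P + b *\<^sub>R Q) ((- b) *\<^sub>R P + a *\<^sub>R Q) = (a\<^sup>2 + b\<^sup>2) * jac2 P Q"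
  by (simp add: jac2_def algebra_simps power2_eq_square)

lemma jacobian_eq_jac2: "jacobian A = jac2 (blinfun_apply A 1) (blinfun_apply A \<i>)"
  by (simp add: jacobian_def jac2_def)

text \<open>Provides room of fixed size around the curves for the supports of the
  mollifiers.\<close>

lemma nonempty_compact_subset_open_thickening:
  fixes T \<Omega> :: "complex set"
  assumes T: "compact T" "T \<noteq> {}" and \<Omega>: "open \<Omega>" "T \<subseteq> \<Omega>"
  obtains r C where "0 < r" "compact C" "C \<subseteq> \<Omega>" "\<And>x. x \<in> T \<Longrightarrow> cball x r \<subseteq> C"
proof -
  have "closed (- \<Omega>)" "T \<inter> - \<Omega> = {}" using \<Omega> by auto
  from separate_compact_closed[OF T(1) this]
  obtain d where "0 < d" and d: "\<And>x y. x \<in> T \<Longrightarrow> y \<in> - \<Omega> \<Longrightarrow> d \<le> dist x y"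
    by blast
  define C where "C = {y. infdist y T \<le> d / 2}"
  have "compact C"
    unfolding C_def using T \<open>0 < d\<close> by (intro compact_infdist_le) auto
  moreover have "C \<subseteq> \<Omega>"
  proof
    fix y assume "y \<in> C"
    obtain x where "x \<in> T" "infdist y T = dist y x"
      using infdist_attains_inf[of T y] T compact_imp_closed by blast
    then have "dist x y < d"
      using \<open>y \<in> C\<close> \<open>0 < d\<close> by (simp add: C_def dist_commute)
    then show "y \<in> \<Omega>"
      using d[OF \<open>x \<in> T\<close>, of y] by force
  qed
  moreover have "cball x (d / 2) \<subseteq> C" if "x \<in> T" for x
  proof
    fix y assume "y \<in> cball x (d / 2)"
    then show "y \<in> C"
      using infdist_le[OF that, of y] by (simp add: C_def dist_commute)
  qed
  ultimately show thesis
    using that[of "d / 2" C] \<open>0 < d\<close> by simp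
qed

text \<open>
  In logarithmic polar coordinates the weak derivative of \<open>f\<close> becomes a pair of partial derivatives
  \<open>p\<close> (radial) and \<open>q\<close> (angular); the change of coordinates is conformal, so it preserves the distortion.
\<close>

lemma log_polar_partial_derivatives:
  fixes f :: "complex \<Rightarrow> complex" and K :: "complex \<Rightarrow> real"
  assumes W: "W1q_loc 1 \<Omega> f Df" and \<Omega>: "open \<Omega>" and f: "continuous_on UNIV f" "inj f"
    and ab: "a < b" and cd: "c < d" "d \<le> c + 2 * pi"
    and img: "log_polar z ` ({a..b} \<times> {c..d}) \<subseteq> \<Omega>"
    and dist: "AE y in lborel. y \<in> \<Omega> \<longrightarrow> (norm (Df y))\<^sup>2 \<le> K y * jacobian (Df y)"
    and K: "\<And>y. 1 \<le> K y"
  obtains p q :: "real \<times> real \<Rightarrow> complex" where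
    "p \<in> borel_measurable borel" "q \<in> borel_measurable borel"
    "AE \<theta> in lborel. \<theta> \<in> {c..d} \<longrightarrow> has_L1_derivative (\<lambda>s. f (log_polar z (s, \<theta>))) (\<lambda>s. p (s, \<theta>)) a b"
    "AE s in lborel. s \<in> {a..b} \<longrightarrow> has_L1_derivative (\<lambda>\<theta>. f (log_polar z (s, \<theta>))) (\<lambda>\<theta>. q (s, \<theta>)) c d"
    "AE x in lborel. x \<in> {a..b} \<times> {c..d} \<longrightarrow>
       (norm (p x))\<^sup>2 \<le> K (log_polar z x) * \<bar>jac2 (p x) (q x)\<bar> \<and>
       (norm (q x))\<^sup>2 \<le> K (log_polar z x) * \<bar>jac2 (p x) (q x)\<bar>"
    "\<forall>h\<in>borel_measurable borel. (\<forall>y. 0 \<le> h y) \<longrightarrow>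
       (\<integral>\<^sup>+x. ennreal (\<bar>jac2 (p x) (q x)\<bar> * h (f (log_polar z x))) * indicator ({a<..<b} \<times> {c<..<d}) x \<partial>lborel)
         \<le> (\<integral>\<^sup>+y. ennreal (h y) \<partial>lborel)"
proof -
  let ?S = "{a..b} \<times> {c..d}"
  let ?E = "\<lambda>x::real \<times> real. exp (Complex (fst x) (snd x))"
  have "compact (log_polar z ` ?S)"
    by (intro compact_continuous_image continuous_on_log_polar compact_Times) auto
  moreover have "log_polar z ` ?S \<noteq> {}" using ab cd by auto
  ultimately obtain r0 C where r0: "0 < r0" and C: "compact C" "C \<subseteq> \<Omega>"
      and sub: "\<And>x. x \<in> log_polar z ` ?S \<Longrightarrow> cball x r0 \<subseteq> C"
    using nonempty_compact_subset_open_thickening[OF _ _ \<Omega> img] by metis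
  have Lq: "Lq_loc 1 \<Omega> (\<lambda>z. blinfun_apply (Df z) e)" for e
    using W by (simp add: W1q_loc_def)
  obtain P where P: "integrable lborel P" "AE y in lborel. y \<in> C \<longrightarrow> blinfun_apply (Df y) 1 = P y"
    by (rule Lq_loc_borel_representative[OF Lq \<Omega> C])
  obtain Q where Q: "integrable lborel Q" "AE y in lborel. y \<in> C \<longrightarrow> blinfun_apply (Df y) \<i> = Q y"
    by (rule Lq_loc_borel_representative[OF Lq \<Omega> C])
  have [measurable]: "P \<in> borel_measurable borel" "Q \<in> borel_measurable borel"
    using P Q by auto
  \<comment> \<open>The chain rule: the weak derivative, represented by \<open>P\<close> and
    \<open>Q\<close>, is applied to the columns \<open>exp\<close> and \<open>\<i> * exp\<close> of
    the derivative of \<open>log_polar\<close>.\<close>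
  define p where "p x = Re (?E x) *\<^sub>R P (log_polar z x) + Im (?E x) *\<^sub>R Q (log_polar z x)" for x
  define q where "q x = Re (\<i> * ?E x) *\<^sub>R P (log_polar z x) + Im (\<i> * ?E x) *\<^sub>R Q (log_polar z x)" for x
  have pm [measurable]: "p \<in> borel_measurable borel" unfolding p_def[abs_def] by measurable
  have qm [measurable]: "q \<in> borel_measurable borel" unfolding q_def[abs_def] by measurable
  let ?B = "2 * exp (- 2 * a)"
  have cov: "(\<integral>\<^sup>+x. ennreal (h (log_polar z x)) * indicator ?S x \<partial>lborel) \<le> ennreal ?B * (\<integral>\<^sup>+y. ennreal (h y) \<partial>lborel)"
    if "h \<in> borel_measurable borel" "\<And>y. 0 \<le> h y" for h
    by (rule nn_integral_log_polar_le_closed[OF cd(2) that])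

  have radial: "AE \<theta> in lborel. \<theta> \<in> {c..d} \<longrightarrow> has_L1_derivative (\<lambda>s. f (log_polar z (s, \<theta>))) (\<lambda>s. p (s, \<theta>)) a b"
  proof (rule weakly_differentiable_ACL(1)[where \<Gamma>="log_polar z" and e="?E" and p=p and S="?S",
        OF W \<Omega> f(1) _ continuous_on_log_polar _ refl C(2) r0 _ cov P Q])
    show "continuous_on UNIV ?E" by (intro continuous_intros)
  qed (use sub p_def in \<open>auto simp: log_polar_radial_derivative\<close>)

  have angular: "AE s in lborel. s \<in> {a..b} \<longrightarrow> has_L1_derivative (\<lambda>\<theta>. f (log_polar z (s, \<theta>))) (\<lambda>\<theta>. q (s, \<theta>)) c d"
  proof -
    \<comment> \<open>The curve parameter has to be the first coordinate, so the two coordinates are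
      interchanged.\<close>
    let ?G = "\<lambda>x::real \<times> real. log_polar z (snd x, fst x)"
    let ?e = "\<lambda>x::real \<times> real. \<i> * exp (Complex (snd x) (fst x))"
    have cov': "(\<integral>\<^sup>+x. ennreal (h (?G x)) * indicator ({c..d} \<times> {a..b}) x \<partial>lborel)
        \<le> ennreal ?B * (\<integral>\<^sup>+y. ennreal (h y) \<partial>lborel)"
      if h: "h \<in> borel_measurable borel" "\<And>y. 0 \<le> h y" for h
    proof -
      have [measurable]: "?S \<in> sets borel" by (auto intro!: borel_Times)
      note [measurable] = h(1)
      have "(\<integral>\<^sup>+x. ennreal (h (log_polar z (snd x, fst x))) * indicator ?S (snd x, fst x) \<partial>lborel)
        = (\<integral>\<^sup>+x. ennreal (h (log_polar z x)) * indicator ?S x \<partial>lborel)"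
        by (rule nn_integral_lborel_swap) measurable
      also have "\<dots> \<le> ennreal ?B * (\<integral>\<^sup>+y. ennreal (h y) \<partial>lborel)"
        by (rule cov[OF h])
      also have "(\<lambda>x::real \<times> real. indicator ?S (snd x, fst x) :: ennreal) = indicator ({c..d} \<times> {a..b})"
        by (auto simp: fun_eq_iff indicator_def)
      then have "(\<integral>\<^sup>+x. ennreal (h (log_polar z (snd x, fst x))) * indicator ?S (snd x, fst x) \<partial>lborel)
        = (\<integral>\<^sup>+x. ennreal (h (?G x)) * indicator ({c..d} \<times> {a..b}) x \<partial>lborel)"
        by (metis (no_types, lifting))
      ultimately show ?thesis by simp
    qed
    have "AE s in lborel. s \<in> {a..b} \<longrightarrow> set_integrable lborel {c..d} (\<lambda>\<theta>. q (snd (\<theta>, s), fst (\<theta>, s))) \<and>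
       (\<forall>\<theta> \<eta>. c \<le> \<theta> \<longrightarrow> \<theta> \<le> \<eta> \<longrightarrow> \<eta> \<le> d \<longrightarrow>
          f (?G (\<eta>, s)) - f (?G (\<theta>, s)) = (LINT u:{\<theta>..\<eta>}|lborel. q (snd (u, s), fst (u, s))))"
    proof (rule weakly_differentiable_ACL(1)[where \<Gamma>="?G" and e="?e" and p="\<lambda>x. q (snd x, fst x)" and S="{c..d} \<times> {a..b}",
        OF W \<Omega> f(1) _ _ _ refl C(2) r0 _ cov' P Q])
      show "continuous_on UNIV ?e" by (intro continuous_intros)
      show "continuous_on UNIV ?G"
        by (intro continuous_on_compose2[OF continuous_on_log_polar[of UNIV]] continuous_intros) auto
      show "cball (?G x) r0 \<subseteq> C" if "x \<in> {c..d} \<times> {a..b}" for x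
        by (rule sub) (use that in auto)
    qed (use q_def in \<open>auto simp: log_polar_angular_derivative\<close>)
    then show ?thesis by simp
  qed

  have distortion: "AE x in lborel. x \<in> ?S \<longrightarrow>
       (norm (p x))\<^sup>2 \<le> K (log_polar z x) * \<bar>jac2 (p x) (q x)\<bar> \<and>
       (norm (q x))\<^sup>2 \<le> K (log_polar z x) * \<bar>jac2 (p x) (q x)\<bar>"
  proof -
    have "AE y in lborel. y \<in> C \<longrightarrow> blinfun_apply (Df y) 1 = P y \<and> blinfun_apply (Df y) \<i> = Q y
        \<and> (norm (Df y))\<^sup>2 \<le> K y * jacobian (Df y)"
      using P(2) Q(2) dist by eventually_elim (use C(2) in auto)
    then obtain N where N: "N \<in> sets lborel" "emeasure lborel N = 0"
      and bad: "{y \<in> space lborel. \<not> (y \<in> C \<longrightarrow> blinfun_apply (Df y) 1 = P y \<and> blinfun_apply (Df y) \<i> = Q y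
        \<and> (norm (Df y))\<^sup>2 \<le> K y * jacobian (Df y))} \<subseteq> N"
      by (rule AE_E) blast
    have good: "\<And>y. y \<notin> N \<Longrightarrow> y \<in> C \<Longrightarrow> blinfun_apply (Df y) 1 = P y \<and> blinfun_apply (Df y) \<i> = Q y
        \<and> (norm (Df y))\<^sup>2 \<le> K y * jacobian (Df y)"
      using bad by auto
    have [measurable]: "N \<in> sets borel" "?S \<in> sets borel" using N by (auto intro!: borel_Times)
    \<comment> \<open>Testing \<open>cov\<close> with the indicator of \<open>N\<close> shows that
      the part of the rectangle mapped into this null set is itself null.\<close>
    have "(\<integral>\<^sup>+x. ennreal (indicator N (log_polar z x)) * indicator ?S x \<partial>lborel)
        \<le> ennreal ?B * (\<integral>\<^sup>+y. ennreal (indicator N y) \<partial>lborel)"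
      by (rule cov) auto
    also have "\<dots> = 0" using N by (simp add: ennreal_indicator)
    finally have "AE x in lborel. ennreal (indicator N (log_polar z x)) * indicator ?S x = 0"
      by (subst (asm) le_zero_eq, subst (asm) nn_integral_0_iff_AE) measurable
    then show ?thesis
    proof eventually_elim
      case (elim x)
      show ?case
      proof
        assume x: "x \<in> ?S"
        let ?y = "log_polar z x"
        have "?y \<notin> N" using elim x by (auto simp: indicator_def split: if_splits)
        moreover have "?y \<in> C" using sub[of ?y] x r0 by (auto simp: subset_iff)
        ultimately have y: "blinfun_apply (Df ?y) 1 = P ?y" "blinfun_apply (Df ?y) \<i> = Q ?y"
          "(norm (Df ?y))\<^sup>2 \<le> K ?y * jacobian (Df ?y)"
          using good by auto
        have pD: "p x = blinfun_apply (Df ?y) (?E x)" "q x = blinfun_apply (Df ?y) (\<i> * ?E x)"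
          unfolding p_def q_def by (subst blinfun_apply_complex, simp add: y)+
        have "jac2 (p x) (q x) = ((Re (?E x))\<^sup>2 + (Im (?E x))\<^sup>2) * jac2 (P ?y) (Q ?y)"
          unfolding p_def q_def using jac2_rotate[of "Re (?E x)" "P ?y" "Im (?E x)" "Q ?y"] by simp
        then have jac: "jac2 (p x) (q x) = (norm (?E x))\<^sup>2 * jacobian (Df ?y)"
          by (simp only: cmod_power2 jacobian_eq_jac2 y)
        have bd: "(norm (blinfun_apply (Df ?y) e))\<^sup>2 \<le> K ?y * \<bar>jac2 (p x) (q x)\<bar>" if "norm e = norm (?E x)" for e
        proof -
          have "norm (blinfun_apply (Df ?y) e) \<le> norm (Df ?y) * norm e"
            by (rule norm_blinfun)
          then have "(norm (blinfun_apply (Df ?y) e))\<^sup>2 \<le> (norm (Df ?y) * norm e)\<^sup>2"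
            by (rule power_mono) simp
          also have "\<dots> = (norm (?E x))\<^sup>2 * (norm (Df ?y))\<^sup>2"
            by (simp only: power_mult_distrib that mult.commute)
          also have "\<dots> \<le> (norm (?E x))\<^sup>2 * (K ?y * jacobian (Df ?y))"
            by (intro mult_left_mono y) simp
          also have "\<dots> = K ?y * jac2 (p x) (q x)"
            by (simp only: jac mult.left_commute)
          also have "\<dots> \<le> K ?y * \<bar>jac2 (p x) (q x)\<bar>"
            using K[of ?y] by (intro mult_left_mono) auto
          finally show ?thesis .
        qed
        show "(norm (p x))\<^sup>2 \<le> K ?y * \<bar>jac2 (p x) (q x)\<bar> \<and> (norm (q x))\<^sup>2 \<le> K ?y * \<bar>jac2 (p x) (q x)\<bar>"
          using bd[of "?E x"] bd[of "\<i> * ?E x"] unfolding pD by (simp add: norm_mult)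
      qed
    qed
  qed

  have area: "(\<integral>\<^sup>+x. ennreal (\<bar>jac2 (p x) (q x)\<bar> * h (f (log_polar z x))) * indicator ({a<..<b} \<times> {c<..<d}) x \<partial>lborel)
         \<le> (\<integral>\<^sup>+y. ennreal (h y) \<partial>lborel)"
    if h: "h \<in> borel_measurable borel" "\<And>y. 0 \<le> h y" for h
  proof -
    let ?U = "{a<..<b} \<times> {c<..<d}"
    define g where "g x = f (log_polar z x)" for x
    have cg: "continuous_on UNIV g"
      unfolding g_def by (intro continuous_on_compose2[OF f(1)] continuous_on_log_polar) auto
    have Ub [measurable]: "?U \<in> sets borel" by (auto intro!: borel_Times)
    have Ufin: "emeasure lborel ?U < \<infinity>"
    proof -
      have "bounded ?U" by (intro bounded_Times bounded_Ioo) 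
      then show ?thesis by (rule emeasure_bounded_finite)
    qed
    have D1: "AE x in lborel. x \<in> ?U \<longrightarrow> differentiable_along g (\<lambda>t. (t, 0)) (p x) x"
    proof -
      let ?D = "{x. differentiable_along g (\<lambda>t. t *\<^sub>R (1, 0)) (p x) x}"
      have "?D \<in> sets borel" by (rule sets_directional_derivative[OF cg pm])
      then have "{x. x \<in> ?U \<longrightarrow> x \<in> ?D} \<in> sets borel"
      proof -
        have eq: "{x. x \<in> ?U \<longrightarrow> x \<in> ?D} = (- ?U) \<union> ?D" by blast
        show ?thesis unfolding eq by (intro sets.Un borel_comp Ub \<open>?D \<in> sets borel\<close>)
      qed
      moreover have "AE \<theta> in lborel. AE s in lborel. (s, \<theta>) \<in> ?U \<longrightarrow> (s, \<theta>) \<in> ?D"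
        using radial
      proof eventually_elim
        case (elim \<theta>)
        show ?case
        proof (cases "\<theta> \<in> {c<..<d}")
          case True
          then have int: "set_integrable lborel {a..b} (\<lambda>s. p (s, \<theta>))"
            and inc: "\<And>s t. a \<le> s \<Longrightarrow> s \<le> t \<Longrightarrow> t \<le> b \<Longrightarrow> g (t, \<theta>) - g (s, \<theta>) = (LINT u:{s..t}|lborel. p (u, \<theta>))"
            using elim by (auto simp: g_def)
          have "AE s in lborel. s \<in> {a<..<b} \<longrightarrow> (\<forall>\<epsilon>>0. \<exists>\<delta>>0. \<forall>t. \<bar>t\<bar> < \<delta> \<longrightarrow>
              norm (g (s + t, \<theta>) - g (s, \<theta>) - t *\<^sub>R p (s, \<theta>)) \<le> \<epsilon> * \<bar>t\<bar>)"
            by (rule indefinite_integral_derivative_AE[OF int, of "\<lambda>s. g (s, \<theta>)"]) (rule inc)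
          then show ?thesis
            by eventually_elim auto
        qed auto
      qed
      ultimately have "AE x in lborel. x \<in> ?U \<longrightarrow> x \<in> ?D"
        by (subst AE_lborel_pair_iff(2)) auto
      then show ?thesis by eventually_elim auto
    qed
    have D2: "AE x in lborel. x \<in> ?U \<longrightarrow> differentiable_along g (\<lambda>t. (0, t)) (q x) x"
    proof -
      let ?D = "{x. differentiable_along g (\<lambda>t. t *\<^sub>R (0, 1)) (q x) x}"
      have "?D \<in> sets borel" by (rule sets_directional_derivative[OF cg qm])
      then have "{x. x \<in> ?U \<longrightarrow> x \<in> ?D} \<in> sets borel"
      proof -
        have eq: "{x. x \<in> ?U \<longrightarrow> x \<in> ?D} = (- ?U) \<union> ?D" by blast
        show ?thesis unfolding eq by (intro sets.Un borel_comp Ub \<open>?D \<in> sets borel\<close>)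
      qed
      moreover have "AE s in lborel. AE \<theta> in lborel. (s, \<theta>) \<in> ?U \<longrightarrow> (s, \<theta>) \<in> ?D"
        using angular
      proof eventually_elim
        case (elim s)
        show ?case
        proof (cases "s \<in> {a<..<b}")
          case True
          then have int: "set_integrable lborel {c..d} (\<lambda>\<theta>. q (s, \<theta>))"
            and inc: "\<And>\<theta> \<eta>. c \<le> \<theta> \<Longrightarrow> \<theta> \<le> \<eta> \<Longrightarrow> \<eta> \<le> d \<Longrightarrow> g (s, \<eta>) - g (s, \<theta>) = (LINT u:{\<theta>..\<eta>}|lborel. q (s, u))"
            using elim by (auto simp: g_def)
          have "AE \<theta> in lborel. \<theta> \<in> {c<..<d} \<longrightarrow> (\<forall>\<epsilon>>0. \<exists>\<delta>>0. \<forall>t. \<bar>t\<bar> < \<delta> \<longrightarrow>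
              norm (g (s, \<theta> + t) - g (s, \<theta>) - t *\<^sub>R q (s, \<theta>)) \<le> \<epsilon> * \<bar>t\<bar>)"
            by (rule indefinite_integral_derivative_AE[OF int, of "\<lambda>\<theta>. g (s, \<theta>)"]) (rule inc)
          then show ?thesis
            by eventually_elim auto
        qed auto
      qed
      ultimately have "AE x in lborel. x \<in> ?U \<longrightarrow> x \<in> ?D"
        by (subst AE_lborel_pair_iff(1)) auto
      then show ?thesis by eventually_elim auto
    qed
    have "inj_on g ?U"
    proof -
      have "inj_on (log_polar z) ?U"
        by (rule inj_on_subset[OF inj_on_log_polar[of z c]]) (use cd in auto)
      then show ?thesis
        using f(2) unfolding g_def inj_on_def by blast
    qed
    from area_inequality[OF cg pm qm Ub Ufin D1 D2 this h]
    show ?thesis by (simp add: g_def)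
  qed
  show thesis
    by (rule that[OF pm qm radial angular distortion]) (use area in blast)
qed

section \<open>Modulus estimates\<close>

text \<open>The length-area step. In its uses \<open>r\<close> is the norm of a directional
  derivative, \<open>k\<close> the distortion, \<open>J\<close> the Jacobian and \<open>w\<close>
  the truncated distance in the image. The integrand splits as sqrt k times sqrt J / w, so the
  second factor on the right is the energy of the logarithm.\<close>

lemma weighted_Cauchy_Schwarz:
  fixes r k J w :: "real \<times> real \<Rightarrow> real"
  assumes [measurable]: "r \<in> borel_measurable borel" "k \<in> borel_measurable borel"
      "J \<in> borel_measurable borel" "w \<in> borel_measurable borel" "U \<in> sets borel"
    and nonneg: "\<And>x. 0 \<le> r x" "\<And>x. 0 \<le> k x" "\<And>x. 0 \<le> J x" "\<And>x. 0 < w x"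
    and le: "AE x in lborel. x \<in> U \<longrightarrow> (r x)\<^sup>2 \<le> k x * J x"
  shows "(\<integral>\<^sup>+x. ennreal (r x / w x) * indicator U x \<partial>lborel)\<^sup>2
     \<le> (\<integral>\<^sup>+x. ennreal (k x) * indicator U x \<partial>lborel) * (\<integral>\<^sup>+x. ennreal (J x / (w x)\<^sup>2) * indicator U x \<partial>lborel)"
proof -
  let ?F = "\<lambda>x. ennreal (sqrt (k x)) * indicator U x" and ?G = "\<lambda>x. ennreal (sqrt (J x) / w x) * indicator U x"
  have "(\<integral>\<^sup>+x. ennreal (r x / w x) * indicator U x \<partial>lborel) \<le> (\<integral>\<^sup>+x. ?F x * ?G x \<partial>lborel)"
  proof (rule nn_integral_mono_AE)
    show "AE x in lborel. ennreal (r x / w x) * indicator U x \<le> ?F x * ?G x"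
      using le
    proof eventually_elim
      case (elim x)
      show ?case
      proof (cases "x \<in> U")
        case True
        then have "r x \<le> sqrt (k x * J x)"
          using elim by (intro real_le_rsqrt) auto
        then have "r x / w x \<le> sqrt (k x) * (sqrt (J x) / w x)"
          using nonneg(4)[of x] by (simp add: real_sqrt_mult divide_right_mono)
        then show ?thesis
          using True nonneg[of x] by (simp add: ennreal_mult[symmetric] ennreal_leI less_imp_le)
      qed simp
    qed
  qed
  then have "(\<integral>\<^sup>+x. ennreal (r x / w x) * indicator U x \<partial>lborel)\<^sup>2 \<le> (\<integral>\<^sup>+x. ?F x * ?G x \<partial>lborel)\<^sup>2"
    by (rule power_mono) simp
  also have "\<dots> \<le> (\<integral>\<^sup>+x. (?F x)\<^sup>2 \<partial>lborel) * (\<integral>\<^sup>+x. (?G x)\<^sup>2 \<partial>lborel)"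
    by (rule Cauchy_Schwarz_nn_integral) measurable
  also have "(\<lambda>x. (?F x)\<^sup>2) = (\<lambda>x. ennreal (k x) * indicator U x)"
    using nonneg by (auto simp: fun_eq_iff indicator_def ennreal_power)
  also have "(\<lambda>x. (?G x)\<^sup>2) = (\<lambda>x. ennreal (J x / (w x)\<^sup>2) * indicator U x)"
    using nonneg by (auto simp: fun_eq_iff indicator_def ennreal_power power_divide less_imp_le)
  finally show ?thesis .
qed

lemma nn_integral_Icc_le_Ioo:
  fixes F :: "real \<Rightarrow> ennreal"
  assumes "a \<le> s" "t \<le> b"
  shows "(\<integral>\<^sup>+u. F u * indicator {s..t} u \<partial>lborel) \<le> (\<integral>\<^sup>+u. F u * indicator {a<..<b} u \<partial>lborel)"
proof (rule nn_integral_mono_AE)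
  show "AE u in lborel. F u * indicator {s..t} u \<le> F u * indicator {a<..<b} u"
    using AE_lborel_singleton[of a] AE_lborel_singleton[of b]
    by eventually_elim (use assms in \<open>auto simp: indicator_def\<close>)
qed

lemma emeasure_lborel_Ioo_Times:
  fixes a b c d :: real
  assumes "a \<le> b" "c \<le> d"
  shows "emeasure lborel ({a<..<b} \<times> {c<..<d}) = ennreal ((b - a) * (d - c))"
proof -
  have "emeasure lborel ({a<..<b} \<times> {c<..<d}) = emeasure lborel {a<..<b} * emeasure lborel {c<..<d}"
    unfolding lborel_prod[symmetric] by (rule lborel.emeasure_pair_measure_Times) auto
  then show ?thesis using assms by (simp add: ennreal_mult)
qed

lemma square_le_of_ennreal:
  assumes "ennreal x \<le> X" "X\<^sup>2 \<le> A * B" "A \<le> ennreal a" "B \<le> ennreal b" "0 \<le> x" "0 \<le> a" "0 \<le> b"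
  shows "x\<^sup>2 \<le> a * b"
proof -
  have "ennreal (x\<^sup>2) = (ennreal x)\<^sup>2" using assms by (simp add: ennreal_power)
  also have "\<dots> \<le> X\<^sup>2" by (rule power_mono[OF assms(1)]) simp
  also have "\<dots> \<le> A * B" by (rule assms(2))
  also have "\<dots> \<le> ennreal a * ennreal b" by (intro mult_mono assms) auto
  also have "\<dots> = ennreal (a * b)" using assms by (simp add: ennreal_mult)
  finally show ?thesis using assms by (simp add: ennreal_le_iff)
qed

text \<open>The area inequality is applied with \<open>h\<close> equal to the ring weight, whose
  pullback is the energy density because the image of \<open>U\<close> stays within distance
  \<open>R\<close> of \<open>y0\<close>.\<close>

lemma ring_energy_le:
  fixes p q g :: "real \<times> real \<Rightarrow> complex" and y0 :: complex
  assumes area: "\<And>h. h \<in> borel_measurable borel \<Longrightarrow> (\<And>y. 0 \<le> h y) \<Longrightarrow>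
       (\<integral>\<^sup>+x. ennreal (\<bar>jac2 (p x) (q x)\<bar> * h (g x)) * indicator U x \<partial>lborel)
         \<le> (\<integral>\<^sup>+y. ennreal (h y) \<partial>lborel)"
    and R: "\<And>x. x \<in> U \<Longrightarrow> norm (g x - y0) \<le> R" and \<delta>: "0 < \<delta>" "\<delta> \<le> R"
  shows "(\<integral>\<^sup>+x. ennreal (\<bar>jac2 (p x) (q x)\<bar> / (max (norm (g x - y0)) \<delta>)\<^sup>2) * indicator U x \<partial>lborel)
     \<le> ennreal (pi + 2 * pi * ln (R / \<delta>))"
proof -
  have "ennreal (\<bar>jac2 (p x) (q x)\<bar> / (max (norm (g x - y0)) \<delta>)\<^sup>2) * indicator U x
      = ennreal (\<bar>jac2 (p x) (q x)\<bar> * ring_weight y0 \<delta> R (g x)) * indicator U x" for x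
    using R[of x] by (cases "x \<in> U") (auto simp: ring_weight_def dist_norm norm_minus_commute)
  then have "(\<integral>\<^sup>+x. ennreal (\<bar>jac2 (p x) (q x)\<bar> / (max (norm (g x - y0)) \<delta>)\<^sup>2) * indicator U x \<partial>lborel)
      = (\<integral>\<^sup>+x. ennreal (\<bar>jac2 (p x) (q x)\<bar> * ring_weight y0 \<delta> R (g x)) * indicator U x \<partial>lborel)"
    by (intro nn_integral_cong)
  also have "\<dots> \<le> (\<integral>\<^sup>+y. ennreal (ring_weight y0 \<delta> R y) \<partial>lborel)"
    by (rule area[OF borel_measurable_ring_weight ring_weight_nonneg])
  also have "\<dots> \<le> ennreal (pi + 2 * pi * ln (R / \<delta>))"
    by (rule nn_integral_ring_weight[OF \<delta>])
  finally show ?thesis .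
qed

text \<open>
  The elementary bound \<open>p K \<le> A + exp (p K - A)\<close> with \<open>A = - 2 a\<close> turns exponential integrability
  into a bound for the integral of \<open>K\<close> over thin rings in logarithmic coordinates.
\<close>

lemma log_polar_integral_distortion_le:
  fixes K :: "complex \<Rightarrow> real"
  assumes [measurable]: "K \<in> borel_measurable borel" and K: "\<And>y. 1 \<le> K y" and p: "0 < p"
    and M: "(\<integral>\<^sup>+y. ennreal (exp (p * K y)) * indicator (cball z 1) y \<partial>lborel) \<le> ennreal M" "0 \<le> M"
    and ab: "a < b" "b \<le> 0"
  shows "(\<integral>\<^sup>+x. ennreal (K (log_polar z x)) * indicator ({a<..<b} \<times> {c<..<c + 2 * pi}) x \<partial>lborel)
     \<le> ennreal ((2 * pi * (b - a) * (- 2 * a) + M) / p)"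
proof -
  let ?U = "{a<..<b} \<times> {c<..<c + 2 * pi}"
  have U [measurable]: "?U \<in> sets borel" by (auto intro!: borel_Times)
  define h where "h y = exp (p * K y) * indicator (cball z 1) y" for y
  have [measurable]: "h \<in> borel_measurable borel"
    unfolding h_def[abs_def] by (intro borel_measurable_times borel_measurable_indicator) auto
  have h0: "0 \<le> h y" for y by (simp add: h_def)
  have "(\<integral>\<^sup>+x. ennreal (K (log_polar z x)) * indicator ?U x \<partial>lborel)
      \<le> (\<integral>\<^sup>+x. ennreal (- 2 * a / p) * indicator ?U x
          + ennreal (1 / p) * (ennreal (exp (2 * fst x) * h (log_polar z x)) * indicator ?U x) \<partial>lborel)"
  proof (rule nn_integral_mono)
    fix x
    show "ennreal (K (log_polar z x)) * indicator ?U x \<le> ennreal (- 2 * a / p) * indicator ?U x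
          + ennreal (1 / p) * (ennreal (exp (2 * fst x) * h (log_polar z x)) * indicator ?U x)"
    proof (cases "x \<in> ?U")
      case True
      let ?k = "K (log_polar z x)"
      have x: "a < fst x" "fst x < b" using True by auto
      have "log_polar z x \<in> cball z 1"
        using norm_log_polar[of z x] x ab by (simp add: dist_norm norm_minus_commute)
      then have hx: "h (log_polar z x) = exp (p * ?k)" by (simp add: h_def)
      have "p * ?k + 2 * a \<le> exp (p * ?k + 2 * a)"
        using exp_ge_add_one_self[of "p * ?k + 2 * a"] by linarith
      \<comment> \<open>The factor \<open>exp (2 * a)\<close> is dominated by the Jacobian
        \<open>exp (2 * fst x)\<close>, which turns the exponential term into an integral over the
        plane.\<close>
      also have "\<dots> \<le> exp (2 * fst x) * exp (p * ?k)"
        using x by (simp add: exp_add[symmetric])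
      finally have "p * ?k \<le> - 2 * a + exp (2 * fst x) * h (log_polar z x)"
        by (simp add: hx)
      then have "?k \<le> (- 2 * a + exp (2 * fst x) * h (log_polar z x)) / p"
        using p by (simp add: field_simps)
      also have "\<dots> = - 2 * a / p + 1 / p * (exp (2 * fst x) * h (log_polar z x))"
        by (simp add: add_divide_distrib diff_divide_distrib)
      finally have "ennreal ?k \<le> ennreal (- 2 * a / p + 1 / p * (exp (2 * fst x) * h (log_polar z x)))"
        by (rule ennreal_leI)
      also have "\<dots> = ennreal (- 2 * a / p) + ennreal (1 / p) * ennreal (exp (2 * fst x) * h (log_polar z x))"
      proof -
        have "0 \<le> - 2 * a / p" using ab p by (intro divide_nonneg_pos) auto
        moreover have n: "0 \<le> 1 / p" "0 \<le> exp (2 * fst x) * h (log_polar z x)"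
          using p h0 by auto
        ultimately show ?thesis
          using ennreal_plus[OF _ mult_nonneg_nonneg[OF n]] ennreal_mult[OF n] by (simp only:)
      qed
      finally show ?thesis using True by simp
    qed simp
  qed
  also have "\<dots> = ennreal (- 2 * a / p) * emeasure lborel ?U
      + ennreal (1 / p) * (\<integral>\<^sup>+x. ennreal (exp (2 * fst x) * h (log_polar z x)) * indicator ?U x \<partial>lborel)"
    by (subst nn_integral_add) (auto simp: nn_integral_cmult nn_integral_cmult_indicator)
  also have "\<dots> \<le> ennreal (- 2 * a / p) * ennreal ((b - a) * (2 * pi)) + ennreal (1 / p) * ennreal M"
  proof (intro add_mono mult_left_mono)
    have "(\<integral>\<^sup>+x. ennreal (exp (2 * fst x) * h (log_polar z x)) * indicator ?U x \<partial>lborel)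
        = (\<integral>\<^sup>+y. ennreal (h y) * indicator (log_polar z ` ?U) y \<partial>lebesgue)"
      by (rule log_polar_change_of_variables(2)[OF U, of c]) (use h0 in auto)
    also have "\<dots> \<le> (\<integral>\<^sup>+y. ennreal (h y) \<partial>lebesgue)"
      by (intro nn_integral_mono) (auto simp: indicator_def)
    also have "\<dots> = (\<integral>\<^sup>+y. ennreal (exp (p * K y)) * indicator (cball z 1) y \<partial>lborel)"
      by (simp add: nn_integral_completion h_def ennreal_mult ennreal_indicator)
    finally show "(\<integral>\<^sup>+x. ennreal (exp (2 * fst x) * h (log_polar z x)) * indicator ?U x \<partial>lborel) \<le> ennreal M"
      using M by simp
  qed (use ab emeasure_lborel_Ioo_Times[of a b c "c + 2 * pi"] in auto)
  also have "\<dots> = ennreal (- 2 * a / p * ((b - a) * (2 * pi)) + 1 / p * M)"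
  proof -
    have "0 \<le> - 2 * a / p" using ab p by (intro divide_nonneg_pos) auto
    moreover have "0 \<le> (b - a) * (2 * pi)" using ab by simp
    moreover have "0 \<le> 1 / p" using p by simp
    ultimately show ?thesis
      using ennreal_plus[OF mult_nonneg_nonneg mult_nonneg_nonneg, of "- 2 * a / p" "(b - a) * (2 * pi)" "1 / p" M]
        ennreal_mult[of "- 2 * a / p" "(b - a) * (2 * pi)"] ennreal_mult[of "1 / p" M] M(2) by (simp only:)
  qed
  also have "- 2 * a / p * ((b - a) * (2 * pi)) + 1 / p * M = (2 * pi * (b - a) * (- 2 * a) + M) / p"
    using p by (simp add: field_simps)
  finally show ?thesis .
qed

text \<open>If the logarithm oscillates by more than \<Lambda> on every circle of the ring, then the
  angular derivative has integral at least \<Lambda> on almost each of them, hence at least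
  \<open>(b - a) * \<Lambda>\<close> over the ring. The length-area step bounds the square of this
  by the integral of the distortion times the ring energy. The circles are complete, so the
  distortion enters only through its exponential integral.\<close>

lemma circle_oscillation:
  fixes f :: "complex \<Rightarrow> complex" and K :: "complex \<Rightarrow> real"
  assumes W: "W1q_loc 1 UNIV f Df" and f: "continuous_on UNIV f" "inj f"
    and dist: "AE y in lborel. (norm (Df y))\<^sup>2 \<le> K y * jacobian (Df y)"
    and K [measurable]: "K \<in> borel_measurable borel" and K1: "\<And>y. 1 \<le> K y" and p: "0 < p"
    and M: "(\<integral>\<^sup>+y. ennreal (exp (p * K y)) * indicator (cball z 1) y \<partial>lborel) \<le> ennreal M" "0 \<le> M"
    and ab: "a < b" "b \<le> 0"
    and R: "\<And>x. x \<in> cball z 1 \<Longrightarrow> norm (f x - f z) \<le> R" and \<delta>: "0 < \<delta>" "\<delta> \<le> R"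
    and w: "\<And>x. w x = max (norm (f (log_polar z x) - f z)) \<delta>" and "0 \<le> \<Lambda>"
    and osc: "\<And>s. a < s \<Longrightarrow> s < b \<Longrightarrow> \<exists>\<theta>\<in>{c..c + 2 * pi}. \<exists>\<eta>\<in>{c..c + 2 * pi}. \<Lambda> < \<bar>ln (w (s, \<eta>)) - ln (w (s, \<theta>))\<bar>"
  shows "((b - a) * \<Lambda>)\<^sup>2 \<le> (2 * pi * (b - a) * (- 2 * a) + M) / p * (pi + 2 * pi * ln (R / \<delta>))"
proof -
  let ?d = "c + 2 * pi"
  let ?U = "{a<..<b} \<times> {c<..<?d}"
  have cd: "c < ?d" by simp
  have dist': "AE y in lborel. y \<in> UNIV \<longrightarrow> (norm (Df y))\<^sup>2 \<le> K y * jacobian (Df y)"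
    using dist by simp
  have U [measurable]: "?U \<in> sets borel" by (auto intro!: borel_Times)
  obtain pp q :: "real \<times> real \<Rightarrow> complex" where pm [measurable]: "pp \<in> borel_measurable borel" and qm [measurable]: "q \<in> borel_measurable borel"
    and ang: "AE s in lborel. s \<in> {a..b} \<longrightarrow> has_L1_derivative (\<lambda>\<theta>. f (log_polar z (s, \<theta>))) (\<lambda>\<theta>. q (s, \<theta>)) c ?d"
    and bd: "AE x in lborel. x \<in> {a..b} \<times> {c..?d} \<longrightarrow>
       (norm (pp x))\<^sup>2 \<le> K (log_polar z x) * \<bar>jac2 (pp x) (q x)\<bar> \<and>
       (norm (q x))\<^sup>2 \<le> K (log_polar z x) * \<bar>jac2 (pp x) (q x)\<bar>"
    and area: "\<forall>h\<in>borel_measurable borel. (\<forall>y. 0 \<le> h y) \<longrightarrow>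
       (\<integral>\<^sup>+x. ennreal (\<bar>jac2 (pp x) (q x)\<bar> * h (f (log_polar z x))) * indicator ?U x \<partial>lborel)
         \<le> (\<integral>\<^sup>+y. ennreal (h y) \<partial>lborel)"
    by (rule log_polar_partial_derivatives[where z=z, OF W open_UNIV f ab(1) cd order_refl subset_UNIV dist' K1])
      (rule that; assumption)
  have wpos: "0 < w x" for x using \<delta> by (simp add: w)
  have contw: "continuous_on UNIV (\<lambda>x. f (log_polar z x))"
    by (intro continuous_on_compose2[OF f(1)] continuous_on_log_polar) auto
  then have wm [measurable]: "w \<in> borel_measurable borel"
    unfolding w[abs_def] by (intro borel_measurable_continuous_onI continuous_intros)
  let ?V = "\<integral>\<^sup>+x. ennreal (norm (q x) / w x) * indicator ?U x \<partial>lborel"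
  have V_ge: "ennreal ((b - a) * \<Lambda>) \<le> ?V"
  proof -
    have "ennreal ((b - a) * \<Lambda>) = (\<integral>\<^sup>+s. ennreal \<Lambda> * indicator {a<..<b} s \<partial>lborel)"
      using ab \<open>0 \<le> \<Lambda>\<close> by (subst nn_integral_cmult_indicator) (auto simp: ennreal_mult[symmetric] mult.commute)
    also have "\<dots> \<le> (\<integral>\<^sup>+s. (\<integral>\<^sup>+\<theta>. ennreal (norm (q (s, \<theta>)) / w (s, \<theta>)) * indicator ?U (s, \<theta>) \<partial>lborel) \<partial>lborel)"
    proof (rule nn_integral_mono_AE)
      show "AE s in lborel. ennreal \<Lambda> * indicator {a<..<b} s
          \<le> (\<integral>\<^sup>+\<theta>. ennreal (norm (q (s, \<theta>)) / w (s, \<theta>)) * indicator ?U (s, \<theta>) \<partial>lborel)"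
        using ang
      proof eventually_elim
        case (elim s)
        show ?case
        proof (cases "s \<in> {a<..<b}")
          case True
          then have int: "set_integrable lborel {c..?d} (\<lambda>\<theta>. q (s, \<theta>))"
            and inc: "\<And>\<theta> \<eta>. c \<le> \<theta> \<Longrightarrow> \<theta> \<le> \<eta> \<Longrightarrow> \<eta> \<le> ?d \<Longrightarrow>
              f (log_polar z (s, \<eta>)) - f (log_polar z (s, \<theta>)) = (LINT u:{\<theta>..\<eta>}|lborel. q (s, u))"
            using elim by auto
          have c\<gamma>: "continuous_on UNIV (\<lambda>\<theta>. f (log_polar z (s, \<theta>)))"
            by (intro continuous_on_compose2[OF contw] continuous_intros) auto
          have le: "ennreal \<bar>ln (w (s, \<eta>)) - ln (w (s, \<theta>))\<bar>
              \<le> (\<integral>\<^sup>+\<theta>. ennreal (norm (q (s, \<theta>)) / w (s, \<theta>)) * indicator ?U (s, \<theta>) \<partial>lborel)"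
            if "c \<le> \<theta>" "\<theta> \<le> \<eta>" "\<eta> \<le> ?d" for \<theta> \<eta>
          proof -
            have "ennreal \<bar>ln (w (s, \<eta>)) - ln (w (s, \<theta>))\<bar>
              \<le> (\<integral>\<^sup>+u. ennreal (norm (q (s, u)) / w (s, u)) * indicator {\<theta>..\<eta>} u \<partial>lborel)"
              by (rule log_increment_le[OF c\<gamma> int inc \<delta>(1) _ that]) (auto simp: w)
            also have "\<dots> \<le> (\<integral>\<^sup>+u. ennreal (norm (q (s, u)) / w (s, u)) * indicator {c<..<?d} u \<partial>lborel)"
              by (rule nn_integral_Icc_le_Ioo[OF that(1,3)])
            also have "\<dots> = (\<integral>\<^sup>+\<theta>. ennreal (norm (q (s, \<theta>)) / w (s, \<theta>)) * indicator ?U (s, \<theta>) \<partial>lborel)"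
              using True by (intro nn_integral_cong) (auto simp: indicator_def)
            finally show ?thesis .
          qed
          obtain \<theta> \<eta> where *: "\<theta> \<in> {c..?d}" "\<eta> \<in> {c..?d}" "\<Lambda> < \<bar>ln (w (s, \<eta>)) - ln (w (s, \<theta>))\<bar>"
            using osc[of s] True by auto
          have "ennreal \<bar>ln (w (s, \<eta>)) - ln (w (s, \<theta>))\<bar>
              \<le> (\<integral>\<^sup>+\<theta>. ennreal (norm (q (s, \<theta>)) / w (s, \<theta>)) * indicator ?U (s, \<theta>) \<partial>lborel)"
            using le[of \<theta> \<eta>] le[of \<eta> \<theta>] * by (cases "\<theta> \<le> \<eta>") (auto simp: abs_minus_commute)
          then show ?thesis
            using True order_trans[OF ennreal_leI[OF less_imp_le[OF *(3)]]] by simp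
        qed simp
      qed
    qed
    also have "\<dots> = ?V"
      by (rule nn_integral_pair_lborel(2)) measurable
    finally show ?thesis .
  qed
  have V_le: "?V\<^sup>2 \<le> (\<integral>\<^sup>+x. ennreal (K (log_polar z x)) * indicator ?U x \<partial>lborel)
      * (\<integral>\<^sup>+x. ennreal (\<bar>jac2 (pp x) (q x)\<bar> / (w x)\<^sup>2) * indicator ?U x \<partial>lborel)"
  proof (rule weighted_Cauchy_Schwarz)
    show "AE x in lborel. x \<in> ?U \<longrightarrow> (norm (q x))\<^sup>2 \<le> K (log_polar z x) * \<bar>jac2 (pp x) (q x)\<bar>"
      using bd by eventually_elim auto
    show "(\<lambda>x. \<bar>jac2 (pp x) (q x)\<bar>) \<in> borel_measurable borel"
      unfolding jac2_def by measurable
    show "0 \<le> K (log_polar z x)" for x using K1[of "log_polar z x"] by simp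
  qed (use wpos in auto)
  have e1: "(\<integral>\<^sup>+x. ennreal (K (log_polar z x)) * indicator ?U x \<partial>lborel)
     \<le> ennreal ((2 * pi * (b - a) * (- 2 * a) + M) / p)"
    by (rule log_polar_integral_distortion_le[OF K K1 p M ab])
  have e2: "(\<integral>\<^sup>+x. ennreal (\<bar>jac2 (pp x) (q x)\<bar> / (w x)\<^sup>2) * indicator ?U x \<partial>lborel)
     \<le> ennreal (pi + 2 * pi * ln (R / \<delta>))"
    unfolding w
  proof (rule ring_energy_le[OF area[rule_format] _ \<delta>])
    fix x assume "x \<in> ?U"
    then have "log_polar z x \<in> cball z 1"
      using norm_log_polar[of z x] ab by (auto simp: dist_norm norm_minus_commute)
    then show "norm (f (log_polar z x) - f z) \<le> R" by (rule R)
  qed auto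
  have "0 \<le> 2 * pi * (b - a) * (- 2 * a)"
  proof (rule mult_nonneg_nonneg)
    show "0 \<le> 2 * pi * (b - a)" using ab by (intro mult_nonneg_nonneg) auto
    show "0 \<le> - 2 * a" using ab by simp
  qed
  then have "0 \<le> (2 * pi * (b - a) * (- 2 * a) + M) / p"
    using M(2) p by (intro divide_nonneg_pos add_nonneg_nonneg)
  moreover have "0 \<le> pi + 2 * pi * ln (R / \<delta>)" "0 \<le> (b - a) * \<Lambda>"
    using \<delta> ab \<open>0 \<le> \<Lambda>\<close> by auto
  ultimately show ?thesis
    using square_le_of_ennreal[OF V_ge V_le e1 e2] by blast
qed

text \<open>The length-area step along radii, with constant distortion. The opening
  \<open>d - c\<close> occurs squared on the left and once on the right, while the energy bound is
  that of a full ring; so the resulting bound for \<Lambda>^2 is inversely proportional to the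
  opening.\<close>

lemma sector_estimate:
  fixes f :: "complex \<Rightarrow> complex"
  assumes W: "W1q_loc 1 \<Omega> f Df" and \<Omega>: "open \<Omega>" and f: "continuous_on UNIV f" "inj f"
    and dist: "AE y in lborel. y \<in> \<Omega> \<longrightarrow> (norm (Df y))\<^sup>2 \<le> K * jacobian (Df y)"
    and K1: "1 \<le> K" and ab: "a < b" and cd: "c < d" "d \<le> c + 2 * pi"
    and img: "log_polar z ` ({a..b} \<times> {c..d}) \<subseteq> \<Omega>"
    and R: "\<And>x. x \<in> log_polar z ` ({a..b} \<times> {c..d}) \<Longrightarrow> norm (f x - f z) \<le> R" and \<delta>: "0 < \<delta>" "\<delta> \<le> R"
    and w: "\<And>x. w x = max (norm (f (log_polar z x) - f z)) \<delta>" and "0 \<le> \<Lambda>"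
    and growth: "\<And>\<theta>. c \<le> \<theta> \<Longrightarrow> \<theta> \<le> d \<Longrightarrow> \<Lambda> \<le> ln (w (b, \<theta>)) - ln (w (a, \<theta>))"
  shows "((d - c) * \<Lambda>)\<^sup>2 \<le> K * ((b - a) * (d - c)) * (pi + 2 * pi * ln (R / \<delta>))"
proof -
  let ?U = "{a<..<b} \<times> {c<..<d}"
  have U [measurable]: "?U \<in> sets borel" by (auto intro!: borel_Times)
  obtain p q :: "real \<times> real \<Rightarrow> complex" where pm [measurable]: "p \<in> borel_measurable borel" and qm [measurable]: "q \<in> borel_measurable borel"
    and rad: "AE \<theta> in lborel. \<theta> \<in> {c..d} \<longrightarrow> has_L1_derivative (\<lambda>s. f (log_polar z (s, \<theta>))) (\<lambda>s. p (s, \<theta>)) a b"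
    and bd: "AE x in lborel. x \<in> {a..b} \<times> {c..d} \<longrightarrow>
       (norm (p x))\<^sup>2 \<le> K * \<bar>jac2 (p x) (q x)\<bar> \<and> (norm (q x))\<^sup>2 \<le> K * \<bar>jac2 (p x) (q x)\<bar>"
    and area: "\<forall>h\<in>borel_measurable borel. (\<forall>y. 0 \<le> h y) \<longrightarrow>
       (\<integral>\<^sup>+x. ennreal (\<bar>jac2 (p x) (q x)\<bar> * h (f (log_polar z x))) * indicator ?U x \<partial>lborel)
         \<le> (\<integral>\<^sup>+y. ennreal (h y) \<partial>lborel)"
    by (rule log_polar_partial_derivatives[OF W \<Omega> f ab cd img dist K1]) (rule that; assumption)
  have wpos: "0 < w x" for x using \<delta> by (simp add: w)
  have contw: "continuous_on UNIV (\<lambda>x. f (log_polar z x))"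
    by (intro continuous_on_compose2[OF f(1)] continuous_on_log_polar) auto
  then have wm [measurable]: "w \<in> borel_measurable borel"
    unfolding w[abs_def] by (intro borel_measurable_continuous_onI continuous_intros)
  let ?V = "\<integral>\<^sup>+x. ennreal (norm (p x) / w x) * indicator ?U x \<partial>lborel"
  have V_ge: "ennreal ((d - c) * \<Lambda>) \<le> ?V"
  proof -
    have "ennreal ((d - c) * \<Lambda>) = (\<integral>\<^sup>+\<theta>. ennreal \<Lambda> * indicator {c<..<d} \<theta> \<partial>lborel)"
      using cd \<open>0 \<le> \<Lambda>\<close> by (subst nn_integral_cmult_indicator) (auto simp: ennreal_mult[symmetric] mult.commute)
    also have "\<dots> \<le> (\<integral>\<^sup>+\<theta>. (\<integral>\<^sup>+s. ennreal (norm (p (s, \<theta>)) / w (s, \<theta>)) * indicator ?U (s, \<theta>) \<partial>lborel) \<partial>lborel)"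
    proof (rule nn_integral_mono_AE)
      show "AE \<theta> in lborel. ennreal \<Lambda> * indicator {c<..<d} \<theta>
          \<le> (\<integral>\<^sup>+s. ennreal (norm (p (s, \<theta>)) / w (s, \<theta>)) * indicator ?U (s, \<theta>) \<partial>lborel)"
        using rad
      proof eventually_elim
        case (elim \<theta>)
        show ?case
        proof (cases "\<theta> \<in> {c<..<d}")
          case True
          then have int: "set_integrable lborel {a..b} (\<lambda>s. p (s, \<theta>))"
            and inc: "\<And>s t. a \<le> s \<Longrightarrow> s \<le> t \<Longrightarrow> t \<le> b \<Longrightarrow>
              f (log_polar z (t, \<theta>)) - f (log_polar z (s, \<theta>)) = (LINT u:{s..t}|lborel. p (u, \<theta>))"
            using elim by auto
          have c\<gamma>: "continuous_on UNIV (\<lambda>s. f (log_polar z (s, \<theta>)))"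
            by (intro continuous_on_compose2[OF contw] continuous_intros) auto
          have "ennreal \<Lambda> \<le> ennreal \<bar>ln (w (b, \<theta>)) - ln (w (a, \<theta>))\<bar>"
            using growth[of \<theta>] True by (intro ennreal_leI) auto
          also have "\<dots> \<le> (\<integral>\<^sup>+u. ennreal (norm (p (u, \<theta>)) / w (u, \<theta>)) * indicator {a..b} u \<partial>lborel)"
            by (rule log_increment_le[OF c\<gamma> int inc \<delta>(1)]) (use ab in \<open>auto simp: w\<close>)
          also have "\<dots> \<le> (\<integral>\<^sup>+u. ennreal (norm (p (u, \<theta>)) / w (u, \<theta>)) * indicator {a<..<b} u \<partial>lborel)"
            by (rule nn_integral_Icc_le_Ioo) auto
          also have "\<dots> = (\<integral>\<^sup>+s. ennreal (norm (p (s, \<theta>)) / w (s, \<theta>)) * indicator ?U (s, \<theta>) \<partial>lborel)"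
            using True by (intro nn_integral_cong) (auto simp: indicator_def)
          finally show ?thesis using True by simp
        qed simp
      qed
    qed
    also have "\<dots> = ?V"
      by (rule nn_integral_pair_lborel(1)) measurable
    finally show ?thesis .
  qed
  have V_le: "?V\<^sup>2 \<le> (\<integral>\<^sup>+x. ennreal K * indicator ?U x \<partial>lborel)
      * (\<integral>\<^sup>+x. ennreal (\<bar>jac2 (p x) (q x)\<bar> / (w x)\<^sup>2) * indicator ?U x \<partial>lborel)"
  proof (rule weighted_Cauchy_Schwarz)
    show "AE x in lborel. x \<in> ?U \<longrightarrow> (norm (p x))\<^sup>2 \<le> K * \<bar>jac2 (p x) (q x)\<bar>"
      using bd by eventually_elim auto
    show "(\<lambda>x. \<bar>jac2 (p x) (q x)\<bar>) \<in> borel_measurable borel"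
      unfolding jac2_def by measurable
  qed (use wpos K1 in auto)
  have e1: "(\<integral>\<^sup>+x. ennreal K * indicator ?U x \<partial>lborel) \<le> ennreal (K * ((b - a) * (d - c)))"
    using K1 ab cd by (subst nn_integral_cmult_indicator) (auto simp: emeasure_lborel_Ioo_Times ennreal_mult)
  have e2: "(\<integral>\<^sup>+x. ennreal (\<bar>jac2 (p x) (q x)\<bar> / (w x)\<^sup>2) * indicator ?U x \<partial>lborel)
     \<le> ennreal (pi + 2 * pi * ln (R / \<delta>))"
    unfolding w
  proof (rule ring_energy_le[OF area[rule_format] _ \<delta>])
    fix x assume "x \<in> ?U"
    then show "norm (f (log_polar z x) - f z) \<le> R" by (intro R imageI) auto
  qed auto
  have "0 \<le> K * ((b - a) * (d - c))" "0 \<le> pi + 2 * pi * ln (R / \<delta>)" "0 \<le> (d - c) * \<Lambda>"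
    using K1 ab cd \<delta> \<open>0 \<le> \<Lambda>\<close> by auto
  then show ?thesis
    using square_le_of_ennreal[OF V_ge V_le e1 e2] by blast
qed

section \<open>Geometry of the disk and constants uniform in the centre\<close>

lemma Lq_loc_2_imp_1:
  assumes u: "Lq_loc 2 \<Omega> u" and \<Omega>: "open \<Omega>"
  shows "Lq_loc 1 \<Omega> u"
  unfolding Lq_loc_def
proof (intro conjI allI impI)
  show um: "u \<in> borel_measurable (lebesgue_on \<Omega>)" using u by (simp add: Lq_loc_def)
  fix C assume C: "compact C \<and> C \<subseteq> \<Omega>"
  have Cl: "C \<in> lmeasurable" using C lmeasurable_compact by blast
  have "(\<lambda>z. indicator \<Omega> z *\<^sub>R u z) \<in> borel_measurable lebesgue"
    using um \<Omega> by (simp add: borel_measurable_restrict_space_iff)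
  moreover have "(indicator C :: complex \<Rightarrow> real) \<in> borel_measurable lebesgue"
    using Cl by (intro borel_measurable_indicator) auto
  ultimately have "(\<lambda>z. indicator C z *\<^sub>R norm (indicator \<Omega> z *\<^sub>R u z)) \<in> borel_measurable lebesgue"
    by (rule borel_measurable_scaleR[rotated, OF measurable_compose[OF _ borel_measurable_norm]])
  also have "(\<lambda>z. indicator C z *\<^sub>R norm (indicator \<Omega> z *\<^sub>R u z)) = (\<lambda>z. indicator C z *\<^sub>R (norm (u z) powr 1))"
    using C by (auto simp: fun_eq_iff indicator_def)
  finally have meas: "(\<lambda>z. indicator C z *\<^sub>R (norm (u z) powr 1)) \<in> borel_measurable lebesgue" .
  show "set_integrable lebesgue C (\<lambda>z. norm (u z) powr 1)"
    unfolding set_integrable_def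
  proof (rule Bochner_Integration.integrable_bound[OF _ meas])
    have "integrable lebesgue (\<lambda>z. indicator C z *\<^sub>R (norm (u z) powr 2))"
      using u C by (auto simp: Lq_loc_def set_integrable_def)
    moreover have "integrable lebesgue (indicator C :: complex \<Rightarrow> real)"
      using Cl by (simp add: lmeasurable_iff_integrable)
    ultimately show "integrable lebesgue (\<lambda>z. indicator C z + indicator C z *\<^sub>R (norm (u z) powr 2))"
      by (rule Bochner_Integration.integrable_add[rotated])
    have "x \<le> 1 + x\<^sup>2" for x :: real
    proof -
      have "2 * x \<le> x\<^sup>2 + 1" using sum_squares_bound[of x 1] by simp
      then show ?thesis using zero_le_power2[of x] by linarith
    qed
    then have "norm (u z) powr 1 \<le> 1 + norm (u z) powr 2" for z
      by (cases "u z = 0") auto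
    then show "AE z in lebesgue. norm (indicator C z *\<^sub>R (norm (u z) powr 1))
        \<le> norm (indicator C z + indicator C z *\<^sub>R (norm (u z) powr 2))"
      by (auto simp: indicator_def)
  qed
qed

lemma W1q_loc_2_imp_1: "W1q_loc 2 \<Omega> f Df \<Longrightarrow> open \<Omega> \<Longrightarrow> W1q_loc 1 \<Omega> f Df"
  by (auto simp: W1q_loc_def intro: Lq_loc_2_imp_1)

text \<open>The sector is symmetric about the inward direction \<open>Arg (- z)\<close>. By the law
  of cosines the squared norm, with \<rho> = \<open>norm z\<close>, is at most t^2 + \<rho>^2 - 2 t
  \<rho> cos \<beta>. The bounds \<rho>^2 \<le> \<rho> and t \<le> cos \<beta> reduce this to t^2 +
  \<rho> (1 - 2 t^2), hence to at most 1 - t^2. For \<open>z = 0\<close> the direction is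
  immaterial, since \<rho> = 0.\<close>

lemma sector_subset_ball:
  assumes z: "norm z \<le> 1" and \<beta>: "0 < \<beta>" "\<beta> < pi / 2"
    and t: "0 < t" "t \<le> cos \<beta>" "t \<le> 1 / 2" and \<theta>: "\<bar>\<theta> - Arg (- z)\<bar> \<le> \<beta>"
  shows "norm (z + of_real t * cis \<theta>) < 1"
proof -
  define \<rho> \<theta>0 where "\<rho> = norm z" and "\<theta>0 = Arg (- z)"
  have "- z = of_real \<rho> * cis \<theta>0"
    using rcis_cmod_Arg[of "- z"] by (simp add: rcis_def \<rho>_def \<theta>0_def)
  then have zeq: "z = - (of_real \<rho> * cis \<theta>0)"
    by (metis minus_minus)
  have \<rho>: "0 \<le> \<rho>" "\<rho> \<le> 1" using z by (auto simp: \<rho>_def)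
  have "cos \<beta> \<le> cos \<bar>\<theta> - \<theta>0\<bar>"
    using \<theta> \<beta> by (intro cos_monotone_0_pi_le) (auto simp: \<theta>0_def)
  then have cos: "cos \<beta> \<le> cos (\<theta> - \<theta>0)" by simp
  have "(norm (z + of_real t * cis \<theta>))\<^sup>2 = (t * cos \<theta> - \<rho> * cos \<theta>0)\<^sup>2 + (t * sin \<theta> - \<rho> * sin \<theta>0)\<^sup>2"
    by (subst zeq) (simp add: cmod_power2)
  also have "\<dots> = t\<^sup>2 * ((cos \<theta>)\<^sup>2 + (sin \<theta>)\<^sup>2) + \<rho>\<^sup>2 * ((cos \<theta>0)\<^sup>2 + (sin \<theta>0)\<^sup>2) - 2 * t * \<rho> * cos (\<theta> - \<theta>0)"
    unfolding cos_diff by algebra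
  also have "\<dots> = t\<^sup>2 + \<rho>\<^sup>2 - 2 * t * \<rho> * cos (\<theta> - \<theta>0)"
    by simp
  also have "\<dots> \<le> t\<^sup>2 + \<rho>\<^sup>2 - 2 * t * \<rho> * cos \<beta>"
    using cos t \<rho> by (intro diff_left_mono mult_left_mono) auto
  also have "\<dots> \<le> t\<^sup>2 + \<rho> - 2 * t * \<rho> * t"
  proof -
    have "\<rho>\<^sup>2 \<le> \<rho>" using \<rho> by (simp add: power2_eq_square mult_left_le)
    moreover have "2 * t * \<rho> * t \<le> 2 * t * \<rho> * cos \<beta>"
      using t \<rho> by (intro mult_left_mono) auto
    ultimately show ?thesis by simp
  qed
  also have "\<dots> = t\<^sup>2 + \<rho> * (1 - 2 * t\<^sup>2)"
    by (simp add: power2_eq_square algebra_simps)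
  also have "\<dots> \<le> t\<^sup>2 + 1 * (1 - 2 * t\<^sup>2)"
  proof -
    have "t\<^sup>2 \<le> (1 / 2)\<^sup>2" using t by (intro power_mono) auto
    then have "0 \<le> 1 - 2 * t\<^sup>2" by (simp add: power2_eq_square)
    then show ?thesis using \<rho> by (intro add_left_mono mult_right_mono) auto
  qed
  also have "\<dots> < 1" using t by simp
  finally have "(norm (z + of_real t * cis \<theta>))\<^sup>2 < 1\<^sup>2" by simp
  then show ?thesis by (rule power_less_imp_less_base) simp
qed

text \<open>The preimage of the segment from \<open>f z\<close> to \<open>f w\<close> joins \<open>z\<close> to \<open>w\<close>, so it meets every circle in between.\<close>

lemma circle_meets_preimage_of_segment:
  fixes f :: "complex \<Rightarrow> complex"
  assumes h: "homeomorphism UNIV UNIV f g" and t: "0 \<le> t" "t \<le> norm (w - z)"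
  obtains x where "norm (x - z) = t" "norm (f x - f z) \<le> norm (f w - f z)"
proof -
  define x where "x u = g (f z + u *\<^sub>R (f w - f z))" for u :: real
  have g: "continuous_on UNIV g" and gf: "g (f y) = y" and fg: "f (g y) = y" for y
    using h by (auto simp: homeomorphism_def)
  have "continuous_on {0..1} (\<lambda>u. norm (x u - z))"
    unfolding x_def by (intro continuous_intros continuous_on_compose2[OF g]) auto
  moreover have "norm (x 0 - z) \<le> t" "t \<le> norm (x 1 - z)"
    using t by (auto simp: x_def gf)
  ultimately obtain u where u: "0 \<le> u" "u \<le> 1" "norm (x u - z) = t"
    using IVT'[of "\<lambda>u. norm (x u - z)" 0 t 1] by auto
  have "norm (f (x u) - f z) \<le> norm (f w - f z)"
    using u by (simp add: x_def fg mult_left_le_one_le)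
  with u(3) show thesis by (rule that)
qed

text \<open>The ball of radius 2 contains every unit ball with centre in the closed disk, so one
  \<open>M\<close> serves all centres.\<close>

lemma exp_integrable_distortion_representative:
  assumes "exp_integrable_distortion p UNIV UNIV f"
  obtains g Df K M where "homeomorphism UNIV UNIV f g" "W1q_loc 1 UNIV f Df"
    "K \<in> borel_measurable borel" "\<And>y. 1 \<le> K y"
    "AE y in lborel. (norm (Df y))\<^sup>2 \<le> K y * jacobian (Df y)"
    "0 \<le> M" "(\<integral>\<^sup>+y. ennreal (exp (p * K y)) * indicator (cball 0 2) y \<partial>lborel) \<le> ennreal M"
proof -
  obtain g where g: "homeomorphism UNIV UNIV f g"
    using assms by (auto simp: exp_integrable_distortion_def finite_distortion_def sense_preserving_homeomorphism_def)
  obtain K0 where K0: "distortion_bound UNIV f K0" "Lq_loc 1 UNIV (\<lambda>z. exp (p * K0 z))"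
    using assms by (auto simp: exp_integrable_distortion_def is_distortion_def)
  obtain Df where Df: "W1q_loc 1 UNIV f Df" "AE z in lebesgue_on UNIV. (norm (Df z))\<^sup>2 \<le> K0 z * jacobian (Df z)"
    using K0(1) unfolding distortion_bound_def by blast
  have K0m: "K0 \<in> borel_measurable lebesgue" and K01: "1 \<le> K0 z" for z
    using K0(1) by (auto simp: distortion_bound_def lebesgue_on_UNIV_eq)
  obtain Kb where Kb: "Kb \<in> borel_measurable lborel" "AE z in lborel. K0 z = Kb z"
    using completion_ex_borel_measurable_real[OF K0m] by blast
  \<comment> \<open>The Borel version agrees with \<open>K0\<close> only almost everywhere; the
    maximum restores the bound 1 at every point.\<close>
  define K where "K y = max 1 (Kb y)" for y
  have Km [measurable]: "K \<in> borel_measurable borel"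
    using Kb(1) unfolding K_def[abs_def] by simp
  have KK0: "AE z in lborel. K0 z = K z"
    using Kb(2)
  proof eventually_elim
    case (elim z)
    then show ?case using K01[of z] by (simp add: K_def)
  qed
  have dist: "AE y in lborel. (norm (Df y))\<^sup>2 \<le> K y * jacobian (Df y)"
    using Df(2)[unfolded lebesgue_on_UNIV_eq AE_completion_iff] KK0 by eventually_elim simp
  define M where "M = enn2real (\<integral>\<^sup>+y. ennreal (exp (p * K y)) * indicator (cball 0 2) y \<partial>lborel)"
  have "integrable lebesgue (\<lambda>z. indicator (cball 0 2) z *\<^sub>R (norm (exp (p * K0 z)) powr 1))"
    using K0(2) by (auto simp: Lq_loc_def set_integrable_def)
  then have "(\<integral>\<^sup>+z. ennreal (norm (indicator (cball 0 2) z *\<^sub>R (norm (exp (p * K0 z)) powr 1))) \<partial>lebesgue) < \<infinity>"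
    by (simp add: integrable_iff_bounded)
  moreover have "(\<integral>\<^sup>+z. ennreal (norm (indicator (cball 0 2) z *\<^sub>R (norm (exp (p * K0 z)) powr 1))) \<partial>lebesgue)
      = (\<integral>\<^sup>+y. ennreal (exp (p * K y)) * indicator (cball 0 2) y \<partial>lebesgue)"
  proof (rule nn_integral_cong_AE)
    show "AE z in lebesgue. ennreal (norm (indicator (cball 0 2) z *\<^sub>R (norm (exp (p * K0 z)) powr 1)))
        = ennreal (exp (p * K z)) * indicator (cball 0 2) z"
      using AE_completion[OF KK0] by eventually_elim (auto simp: indicator_def)
  qed
  ultimately have "(\<integral>\<^sup>+y. ennreal (exp (p * K y)) * indicator (cball 0 2) y \<partial>lborel) < \<infinity>"
    by (simp add: nn_integral_completion)
  then have "(\<integral>\<^sup>+y. ennreal (exp (p * K y)) * indicator (cball 0 2) y \<partial>lborel) \<le> ennreal M"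
    by (simp add: M_def)
  moreover have "0 \<le> M" by (simp add: M_def)
  moreover have "1 \<le> K y" for y by (simp add: K_def)
  ultimately show thesis
    using that[OF g Df(1) Km _ dist] by blast
qed

text \<open>The displacement is a continuous function of the pair of points, and positive off the
  diagonal by injectivity. Its extrema over compact sets of pairs are therefore constants
  independent of the centre.\<close>

lemma displacement_bounds:
  fixes f :: "complex \<Rightarrow> complex"
  assumes f: "continuous_on UNIV f" "inj f" and r: "0 < r" "r \<le> 1"
  obtains R R' c where "0 < R" "R \<le> R'" "0 < c"
    "\<And>z x. norm z \<le> 1 \<Longrightarrow> norm (x - z) = r \<Longrightarrow> R \<le> norm (f x - f z)"
    "\<And>z x. norm z \<le> 1 \<Longrightarrow> norm (x - z) \<le> 1 \<Longrightarrow> norm (f x - f z) \<le> R'"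
    "\<And>z w. norm z \<le> 1 \<Longrightarrow> norm w \<le> 1 \<Longrightarrow> r \<le> norm (z - w) \<Longrightarrow> c \<le> norm (f z - f w)"
proof -
  let ?F = "\<lambda>(z, x). norm (f x - f z)"
  have cF: "continuous_on S ?F" for S
    unfolding split_beta by (intro continuous_intros continuous_on_compose2[OF f(1)]) auto
  have comp: "compact (B \<inter> {x. r \<le> norm (snd x - fst x)})" if "compact B" for B :: "(complex \<times> complex) set"
    using that by (intro compact_Int_closed closed_Collect_le continuous_intros)
  let ?B = "cball (0::complex) 1 \<times> cball (0::complex) 2"
  have cB: "compact ?B" by (intro compact_Times) auto
  let ?A = "?B \<inter> {x. r \<le> norm (snd x - fst x)}"
  have "(0, 1) \<in> ?A" using r by auto
  then have "?A \<noteq> {}" by blast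
  then obtain m where m: "m \<in> ?A" and inf: "\<And>x. x \<in> ?A \<Longrightarrow> ?F m \<le> ?F x"
    using continuous_attains_inf[OF comp[OF cB] _ cF] by blast
  have "(0, 1) \<in> ?B" by auto
  then obtain m' where sup: "\<And>x. x \<in> ?B \<Longrightarrow> ?F x \<le> ?F m'"
    using continuous_attains_sup[OF cB _ cF] by blast
  have "fst m \<noteq> snd m" using m r by auto
  then have pos: "0 < ?F m" using f(2) by (auto simp: split_beta inj_def)
  have nx: "norm x \<le> 2" if "norm z \<le> 1" "norm (x - z) \<le> 1" for x z :: complex
    using norm_triangle_ineq[of "x - z" z] that by simp
  show thesis
  proof
    \<comment> \<open>The same minimum serves as \<open>R\<close> and as \<open>c\<close>.\<close>
    show "0 < ?F m" "0 < ?F m" by (rule pos)+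
    show "?F m \<le> ?F m'" using sup m by blast
    show "?F m \<le> norm (f x - f z)" if "norm z \<le> 1" "norm (x - z) = r" for z x
      using inf[of "(z, x)"] that nx[of z x] r by auto
    show "norm (f x - f z) \<le> ?F m'" if "norm z \<le> 1" "norm (x - z) \<le> 1" for z x
      using sup[of "(z, x)"] that nx[of z x] by auto
    show "?F m \<le> norm (f z - f w)" if "norm z \<le> 1" "norm w \<le> 1" "r \<le> norm (z - w)" for z w
      using inf[of "(w, z)"] that by auto
  qed
qed

text \<open>The cube collects three losses: the logarithmic length of the radii, the additive
  constants in the energy, and the opening of the sector. The square comes from the growth
  \<open>(1 - \<kappa>) * L\<close>, which enters the sector estimate squared.\<close>

lemma small_parameter_exists:
  assumes "0 < (\<epsilon>::real)"
  obtains \<kappa> :: real where "0 < \<kappa>" "\<kappa> < 1" "(1 + \<kappa>) ^ 3 \<le> (1 + \<epsilon>) * (1 - \<kappa>)\<^sup>2"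
proof -
  have "((\<lambda>\<kappa>::real. (1 + \<kappa>) ^ 3 - (1 + \<epsilon>) * (1 - \<kappa>)\<^sup>2) \<longlongrightarrow> (1 + 0) ^ 3 - (1 + \<epsilon>) * (1 - 0)\<^sup>2) (at_right 0)"
    by (intro tendsto_intros)
  then have "\<forall>\<^sub>F \<kappa> in at_right 0. (1 + \<kappa>) ^ 3 - (1 + \<epsilon>) * (1 - \<kappa>)\<^sup>2 < 0"
    using assms by (intro order_tendstoD(2)) auto
  then obtain b where "0 < b" and b: "\<And>\<kappa>. 0 < \<kappa> \<Longrightarrow> \<kappa> < b \<Longrightarrow> (1 + \<kappa>) ^ 3 - (1 + \<epsilon>) * (1 - \<kappa>)\<^sup>2 < 0"
    by (auto simp: eventually_at_right_field)
  define \<kappa> where "\<kappa> = min b 1 / 2"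
  have "0 < \<kappa>" "\<kappa> < b" "\<kappa> < 1" using \<open>0 < b\<close> by (auto simp: \<kappa>_def)
  then show thesis
    using that[of \<kappa>] b[of \<kappa>] by simp
qed

section \<open>Choice of parameters and the lower bound for the displacement\<close>

theorem theorem3:
  fixes p K \<epsilon> :: real and f :: "complex \<Rightarrow> complex"
  assumes "p > 0" and "K \<ge> 1"
    and "exp_integrable_distortion p UNIV UNIV f"
    and "quasiconformal_in K (ball 0 1) f"
    and "\<epsilon> > 0"
  shows "\<exists>c>0. \<forall>z\<in>cball 0 1. \<forall>w\<in>cball 0 1.
           norm (f z - f w) \<ge> c * norm (z - w) powr (2 * K * (1 + \<epsilon>))"
proof -
  obtain g Df Kf M where g: "homeomorphism UNIV UNIV f g" and W: "W1q_loc 1 UNIV f Df"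
    and Kf: "Kf \<in> borel_measurable borel" "\<And>y. 1 \<le> Kf y"
    and dist: "AE y in lborel. (norm (Df y))\<^sup>2 \<le> Kf y * jacobian (Df y)"
    and M: "0 \<le> M" "(\<integral>\<^sup>+y. ennreal (exp (p * Kf y)) * indicator (cball 0 2) y \<partial>lborel) \<le> ennreal M"
    by (rule exp_integrable_distortion_representative[OF assms(3)]) (rule that; assumption)
  have f: "continuous_on UNIV f" "inj f"
    using g by (auto simp: homeomorphism_def intro: inj_on_inverseI)
  obtain Dq where Wq: "W1q_loc 2 (ball 0 1) f Dq"
    and distq0: "AE z in lebesgue_on (ball 0 1). (norm (Dq z))\<^sup>2 \<le> K * jacobian (Dq z)"
    using assms(4) by (auto simp: quasiconformal_in_def)
  have Wq1: "W1q_loc 1 (ball 0 1) f Dq" using W1q_loc_2_imp_1[OF Wq] by simp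
  have distq: "AE y in lborel. y \<in> ball 0 1 \<longrightarrow> (norm (Dq y))\<^sup>2 \<le> K * jacobian (Dq y)"
    using distq0 by (simp add: AE_restrict_space_iff AE_completion_iff)

  obtain \<kappa> where \<kappa>: "0 < \<kappa>" "\<kappa> < 1" "(1 + \<kappa>) ^ 3 \<le> (1 + \<epsilon>) * (1 - \<kappa>)\<^sup>2"
    using small_parameter_exists[OF assms(5)] by blast
  \<comment> \<open>Half the opening of the sector. It stays below pi/2, so that even for
    \<open>norm z = 1\<close> a small sector fits into the disk.\<close>
  define \<beta> where "\<beta> = pi / (1 + \<kappa>) / 2"
  have two_\<beta>: "2 * \<beta> = pi / (1 + \<kappa>)"
    unfolding \<beta>_def by (rule times_divide_eq_right[THEN trans]) (rule nonzero_mult_div_cancel_left, simp)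
  have \<beta>: "0 < \<beta>" "\<beta> < pi / 2"
    using \<kappa> by (auto simp: \<beta>_def field_simps)
  define r where "r = min (1 / 2) (cos \<beta>)"
  have r: "0 < r" "r \<le> 1 / 2" "r \<le> cos \<beta>"
    using cos_gt_zero[OF \<beta>] by (auto simp: r_def)
  have r1: "r \<le> 1" using r by simp
  obtain R R' c1 where R: "0 < R" "R \<le> R'" and "0 < c1"
    and R_le: "\<And>z x. norm z \<le> 1 \<Longrightarrow> norm (x - z) = r \<Longrightarrow> R \<le> norm (f x - f z)"
    and le_R': "\<And>z x. norm z \<le> 1 \<Longrightarrow> norm (x - z) \<le> 1 \<Longrightarrow> norm (f x - f z) \<le> R'"
    and far: "\<And>z w. norm z \<le> 1 \<Longrightarrow> norm w \<le> 1 \<Longrightarrow> r \<le> norm (z - w) \<Longrightarrow> c1 \<le> norm (f z - f w)"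
    by (rule displacement_bounds[OF f r(1) r1]) (rule that; assumption)

  define l0 where "l0 = ln (1 / r)"
  have l0: "0 < l0" using r by (auto simp: l0_def)
  \<comment> \<open>For the ring with logarithmic radii between \<open>- (1 + \<kappa>) * l\<close>
    and \<open>- l\<close> the distortion integral is at most \<open>B1 * l\<^sup>2\<close>: the
    first term comes from \<open>b - a = \<kappa> * l\<close> and
    \<open>- a = (1 + \<kappa>) * l\<close>, the second from
    \<open>M \<le> M / l0\<^sup>2 * l\<^sup>2\<close>, as \<open>l > l0\<close>.\<close>
  define B1 where "B1 = (4 * pi * \<kappa> * (1 + \<kappa>) + M / l0\<^sup>2) / p"
  \<comment> \<open>The three thresholds make \<open>L\<close> positive, absorb the additive
    constants of the energy into the factor \<open>1 + \<kappa>\<close>, and rule out large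
    oscillation on all circles of the ring.\<close>
  define L0 where "L0 = max 1 (max ((1 / 2 + ln (R' / R)) / \<kappa>) (2 * pi * (1 + \<kappa>) * B1 / \<kappa> ^ 4))"
  define e where "e = 2 * K * (1 + \<epsilon>)"
  have "0 < e" using assms by (simp add: e_def)

  have key: "ln (R / \<delta>) \<le> e * ln (1 / d)"
    if zw: "norm z \<le> 1" "norm w \<le> 1" and d: "d = norm (w - z)" "0 < d" "d < r"
      and \<delta>: "\<delta> = norm (f w - f z)" and big: "L0 < ln (R / \<delta>)" for z w d \<delta>
  proof -
    define l L where "l = ln (1 / d)" and "L = ln (R / \<delta>)"
    have "w \<noteq> z" using d by auto
    then have \<delta>pos: "0 < \<delta>" using f(2) by (auto simp: \<delta> inj_def)
    have L: "1 < L" "(1 / 2 + ln (R' / R)) / \<kappa> < L" "2 * pi * (1 + \<kappa>) * B1 / \<kappa> ^ 4 < L"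
      using big by (auto simp: L0_def L_def)
    have "\<delta> < R"
    proof (rule ccontr)
      assume "\<not> \<delta> < R"
      then have "R / \<delta> \<le> 1" using \<delta>pos by simp
      then have "ln (R / \<delta>) \<le> ln 1" using R \<delta>pos by (subst ln_le_cancel_iff) auto
      then show False using L by (simp add: L_def)
    qed
    then have \<delta>R': "\<delta> \<le> R'" using R by simp
    have ll0: "l0 < l"
      using d r by (auto simp: l0_def l_def ln_div)
    then have l: "0 < l" using l0 by simp
    have dl: "exp (- l) = d" using d by (simp add: l_def ln_div)
    have I_le: "pi + 2 * pi * ln (R' / \<delta>) \<le> 2 * pi * (1 + \<kappa>) * L"
    proof -
      have "ln (R' / \<delta>) = ln (R' / R) + L"
        using R \<delta>pos by (simp add: L_def ln_div)
      moreover have "1 / 2 + ln (R' / R) \<le> \<kappa> * L"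
        using L(2) \<kappa> by (simp add: field_simps)
      ultimately have "2 * pi * (1 / 2 + ln (R' / \<delta>)) \<le> 2 * pi * ((1 + \<kappa>) * L)"
        by (intro mult_left_mono) (auto simp: algebra_simps)
      then show ?thesis by (simp add: algebra_simps)
    qed
    have I0: "0 \<le> pi + 2 * pi * ln (R' / \<delta>)"
      using \<delta>pos \<delta>R' by simp
    define v where "v x = max (norm (f (log_polar z x) - f z)) \<delta>" for x
    define \<theta>0 where "\<theta>0 = Arg (- z)"
    \<comment> \<open>Starting the full turn opposite to the inward direction makes its angular
      interval contain that of the sector.\<close>
    let ?c = "\<theta>0 - pi"
    have Mz: "(\<integral>\<^sup>+y. ennreal (exp (p * Kf y)) * indicator (cball z 1) y \<partial>lborel) \<le> ennreal M"
    proof (rule order_trans[OF _ M(2)], rule nn_integral_mono)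
      fix y
      have "y \<in> cball z 1 \<Longrightarrow> y \<in> cball 0 2"
        using norm_triangle_ineq[of "y - z" z] zw by (auto simp: dist_norm norm_minus_commute)
      then show "ennreal (exp (p * Kf y)) * indicator (cball z 1) y \<le> ennreal (exp (p * Kf y)) * indicator (cball 0 2) y"
        by (auto simp: indicator_def)
    qed

    have "\<exists>s. - (1 + \<kappa>) * l < s \<and> s < - l \<and>
        (\<forall>\<theta>\<in>{?c..?c + 2 * pi}. \<forall>\<eta>\<in>{?c..?c + 2 * pi}. \<bar>ln (v (s, \<eta>)) - ln (v (s, \<theta>))\<bar> \<le> \<kappa> * L)"
    proof (rule ccontr)
      assume neg: "\<not> ?thesis"
      have "(((- l) - (- (1 + \<kappa>) * l)) * (\<kappa> * L))\<^sup>2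
          \<le> (2 * pi * ((- l) - (- (1 + \<kappa>) * l)) * (- 2 * (- (1 + \<kappa>) * l)) + M) / p * (pi + 2 * pi * ln (R' / \<delta>))"
      proof (rule circle_oscillation[OF W f dist Kf assms(1) Mz M(1) _ _ _ \<delta>pos \<delta>R' v_def, where c="?c"])
        show "- (1 + \<kappa>) * l < - l"
          using mult_pos_pos[OF \<kappa>(1) l] by (simp add: algebra_simps)
        show "- l \<le> 0" using l by simp
        show "norm (f x - f z) \<le> R'" if "x \<in> cball z 1" for x
          using le_R'[OF zw(1)] that by (simp add: dist_norm norm_minus_commute)
        show "0 \<le> \<kappa> * L" using \<kappa> L by simp
        show "\<exists>\<theta>\<in>{?c..?c + 2 * pi}. \<exists>\<eta>\<in>{?c..?c + 2 * pi}. \<kappa> * L < \<bar>ln (v (s, \<eta>)) - ln (v (s, \<theta>))\<bar>"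
          if "- (1 + \<kappa>) * l < s" "s < - l" for s
          using neg that by (meson not_less)
      qed
      also have "(2 * pi * ((- l) - (- (1 + \<kappa>) * l)) * (- 2 * (- (1 + \<kappa>) * l)) + M) / p * (pi + 2 * pi * ln (R' / \<delta>))
          \<le> (B1 * l\<^sup>2) * (2 * pi * (1 + \<kappa>) * L)"
      proof (intro mult_mono I_le I0)
        have "M = M / l0\<^sup>2 * l0\<^sup>2" using l0 by simp
        also have "\<dots> \<le> M / l0\<^sup>2 * l\<^sup>2"
          using ll0 l0 M by (intro mult_left_mono power_mono) auto
        finally have "4 * pi * \<kappa> * (1 + \<kappa>) * l\<^sup>2 + M \<le> (4 * pi * \<kappa> * (1 + \<kappa>) + M / l0\<^sup>2) * l\<^sup>2"
          by (simp add: distrib_right)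
        then have "(4 * pi * \<kappa> * (1 + \<kappa>) * l\<^sup>2 + M) / p \<le> (4 * pi * \<kappa> * (1 + \<kappa>) + M / l0\<^sup>2) * l\<^sup>2 / p"
          using assms(1) by (intro divide_right_mono) auto
        moreover have "2 * pi * ((- l) - (- (1 + \<kappa>) * l)) * (- 2 * (- (1 + \<kappa>) * l)) = 4 * pi * \<kappa> * (1 + \<kappa>) * l\<^sup>2"
          by (simp add: power2_eq_square algebra_simps)
        ultimately show "(2 * pi * ((- l) - (- (1 + \<kappa>) * l)) * (- 2 * (- (1 + \<kappa>) * l)) + M) / p \<le> B1 * l\<^sup>2"
          by (simp only: B1_def times_divide_eq_left)
        show "0 \<le> B1 * l\<^sup>2"
          unfolding B1_def using \<kappa> M assms(1) l0 by (intro mult_nonneg_nonneg divide_nonneg_pos add_nonneg_nonneg) auto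
      qed
      \<comment> \<open>Both sides carry the factor \<open>l\<^sup>2 * L\<close>. Cancelling it
        leaves a bound for \<open>L\<close> in which neither \<open>d\<close> nor \<open>z\<close>
        occurs, contradicting the third threshold in \<open>L0\<close>.\<close>
      also have "(((- l) - (- (1 + \<kappa>) * l)) * (\<kappa> * L))\<^sup>2 = (l\<^sup>2 * L) * (\<kappa> ^ 4 * L)"
        by (simp add: power2_eq_square power4_eq_xxxx algebra_simps)
      also have "(B1 * l\<^sup>2) * (2 * pi * (1 + \<kappa>) * L) = (l\<^sup>2 * L) * (2 * pi * (1 + \<kappa>) * B1)"
        by (simp only: mult.commute mult.left_commute)
      finally have "\<kappa> ^ 4 * L \<le> 2 * pi * (1 + \<kappa>) * B1"
        by (rule mult_left_le_imp_le) (use l L in auto)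
      then have "L \<le> 2 * pi * (1 + \<kappa>) * B1 / \<kappa> ^ 4"
        using \<kappa> by (simp add: pos_le_divide_eq mult.commute)
      then show False using L(3) by simp
    qed
    then obtain s where s: "- (1 + \<kappa>) * l < s" "s < - l"
      and good: "\<And>\<theta> \<eta>. \<theta> \<in> {?c..?c + 2 * pi} \<Longrightarrow> \<eta> \<in> {?c..?c + 2 * pi} \<Longrightarrow> \<bar>ln (v (s, \<eta>)) - ln (v (s, \<theta>))\<bar> \<le> \<kappa> * L"
      by blast
    have "exp s \<le> norm (w - z)"
      using s dl d by (metis exp_less_cancel_iff less_imp_le)
    then obtain x where x: "norm (x - z) = exp s" "norm (f x - f z) \<le> norm (f w - f z)"
      using circle_meets_preimage_of_segment[OF g, of "exp s" w z] by auto
    then have "x \<noteq> z" by auto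
    then obtain \<theta>1 where \<theta>1: "?c \<le> \<theta>1" "\<theta>1 < ?c + 2 * pi" "x = log_polar z (ln (norm (x - z)), \<theta>1)"
      by (rule log_polar_surj)
    \<comment> \<open>At the crossing point the displacement is at most \<delta>, so the truncated
      value is exactly \<delta>, the minimum of \<open>v\<close>. The small oscillation spreads this
      bound over the whole circle.\<close>
    then have v1: "v (s, \<theta>1) = \<delta>"
      using x by (simp add: v_def \<delta>)
    have inner: "ln (v (s, \<theta>)) \<le> ln \<delta> + \<kappa> * L" if "\<theta> \<in> {?c..?c + 2 * pi}" for \<theta>
      using good[of \<theta>1 \<theta>] \<theta>1 that v1 by auto

    have "l0 = - ln r" using r by (simp add: l0_def ln_div)
    then have sr: "s < ln r" using s ll0 by simp
    have "(((\<theta>0 + \<beta>) - (\<theta>0 - \<beta>)) * ((1 - \<kappa>) * L))\<^sup>2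
        \<le> K * ((ln r - s) * ((\<theta>0 + \<beta>) - (\<theta>0 - \<beta>))) * (pi + 2 * pi * ln (R' / \<delta>))"
    proof (rule sector_estimate[OF Wq1 open_ball f distq assms(2) _ _ _ _ _ \<delta>pos \<delta>R' v_def])
      show "s < ln r" by (rule sr)
      show "\<theta>0 - \<beta> < \<theta>0 + \<beta>" "\<theta>0 + \<beta> \<le> \<theta>0 - \<beta> + 2 * pi" using \<beta> by auto
      show sub: "log_polar z ` ({s..ln r} \<times> {\<theta>0 - \<beta>..\<theta>0 + \<beta>}) \<subseteq> ball 0 1"
      proof clarify
        fix t \<theta> assume t: "t \<in> {s..ln r}" and \<theta>: "\<theta> \<in> {\<theta>0 - \<beta>..\<theta>0 + \<beta>}"
        have "exp t \<le> r" using t r by (simp add: ln_ge_iff)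
        moreover have "log_polar z (t, \<theta>) = z + of_real (exp t) * cis \<theta>"
          by (simp add: log_polar_def Complex_eq exp_add exp_of_real cis_conv_exp mult.commute)
        ultimately show "log_polar z (t, \<theta>) \<in> ball 0 1"
          using sector_subset_ball[OF zw(1) \<beta>, of "exp t" \<theta>] r \<theta> by (auto simp: \<theta>0_def abs_le_iff)
      qed
      show "norm (f x - f z) \<le> R'" if xin: "x \<in> log_polar z ` ({s..ln r} \<times> {\<theta>0 - \<beta>..\<theta>0 + \<beta>})" for x
      proof (rule le_R'[OF zw(1)])
        obtain y where y: "x = log_polar z y" "fst y \<le> ln r" using xin by auto
        then have "norm (x - z) = exp (fst y)" by (simp add: norm_log_polar)
        also have "\<dots> \<le> r" using y r by (simp add: ln_ge_iff)
        finally show "norm (x - z) \<le> 1" using r by simp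
      qed
      show "0 \<le> (1 - \<kappa>) * L" using \<kappa> L by simp
      show "(1 - \<kappa>) * L \<le> ln (v (ln r, \<theta>)) - ln (v (s, \<theta>))" if \<theta>: "\<theta>0 - \<beta> \<le> \<theta>" "\<theta> \<le> \<theta>0 + \<beta>" for \<theta>
      proof -
        have "norm (log_polar z (ln r, \<theta>) - z) = r"
          using r by (simp add: norm_log_polar)
        then have "R \<le> v (ln r, \<theta>)"
          using R_le[OF zw(1)] by (simp add: v_def le_max_iff_disj)
        then have "ln R \<le> ln (v (ln r, \<theta>))"
          using R by simp
        moreover have "ln (v (s, \<theta>)) \<le> ln \<delta> + \<kappa> * L"
          using \<theta> \<beta> by (intro inner) auto
        moreover have "L = ln R - ln \<delta>"
          using R \<delta>pos by (simp add: L_def ln_div)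
        moreover have "(1 - \<kappa>) * L = L - \<kappa> * L"
          by (simp add: left_diff_distrib)
        ultimately show ?thesis by linarith
      qed
    qed
    \<comment> \<open>As \<open>ln r \<le> 0\<close>, the logarithmic length of the radii is at most
      \<open>- s\<close>, hence at most \<open>(1 + \<kappa>) * l\<close>.\<close>
    also have "\<dots> \<le> K * (((1 + \<kappa>) * l) * (2 * \<beta>)) * (2 * pi * (1 + \<kappa>) * L)"
    proof (intro mult_mono I_le I0)
      have "ln r \<le> 0" using r by simp
      then show "ln r - s \<le> (1 + \<kappa>) * l"
        using s(1) minus_mult_left[of "1 + \<kappa>" l] by linarith
    qed (use assms(2) \<kappa> l \<beta> sr in \<open>auto simp: zero_le_mult_iff\<close>)
    finally have est: "(2 * \<beta> * ((1 - \<kappa>) * L))\<^sup>2 \<le> K * (((1 + \<kappa>) * l) * (2 * \<beta>)) * (2 * pi * (1 + \<kappa>) * L)"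
      by (simp add: mult.commute)
    \<comment> \<open>One factor \<open>2 * \<beta> * L\<close> cancels. Multiplying by
      \<open>1 + \<kappa>\<close> then turns the remaining \<open>2 * \<beta>\<close> into
      pi.\<close>
    have "(2 * \<beta> * L) * (2 * \<beta> * (1 - \<kappa>)\<^sup>2 * L) \<le> (2 * \<beta> * L) * (2 * pi * K * (1 + \<kappa>)\<^sup>2 * l)"
      using est by (simp add: power2_eq_square algebra_simps)
    then have "2 * \<beta> * (1 - \<kappa>)\<^sup>2 * L \<le> 2 * pi * K * (1 + \<kappa>)\<^sup>2 * l"
      by (rule mult_left_le_imp_le) (use \<beta> L in auto)
    then have "(1 + \<kappa>) * (2 * \<beta> * (1 - \<kappa>)\<^sup>2 * L) \<le> (1 + \<kappa>) * (2 * pi * K * (1 + \<kappa>)\<^sup>2 * l)"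
      using \<kappa> by (intro mult_left_mono) auto
    moreover have "(1 + \<kappa>) * (2 * \<beta> * (1 - \<kappa>)\<^sup>2 * L) = pi * ((1 - \<kappa>)\<^sup>2 * L)"
    proof -
      have "(1 + \<kappa>) * (2 * \<beta>) = pi" unfolding two_\<beta> using \<kappa> by simp
      then show ?thesis by (metis mult.assoc)
    qed
    moreover have "(1 + \<kappa>) * (2 * pi * K * (1 + \<kappa>)\<^sup>2 * l) = pi * (2 * K * l * (1 + \<kappa>) ^ 3)"
      by (simp add: power2_eq_square power3_eq_cube algebra_simps)
    ultimately have "pi * ((1 - \<kappa>)\<^sup>2 * L) \<le> pi * (2 * K * l * (1 + \<kappa>) ^ 3)" by simp
    then have "(1 - \<kappa>)\<^sup>2 * L \<le> 2 * K * l * (1 + \<kappa>) ^ 3"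
      by (rule mult_left_le_imp_le) simp
    also have "\<dots> \<le> 2 * K * l * ((1 + \<epsilon>) * (1 - \<kappa>)\<^sup>2)"
      using \<kappa> assms(2) l by (intro mult_left_mono) auto
    also have "\<dots> = (1 - \<kappa>)\<^sup>2 * (e * l)"
      by (simp add: e_def)
    finally have "L \<le> e * l"
      by (rule mult_left_le_imp_le) (use \<kappa> in simp)
    then show ?thesis by (simp add: L_def l_def)
  qed

  \<comment> \<open>For nearby points with large \<open>L\<close> the constant \<open>R\<close>
    suffices. For nearby points with \<open>L \<le> L0\<close> the displacement is at least
    \<open>R * exp (- L0)\<close>, and for distant points at least \<open>c1\<close>. In the last
    two cases \<open>2 powr e\<close> bounds the power of the distance, which is at most 2.\<close>
  define c where "c = min R (min (R * exp (- L0)) c1 / 2 powr e)"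
  have "0 < c"
    using R \<open>0 < c1\<close> by (simp add: c_def)
  moreover have "c * norm (z - w) powr e \<le> norm (f z - f w)" if z: "z \<in> cball 0 1" and w: "w \<in> cball 0 1" for z w
  proof (cases "z = w")
    case False
    define d \<delta> where "d = norm (w - z)" and "\<delta> = norm (f w - f z)"
    have "0 < d" "0 < \<delta>" using False f(2) by (auto simp: d_def \<delta>_def inj_def)
    have nz: "norm z \<le> 1" "norm w \<le> 1" using z w by auto
    have "d \<le> 2" using norm_triangle_ineq4[of w z] nz by (simp add: d_def)
    then have dpow: "d powr e \<le> 2 powr e"
      using \<open>0 < d\<close> \<open>0 < e\<close> by (intro powr_mono2) auto
    have trivial: "c * d powr e \<le> \<delta>" if "min (R * exp (- L0)) c1 \<le> \<delta>"
    proof -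
      have "0 < min (R * exp (- L0)) c1 / 2 powr e"
        using R \<open>0 < c1\<close> by simp
      then have "c * d powr e \<le> (min (R * exp (- L0)) c1 / 2 powr e) * 2 powr e"
        using dpow by (intro mult_mono) (auto simp only: c_def min.cobounded2 powr_ge_zero less_imp_le)
      also have "\<dots> = min (R * exp (- L0)) c1"
        by (rule nonzero_eq_divide_eq[THEN iffD1, OF _ refl]) simp
      also note that
      finally show ?thesis .
    qed
    have "c * d powr e \<le> \<delta>"
    proof (cases "r \<le> d")
      case True
      then have "c1 \<le> \<delta>" using far[OF nz(2,1)] by (simp add: d_def \<delta>_def)
      then show ?thesis by (intro trivial) (simp add: min_le_iff_disj)
    next
      case False
      show ?thesis
      proof (cases "L0 < ln (R / \<delta>)")
        case True
        then have "ln (R / \<delta>) \<le> e * ln (1 / d)"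
          using key[OF nz d_def \<open>0 < d\<close> _ \<delta>_def] False by simp
        then have "ln R + e * ln d \<le> ln \<delta>"
          using R \<open>0 < \<delta>\<close> \<open>0 < d\<close> by (simp add: ln_div)
        then have "exp (ln R + e * ln d) \<le> exp (ln \<delta>)" by simp
        then have "R * d powr e \<le> \<delta>"
          using R \<open>0 < \<delta>\<close> \<open>0 < d\<close> by (simp add: exp_add powr_def)
        moreover have "c * d powr e \<le> R * d powr e"
          by (intro mult_right_mono) (auto simp: c_def)
        ultimately show ?thesis by linarith
      next
        case F: False
        then have "ln R - L0 \<le> ln \<delta>"
          using R \<open>0 < \<delta>\<close> by (simp add: ln_div)
        then have "exp (ln R - L0) \<le> exp (ln \<delta>)" by simp
        then have "R * exp (- L0) \<le> \<delta>"
          using R \<open>0 < \<delta>\<close> by (simp add: exp_diff exp_minus field_simps)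
        then show ?thesis by (intro trivial) (simp add: min_le_iff_disj)
      qed
    qed
    then show ?thesis by (simp add: d_def \<delta>_def norm_minus_commute)
  \<comment> \<open>For \<open>z = w\<close> both sides vanish, since
    \<open>0 powr e = 0\<close>.\<close>
  qed simp
  ultimately show ?thesis
    unfolding e_def by blast
qed

end
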